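(* Let $f:\mathbb{R}^n\to\mathbb{R}$ be locally Lipschitz and definable in an o-minimal structure on the real field, let $U\subseteq\mathbb{R}^n$ be a bounded convex open set, and let $c:\mathbb{R}^n\to\mathbb{R}\cup\{\infty\}$ be $C^4$ on $U$. Suppose there exists $\omega>0$ such that for all $x\in U$ and all $v\in\overline\nabla f(x)$, $$\langle\nabla c(x),v\rangle=0\quad\text{and}\quad\langle\nabla^2c(x)v,v\rangle\le-\omega|v|^2 .$$ Let $I$ be a compact interval of $\mathbb{R}$ containing $t_0$, and let $x:I\to U$ satisfy $\dot x=-\nabla c(x)$ on $I$. Let $s,t\in I$ with $s<t$. (i) If $f$ is (locally Lipschitz and) regular, then $\operatorname{lip}f(x(t))\le e^{-\omega(t-s)/2}\operatorname{lip}f(x(s))$. (ii) Let $k\ge1$ be an integer. If $c$ is $C^{k+1}$ on $U$, $f$ is $D^k$, and $f^{(i)}(x(t_0))=0$ for all $i\in\{1,\dots,k-1\}$, then $\|f^{(k)}(x(t))\|\le e^{-k\omega(t-s)/2}\|f^{(k)}(x(s))\|$. Moreover, if $\operatorname{lip}f(x(t_0))>0$ in case (i), or $\|f^{(k)}(x(t_0))\|>0$ in case (ii), then $x(t)\prec x(s)$.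
   Context: For locally Lipschitz $f$, $\overline\nabla f(x)$ is the set of all limits $\lim_k\nabla f(x_k)$ with $x_k\to x$ and $f$ differentiable at each $x_k$. The Lipschitz modulus is $\operatorname{lip}f(x)=\limsup_{y,z\to x,\,y\ne z}|f(y)-f(z)|/|y-z|$. "Regular" means subdifferentially regular in the sense of Rockafellar–Wets at every point: the epigraph of $f$ is locally closed and its regular normal cone coincides with its limiting normal cone at $(x,f(x))$. $f$ is $D^1$ at a point if Fréchet differentiable there; inductively $f$ is $D^k$ at a point if it is $D^{k-1}$ near it and $f^{(k-1)}$ is Fréchet differentiable at it; $f$ is $D^k$ if it is so at every point. $\|f^{(k)}(x)\|=\sup_{|v|=1}|f^{(k)}(x)(v,\dots,v)|$. With $\mathring f(x,r)=\sup_{y\in\overline B_r(x)}|f(y)-f(x)|$ ($\overline B_r(x)$ the closed Euclidean ball), write $x\preceq y$ iff there exists $\overline r>0$ with $\mathring f(x,r)\le\mathring f(y,r)$ for all $r\in(0,\overline r]$, and $x\prec y$ iff $x\preceq y$ and not $y\preceq x$. Definability is with respect to a fixed, arbitrary o-minimal structure on the real field. *)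

theory Defs
  imports "HOL-Analysis.Analysis"
begin

section \<open>O-minimal structures and definable functions\<close>

text \<open>
  A point of \<open>\<real>\<^sup>m\<close>, with \<open>m\<close> varying, is a real list of length \<open>m\<close>; \<open>S m\<close> is the
  family of definable subsets of \<open>\<real>\<^sup>m\<close>. In the last clause \<open>is_interval\<close> includes the
  empty set, singletons and unbounded intervals, so \<open>S 1\<close> consists exactly of the finite
  unions of points and open intervals.
\<close>

definition o_minimal_structure :: "(nat \<Rightarrow> real list set set) \<Rightarrow> bool" where
  "o_minimal_structure S \<longleftrightarrow>
     (\<forall>m. \<forall>A\<in>S m. A \<subseteq> {xs. length xs = m}) \<and>
     (\<forall>m. {} \<in> S m) \<and>
     (\<forall>m. \<forall>A\<in>S m. {xs. length xs = m} - A \<in> S m) \<and>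
     (\<forall>m. \<forall>A\<in>S m. \<forall>B\<in>S m. A \<union> B \<in> S m) \<and>
     (\<forall>m. \<forall>A\<in>S m. {r # xs | r xs. xs \<in> A} \<in> S (Suc m) \<and>
                    {xs @ [r] | r xs. xs \<in> A} \<in> S (Suc m)) \<and>
     (\<forall>m. \<forall>i<m. \<forall>j<m. {xs. length xs = m \<and> xs ! i = xs ! j} \<in> S m) \<and>
     (\<forall>m. \<forall>A\<in>S (Suc m). butlast ` A \<in> S m) \<and>
     {[a, b, a + b] | a b. True} \<in> S 3 \<and>
     {[a, b, a * b] | a b. True} \<in> S 3 \<and>
     S 1 = {(\<lambda>r. [r]) ` (\<Union>\<J>) | \<J>. finite \<J> \<and> (\<forall>J\<in>\<J>. is_interval J)}"

text \<open>
  The graph of \<open>f\<close> is read as a subset of \<open>\<real>\<^sup>n\<^sup>+\<^sup>1\<close> through an enumeration \<open>e\<close> of the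
  coordinates. An o-minimal structure is closed under permutation of coordinates, so the choice
  of \<open>e\<close> is immaterial.
\<close>

definition definable_in :: "(nat \<Rightarrow> real list set set) \<Rightarrow> (real ^ 'n \<Rightarrow> real) \<Rightarrow> bool" where
  "definable_in S f \<longleftrightarrow>
     (\<exists>e. bij_betw e {..<CARD('n)} (UNIV :: 'n set) \<and>
          {map (\<lambda>i. x $ e i) [0..<CARD('n)] @ [f x] | x. True} \<in> S (Suc CARD('n)))"


section \<open>First-order notions\<close>

definition locally_Lipschitz :: "('a::metric_space \<Rightarrow> 'b::metric_space) \<Rightarrow> bool" where
  "locally_Lipschitz f \<longleftrightarrow> (\<forall>x. \<exists>\<epsilon>>0. \<exists>L. L-lipschitz_on (ball x \<epsilon>) f)"

definition gradient :: "('a::real_inner \<Rightarrow> real) \<Rightarrow> 'a \<Rightarrow> 'a" where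
  "gradient f x = (THE D. GDERIV f x :> D)"

definition hessian :: "('a::real_inner \<Rightarrow> real) \<Rightarrow> 'a \<Rightarrow> 'a \<Rightarrow> 'a" where
  "hessian f x = frechet_derivative (gradient f) (at x)"

definition limiting_gradients :: "('a::real_inner \<Rightarrow> real) \<Rightarrow> 'a \<Rightarrow> 'a set" where
  "limiting_gradients f x =
     {v. \<exists>X. X \<longlonglongrightarrow> x \<and> (\<forall>k. f differentiable (at (X k))) \<and>
             (\<lambda>k. gradient f (X k)) \<longlonglongrightarrow> v}"

definition lip :: "('a::real_normed_vector \<Rightarrow> real) \<Rightarrow> 'a \<Rightarrow> ereal" where
  "lip f x =
     Limsup (at (x, x) within {p. fst p \<noteq> snd p})
            (\<lambda>p. ereal (\<bar>f (fst p) - f (snd p)\<bar> / norm (fst p - snd p)))"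


section \<open>Subdifferential regularity\<close>

definition locally_closed_at :: "'a::topological_space set \<Rightarrow> 'a \<Rightarrow> bool" where
  "locally_closed_at C p \<longleftrightarrow> (\<exists>V. closed V \<and> p \<in> interior V \<and> closed (C \<inter> V))"

text \<open>
  The vectors \<open>v\<close> with \<open>v \<bullet> (z - p) \<le> o(norm (z - p))\<close> for \<open>z\<close> in \<open>C\<close>; used only at
  points \<open>p\<close> of \<open>C\<close>.
\<close>

definition regular_normal_cone :: "'a::real_inner set \<Rightarrow> 'a \<Rightarrow> 'a set" where
  "regular_normal_cone C p =
     {v. \<forall>\<epsilon>>0. \<forall>\<^sub>F z in at p within C. v \<bullet> (z - p) \<le> \<epsilon> * norm (z - p)}"

definition limiting_normal_cone :: "'a::real_inner set \<Rightarrow> 'a \<Rightarrow> 'a set" where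
  "limiting_normal_cone C p =
     {v. \<exists>P V. (\<forall>k. P k \<in> C \<and> V k \<in> regular_normal_cone C (P k)) \<and>
               P \<longlonglongrightarrow> p \<and> V \<longlonglongrightarrow> v}"

definition subdiff_regular_at :: "('a::real_inner \<Rightarrow> real) \<Rightarrow> 'a \<Rightarrow> bool" where
  "subdiff_regular_at f x \<longleftrightarrow>
     locally_closed_at (epigraph UNIV f) (x, f x) \<and>
     regular_normal_cone (epigraph UNIV f) (x, f x) =
       limiting_normal_cone (epigraph UNIV f) (x, f x)"

definition subdiff_regular :: "('a::real_inner \<Rightarrow> real) \<Rightarrow> bool" where
  "subdiff_regular f \<longleftrightarrow> (\<forall>x. subdiff_regular_at f x)"


section \<open>Higher-order derivatives\<close>

text \<open>
  The \<open>k\<close>-th derivative at \<open>x\<close> is a \<open>k\<close>-linear form, whose arguments are given as a list of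
  length \<open>k\<close>: \<open>f\<^sup>(\<^sup>k\<^sup>+\<^sup>1\<^sup>)(x)(v, w\<^sub>1, \<dots>, w\<^sub>k)\<close> is the derivative of
  \<open>y \<mapsto> f\<^sup>(\<^sup>k\<^sup>)(y)(w\<^sub>1, \<dots>, w\<^sub>k)\<close> at \<open>x\<close> in direction \<open>v\<close>. As the \<open>k\<close>-linear forms on a
  Euclidean space form a finite-dimensional space, Frechet differentiability and continuity of
  \<open>y \<mapsto> f\<^sup>(\<^sup>k\<^sup>)(y)\<close> are those of its evaluations at all argument lists.
\<close>

primrec nth_derivative :: "nat \<Rightarrow> ('a::euclidean_space \<Rightarrow> real) \<Rightarrow> 'a \<Rightarrow> 'a list \<Rightarrow> real" where
  "nth_derivative 0 f x vs = f x"
| "nth_derivative (Suc k) f x vs =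
     frechet_derivative (\<lambda>y. nth_derivative k f y (tl vs)) (at x) (hd vs)"

text \<open>
  \<open>D_at 0\<close> is vacuous, so that \<open>D_at 1 f x\<close> is just Frechet differentiability of \<open>f\<close> at \<open>x\<close>.
\<close>

primrec D_at :: "nat \<Rightarrow> ('a::euclidean_space \<Rightarrow> real) \<Rightarrow> 'a \<Rightarrow> bool" where
  "D_at 0 f x \<longleftrightarrow> True"
| "D_at (Suc k) f x \<longleftrightarrow>
     (\<forall>\<^sub>F y in nhds x. D_at k f y) \<and>
     (\<forall>vs. length vs = k \<longrightarrow> (\<lambda>y. nth_derivative k f y vs) differentiable (at x))"

definition C_on :: "nat \<Rightarrow> 'a::euclidean_space set \<Rightarrow> ('a \<Rightarrow> real) \<Rightarrow> bool" where
  "C_on k U f \<longleftrightarrow>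
     (\<forall>x\<in>U. D_at k f x) \<and>
     (\<forall>vs. length vs = k \<longrightarrow> continuous_on U (\<lambda>x. nth_derivative k f x vs))"

definition nth_derivative_norm :: "nat \<Rightarrow> ('a::euclidean_space \<Rightarrow> real) \<Rightarrow> 'a \<Rightarrow> real" where
  "nth_derivative_norm k f x =
     (SUP v\<in>sphere 0 1. \<bar>nth_derivative k f x (replicate k v)\<bar>)"


section \<open>The preorder of local variation\<close>

definition local_variation :: "('a::real_normed_vector \<Rightarrow> real) \<Rightarrow> 'a \<Rightarrow> real \<Rightarrow> real" where
  "local_variation f x r = (SUP y\<in>cball x r. \<bar>f y - f x\<bar>)"

definition flatter_eq :: "('a::real_normed_vector \<Rightarrow> real) \<Rightarrow> 'a \<Rightarrow> 'a \<Rightarrow> bool" where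
  "flatter_eq f x y \<longleftrightarrow>
     (\<exists>r'>0. \<forall>r\<in>{0<..r'}. local_variation f x r \<le> local_variation f y r)"

definition flatter :: "('a::real_normed_vector \<Rightarrow> real) \<Rightarrow> 'a \<Rightarrow> 'a \<Rightarrow> bool" where
  "flatter f x y \<longleftrightarrow> flatter_eq f x y \<and> \<not> flatter_eq f y x"

end

theory Submission
  imports Defs
begin

text \<open>
  Since \<open>f\<close> is constant along solutions of \<open>u' = - \<nabla>c(u)\<close>, the flow between two nearby times is a
  bi-Lipschitz change of variables \<open>\<phi>\<close> with \<open>f \<circ> \<phi> = f\<close>. Backwards over a short time \<open>h\<close> it is
  \<open>y \<mapsto> y + h \<nabla>c(y)\<close> to first order, so it shrinks displacements \<open>v\<close> with \<open>\<nabla>\<^sup>2c(v, v) \<le> - \<omega>|v|\<^sup>2\<close> by at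
  least the factor \<open>1 - h\<omega>/2\<close>; the slack in the exponent absorbs all second-order errors. The
  directions responsible for the size of \<open>f\<close> (gradients in case (i), maximisers of the leading form
  \<open>f\<^sup>(\<^sup>k\<^sup>)\<close> in case (ii), which are limits of normalised gradients) satisfy this curvature bound. Comparing
  \<open>f\<close> near \<open>x(t)\<close> with \<open>f\<close> near \<open>x(s)\<close> through \<open>\<phi>\<close> gives the decay.

  For regular \<open>f\<close>, Clarke's directional derivative is both a one-sided derivative and upper
  semicontinuous in the base point, so by Baire's theorem \<open>f\<close> is differentiable on a dense set; the
  invariance of \<open>f\<close> and its Lipschitz modulus can be read off from the gradients there.
\<close>

section \<open>Mean value theorems and regularity\<close>

text \<open>The hypothesis on curvature speaks about \<open>f\<close> only through limiting
  gradients, so each case must convert gradients into differences of values. In case (ii) the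
  gradient at \<open>x t\<close> vanishes as soon as \<open>k\<close> exceeds 1, and the hypothesis
  at that point says nothing about the leading form; the bound for a maximiser has to be imported
  from gradients at nearby points. In case (i) the conversion is a mean value theorem: a steep
  difference quotient yields a proximal subgradient nearby, regularity moves it to the base point,
  and the one-sided slopes obtained in this way lead to differentiability points with equally long
  gradients. The flow maps are only known to be Lipschitz, so derivatives are never pushed through
  them. What travels along the trajectory is the growth of \<open>f\<close> about a point, and
  Taylor's formula translates it back into derivatives. It must travel in both time directions,
  because \<open>t\<^sub>0\<close> may lie on either side of \<open>s\<close> and \<open>t\<close>.
  All estimates are made on short time intervals and glued by bisection, which works because the
  exponential is multiplicative.\<close>

lemma le_if_right_Dini_nonneg:
  fixes g :: "real \<Rightarrow> real"
  assumes "a \<le> b" and cont: "continuous_on {a..b} g"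
    and dini: "\<And>t e. a \<le> t \<Longrightarrow> t < b \<Longrightarrow> 0 < e \<Longrightarrow> \<forall>\<^sub>F h in at_right 0. g t - e * h \<le> g (t + h)"
  shows "g a \<le> g b"
proof (rule field_le_epsilon)
  fix e :: real assume "0 < e"
  \<comment> \<open>A line of slope \<open>- d\<close> loses at most \<open>e\<close> over the whole
    interval; the 1 guards against \<open>a = b\<close>. The Dini condition pushes the last point
    where \<open>g\<close> stays above that line to the right, up to \<open>b\<close>.\<close>
  define d where "d = e / (b - a + 1)"
  have d: "0 < d" "d * (b - a) \<le> e" using \<open>0 < e\<close> \<open>a \<le> b\<close> by (auto simp: d_def field_simps)
  define S where "S = {t \<in> {a..b}. g a - d * (t - a) \<le> g t}"
  have "closed S"
    unfolding S_def by (rule continuous_on_closed_Collect_le) (auto intro!: continuous_intros cont)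
  then have "compact S" unfolding compact_eq_bounded_closed
    by (auto simp: S_def intro: bounded_subset[OF bounded_closed_interval])
  moreover have "a \<in> S" using \<open>a \<le> b\<close> by (simp add: S_def)
  ultimately obtain m where m: "m \<in> S" "\<And>t. t \<in> S \<Longrightarrow> t \<le> m"
    using compact_attains_sup by (metis empty_iff)
  have "m = b"
  proof (rule ccontr)
    assume "m \<noteq> b"
    with m(1) have "a \<le> m" "m < b" by (auto simp: S_def)
    have "\<forall>\<^sub>F h in at_right 0. h < b - m \<and> 0 < h"
      using eventually_at_right_less[of "0::real"] eventually_at_right_real[of 0 "b - m"] \<open>m < b\<close>
      by (auto elim: eventually_mono)
    with dini[OF \<open>a \<le> m\<close> \<open>m < b\<close> d(1)]
    have "\<forall>\<^sub>F h in at_right 0. g m - d * h \<le> g (m + h) \<and> h < b - m \<and> 0 < h"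
      by eventually_elim auto
    then obtain h where "g m - d * h \<le> g (m + h)" "h < b - m" "0 < h"
      using eventually_happens trivial_limit_at_right_real by blast
    with m(1) have "m + h \<in> S" by (auto simp: S_def algebra_simps)
    with m(2) \<open>0 < h\<close> show False by fastforce
  qed
  with m(1) d(2) show "g a \<le> g b + e" by (auto simp: S_def)
qed

text \<open>Segment and evaluation point are decoupled: \<open>\<Psi>\<close> lets \<open>z\<close>
  leave the segment at a quadratic cost. At a minimum \<open>(z, s)\<close>, varying
  \<open>z\<close> gives a quadratic minorant of \<open>f\<close> that touches at \<open>z\<close>
  with slope \<open>v\<close>, and moving \<open>s\<close> forward compares
  \<open>v \<bullet> w\<close> with \<open>a\<close>.\<close>

lemma proximal_mean_value:
  fixes f :: "'a::euclidean_space \<Rightarrow> real"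
  assumes lip: "L-lipschitz_on (cball x R) f" and "R' < R"
    and seg: "\<And>s. 0 \<le> s \<Longrightarrow> s \<le> t \<Longrightarrow> y + s *\<^sub>R w \<in> cball x R'"
    and "0 < t" and slope: "a * t < f (y + t *\<^sub>R w) - f y"
  shows "\<exists>z v N. z \<in> ball x R \<and> norm v \<le> 2 * L \<and> a \<le> v \<bullet> w \<and> 0 \<le> N \<and>
           (\<forall>z'\<in>cball x R. f z + v \<bullet> (z' - z) - N * (norm (z' - z))\<^sup>2 \<le> f z')"
proof -
  have L: "0 \<le> L" using lip by (rule lipschitz_on_nonneg)
  define gap where "gap = f (y + t *\<^sub>R w) - f y - a * t"
  have "0 < gap" using slope by (simp add: gap_def)
  \<comment> \<open>The first summand makes the penalty too expensive for \<open>z\<close> to reach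
    the sphere of radius \<open>R\<close>; the second gives
    \<open>L\<^sup>2 / (4 * N) < gap\<close>, which rules out a minimum at the end
    \<open>s = t\<close>.\<close>
  define N where "N = (L + 1) / (R - R') + (L\<^sup>2 + 1) / (4 * gap) "
  have "0 < L\<^sup>2 + 1" "0 < L + 1" using L by (simp_all add: add_nonneg_pos)
  then have "0 < (L + 1) / (R - R')" "0 < (L\<^sup>2 + 1) / (4 * gap)" using \<open>0 < gap\<close> \<open>R' < R\<close> by simp_all
  then have "0 < N" unfolding N_def by linarith
  have "L < N * (R - R')"
  proof -
    have "N * (R - R') = (L + 1) + (L\<^sup>2 + 1) / (4 * gap) * (R - R')"
      using \<open>R' < R\<close> by (simp add: N_def algebra_simps add_divide_distrib[symmetric] diff_divide_distrib[symmetric])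
         (simp add: field_simps)
    moreover have "0 \<le> (L\<^sup>2 + 1) / (4 * gap) * (R - R')" using \<open>0 < gap\<close> \<open>R' < R\<close> by simp
    ultimately show ?thesis by linarith
  qed
  have "L\<^sup>2 < 4 * N * gap"
  proof -
    have "4 * N * gap = 4 * ((L + 1) / (R - R')) * gap + (L\<^sup>2 + 1)"
    proof -
      have "4 * (c + d / (4 * gap)) * gap = 4 * c * gap + d" for c d :: real
        using \<open>0 < gap\<close> by (simp add: field_simps)
      then show ?thesis unfolding N_def .
    qed
    moreover have "0 \<le> 4 * ((L + 1) / (R - R')) * gap" using \<open>0 < gap\<close> \<open>R' < R\<close> L by simp
    ultimately show ?thesis by linarith
  qed
  define \<Psi> where "\<Psi> p = f (fst p) - a * snd p + N * (norm (fst p - (y + snd p *\<^sub>R w)))\<^sup>2" for p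
  have contf: "continuous_on (cball x R) f" using lip by (rule lipschitz_on_continuous_on)
  have "continuous_on (cball x R \<times> {0..t}) \<Psi>"
    unfolding \<Psi>_def
    by (intro continuous_intros continuous_on_compose2[OF contf]) auto
  moreover have "compact (cball x R \<times> {0..t})" by (intro compact_Times) auto
  moreover have y: "y \<in> cball x R" using seg[of 0] \<open>0 < t\<close> \<open>R' < R\<close> by auto
  then have "cball x R \<times> {0..t} \<noteq> {}" using \<open>0 < t\<close> by fastforce
  ultimately obtain p where p: "p \<in> cball x R \<times> {0..t}"
    "\<And>q. q \<in> cball x R \<times> {0..t} \<Longrightarrow> \<Psi> p \<le> \<Psi> q"
    using continuous_attains_inf by metis
  obtain z s where zs: "p = (z, s)" by force
  have z: "z \<in> cball x R" and s: "0 \<le> s" "s \<le> t" using p(1) zs by auto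
  define q where "q = y + s *\<^sub>R w"
  define d where "d = z - q"
  have q: "q \<in> cball x R'" unfolding q_def using seg s by auto
  then have qR: "q \<in> cball x R" using \<open>R' < R\<close> by auto
  have lipf: "\<bar>f u - f v\<bar> \<le> L * norm (u - v)" if "u \<in> cball x R" "v \<in> cball x R" for u v
    using lipschitz_onD[OF lip that] by (simp add: dist_norm)
  \<comment> \<open>Replacing \<open>z\<close> by its target \<open>q\<close> on the segment saves
    the whole penalty and costs at most \<open>L * norm d\<close>.\<close>
  have "\<Psi> (z, s) \<le> \<Psi> (q, s)" using p(2)[of "(q, s)"] zs qR s by auto
  then have "N * (norm d)\<^sup>2 \<le> f q - f z" by (simp add: \<Psi>_def d_def q_def)
  also have "\<dots> \<le> L * norm d" using lipf[OF qR z] by (simp add: d_def norm_minus_commute)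
  finally have "norm d * (N * norm d) \<le> norm d * L" by (simp add: power2_eq_square mult_ac)
  then have Nd: "N * norm d \<le> L" using L by (cases "norm d = 0") auto
  have "z \<in> ball x R"
  proof -
    have "N * norm d < N * (R - R')" using Nd \<open>L < N * (R - R')\<close> by simp
    then have "norm d < R - R'" using \<open>0 < N\<close> by simp
    moreover have "dist x z \<le> dist x q + norm d" using dist_triangle[of x z q] by (simp add: d_def dist_norm norm_minus_commute)
    ultimately show ?thesis using q by simp
  qed
  define v where "v = - (2 * N) *\<^sub>R d"
  have "norm v \<le> 2 * L" using Nd \<open>0 < N\<close> by (simp add: v_def)
  have sub: "f z + v \<bullet> (z' - z) - N * (norm (z' - z))\<^sup>2 \<le> f z'" if "z' \<in> cball x R" for z'
  proof -
    have "\<Psi> (z, s) \<le> \<Psi> (z', s)" using p(2)[of "(z', s)"] zs that s by auto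
    then have le: "f z + N * (norm d)\<^sup>2 \<le> f z' + N * (norm (z' - q))\<^sup>2" by (simp add: \<Psi>_def d_def q_def)
    have sq: "(norm (z' - q))\<^sup>2 = (norm d)\<^sup>2 + 2 * (d \<bullet> (z' - z)) + (norm (z' - z))\<^sup>2"
      unfolding d_def power2_norm_eq_inner by (simp add: algebra_simps inner_commute)
    have "N * (norm (z' - q))\<^sup>2 = N * (norm d)\<^sup>2 - v \<bullet> (z' - z) + N * (norm (z' - z))\<^sup>2"
      unfolding sq v_def by (simp add: distrib_left)
    with le show ?thesis by linarith
  qed
  \<comment> \<open>A forward variation of \<open>s\<close> must be available. At
    \<open>s = t\<close>, comparison with the start of the segment bounds \<open>gap\<close> by
    \<open>L * norm d - N * (norm d)\<^sup>2\<close>, which never exceeds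
    \<open>L\<^sup>2 / (4 * N)\<close>.\<close>
  have "s \<noteq> t"
  proof
    assume "s = t"
    have "\<Psi> (z, s) \<le> \<Psi> (y, 0)" using p(2)[of "(y, 0)"] zs y \<open>0 < t\<close> by auto
    then have "f z - a * t + N * (norm d)\<^sup>2 \<le> f y" by (simp add: \<Psi>_def d_def q_def \<open>s = t\<close>)
    moreover have "f q - f z \<le> L * norm d" using lipf[OF qR z] by (simp add: d_def norm_minus_commute)
    ultimately have "gap \<le> L * norm d - N * (norm d)\<^sup>2" by (simp add: gap_def q_def \<open>s = t\<close>)
    then have "4 * N * gap \<le> 4 * N * (L * norm d - N * (norm d)\<^sup>2)" using \<open>0 < N\<close> by simp
    also have "\<dots> = L\<^sup>2 - (L - 2 * N * norm d)\<^sup>2" by (simp add: power2_eq_square algebra_simps)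
    also have "\<dots> \<le> L\<^sup>2" by simp
    finally show False using \<open>L\<^sup>2 < 4 * N * gap\<close> by simp
  qed
  with s have "s < t" by simp
  have step: "a - v \<bullet> w \<le> N * (norm w)\<^sup>2 * h" if h: "0 < h" "h \<le> t - s" for h
  proof -
    have "\<Psi> (z, s) \<le> \<Psi> (z, s + h)" using p(2)[of "(z, s + h)"] zs z s that by auto
    then have "a * h + N * (norm d)\<^sup>2 \<le> N * (norm (d - h *\<^sub>R w))\<^sup>2"
      by (simp add: \<Psi>_def d_def q_def algebra_simps)
    also have "(norm (d - h *\<^sub>R w))\<^sup>2 = (norm d)\<^sup>2 - 2 * h * (d \<bullet> w) + h\<^sup>2 * (norm w)\<^sup>2"
      unfolding power2_norm_eq_inner by (simp add: algebra_simps inner_commute power2_eq_square)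
    finally have "a * h \<le> h * (v \<bullet> w) + N * (h * (h * (norm w)\<^sup>2))"
      by (simp add: v_def algebra_simps power2_eq_square)
    then have "h * (a - v \<bullet> w) \<le> h * (N * (norm w)\<^sup>2 * h)" by (simp add: algebra_simps)
    then show ?thesis using h by simp
  qed
  have "a \<le> v \<bullet> w"
  proof (rule ccontr)
    assume "\<not> a \<le> v \<bullet> w"
    define K where "K = N * (norm w)\<^sup>2 + 1"
    have "0 < K" using \<open>0 < N\<close> by (simp add: K_def add_nonneg_pos)
    define h where "h = min (t - s) ((a - v \<bullet> w) / (2 * K))"
    have h: "0 < h" "h \<le> t - s" using \<open>s < t\<close> \<open>0 < K\<close> \<open>\<not> a \<le> v \<bullet> w\<close> by (auto simp: h_def)
    have "K * h \<le> (a - v \<bullet> w) / 2" using \<open>0 < K\<close> by (simp add: h_def min_def field_simps)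
    moreover have "N * (norm w)\<^sup>2 * h \<le> K * h" using h by (simp add: K_def algebra_simps)
    ultimately show False using step[OF h] \<open>\<not> a \<le> v \<bullet> w\<close> by simp
  qed
  then show ?thesis using \<open>z \<in> ball x R\<close> \<open>norm v \<le> 2 * L\<close> \<open>0 < N\<close> sub by (meson less_imp_le)
qed

text \<open>The quadratic error is negligible against the distance, and moving up from the graph
  only lowers the inner product because the last entry is -1.\<close>

lemma proximal_subgradient_regular_normal:
  fixes f :: "'a::euclidean_space \<Rightarrow> real"
  assumes "0 < R" "0 \<le> N"
    and sub: "\<And>z'. z' \<in> ball z R \<Longrightarrow> f z + v \<bullet> (z' - z) - N * (norm (z' - z))\<^sup>2 \<le> f z'"
  shows "(v, -1) \<in> regular_normal_cone (epigraph UNIV f) (z, f z)"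
proof -
  have "\<forall>\<^sub>F p in at (z, f z) within epigraph UNIV f. (v, -1) \<bullet> (p - (z, f z)) \<le> e * norm (p - (z, f z))"
    if "0 < e" for e :: real
    unfolding eventually_at
  proof (intro exI[of _ "min R (e / (N + 1))"] conjI ballI impI)
    show "0 < min R (e / (N + 1))" using assms \<open>0 < e\<close> by simp
    fix p assume p: "p \<in> epigraph UNIV f" "p \<noteq> (z, f z) \<and> dist p (z, f z) < min R (e / (N + 1))"
    obtain z' r where zr: "p = (z', r)" by force
    have "f z' \<le> r" using p zr by (simp add: epigraph_def)
    define D where "D = norm (p - (z, f z))"
    have "norm (z' - z) \<le> D" using norm_fst_le[of "z' - z" "r - f z"] by (simp add: D_def zr)
    have D: "D < R" "D < e / (N + 1)" "0 \<le> D" using p by (auto simp: D_def dist_norm)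
    have "z' \<in> ball z R" using D \<open>norm (z' - z) \<le> D\<close> by (simp add: dist_norm norm_minus_commute)
    from sub[OF this] have "v \<bullet> (z' - z) - (r - f z) \<le> N * (norm (z' - z))\<^sup>2" using \<open>f z' \<le> r\<close> by simp
    also have "\<dots> \<le> (N + 1) * D\<^sup>2"
      using \<open>norm (z' - z) \<le> D\<close> \<open>0 \<le> N\<close> by (intro mult_mono power_mono) auto
    also have "\<dots> = ((N + 1) * D) * D" by (simp add: power2_eq_square)
    also have "\<dots> \<le> e * D" using D \<open>0 \<le> N\<close> by (intro mult_right_mono) (auto simp: field_simps)
    finally show "(v, -1) \<bullet> (p - (z, f z)) \<le> e * norm (p - (z, f z))" by (simp add: zr D_def)
  qed
  then show ?thesis by (simp add: regular_normal_cone_def)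
qed

text \<open>Here regularity enters. Steep quotients near \<open>x\<close> give proximal subgradients
  at points tending to \<open>x\<close>; the Lipschitz constant bounds them, so a subsequence
  converges to a limiting normal of the epigraph. Regularity makes it a regular normal at
  \<open>(x, f x)\<close> itself, and testing it on the graph over the ray in direction
  \<open>w\<close> gives a slope based at \<open>x\<close>.\<close>

lemma subdiff_regular_strict_slope:
  fixes f :: "'a::euclidean_space \<Rightarrow> real"
  assumes lip: "locally_Lipschitz f" and reg: "subdiff_regular_at f x"
    and steep: "\<And>\<delta>. 0 < \<delta> \<Longrightarrow> \<exists>y\<in>ball x \<delta>. \<exists>t\<in>{0<..<\<delta>}. a * t < f (y + t *\<^sub>R w) - f y"
    and "0 < e"
  shows "\<forall>\<^sub>F t in at_right 0. (a - e) * t \<le> f (x + t *\<^sub>R w) - f x"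
proof (cases "w = 0")
  case True
  obtain t where "0 < t" "a * t < 0" using steep[of 1] True by auto
  then have "a < 0" by (simp add: mult_less_0_iff)
  have "(a - e) * t \<le> 0" if "0 < t" for t using \<open>a < 0\<close> \<open>0 < e\<close> that by (intro mult_nonpos_nonneg) auto
  then show ?thesis using True by (auto simp: eventually_at_right_less elim: eventually_mono[OF eventually_at_right_less[of 0]])
next
  case False
  obtain r0 L where "0 < r0" and L: "L-lipschitz_on (ball x r0) f"
    using lip unfolding locally_Lipschitz_def by blast
  have "0 \<le> L" using L by (rule lipschitz_on_nonneg)
  have "\<exists>z v. z \<in> ball x R \<and> norm v \<le> 2 * L \<and> a \<le> v \<bullet> w \<and>
      (v, -1) \<in> regular_normal_cone (epigraph UNIV f) (z, f z)" if R: "0 < R" "R < r0" for R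
  proof -
    \<comment> \<open>A start point and a length below this bound keep the whole segment in the ball
      of radius \<open>R / 2\<close>.\<close>
    define \<delta> where "\<delta> = R / (2 * (1 + norm w))"
    have pos: "0 < 1 + norm w" by (simp add: add_pos_nonneg)
    have "0 < \<delta>" using R pos by (simp add: \<delta>_def)
    have cancel: "R / (2 * c) * c = R / 2" if "c \<noteq> 0" for c using that by simp
    obtain y t where yt: "y \<in> ball x \<delta>" "0 < t" "t < \<delta>" "a * t < f (y + t *\<^sub>R w) - f y"
      using steep[OF \<open>0 < \<delta>\<close>] by auto
    have "\<exists>z v N. z \<in> ball x R \<and> norm v \<le> 2 * L \<and> a \<le> v \<bullet> w \<and> 0 \<le> N \<and>
           (\<forall>z'\<in>cball x R. f z + v \<bullet> (z' - z) - N * (norm (z' - z))\<^sup>2 \<le> f z')"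
    proof (rule proximal_mean_value[where R' = "R / 2"])
      show "L-lipschitz_on (cball x R) f" using R by (intro lipschitz_on_subset[OF L]) auto
      fix s assume "0 \<le> s" "s \<le> t"
      have "norm (y + s *\<^sub>R w - x) \<le> norm (y - x) + s * norm w"
        using norm_triangle_ineq[of "y - x" "s *\<^sub>R w"] \<open>0 \<le> s\<close> by (simp add: algebra_simps)
      also have "\<dots> \<le> \<delta> + \<delta> * norm w"
        using yt \<open>0 \<le> s\<close> \<open>s \<le> t\<close> by (intro add_mono mult_right_mono) (auto simp: dist_norm norm_minus_commute)
      also have "\<dots> = \<delta> * (1 + norm w)" by (simp add: algebra_simps)
      also have "\<dots> = R / 2" using pos unfolding \<delta>_def by (rule cancel[OF less_imp_neq[THEN not_sym]])
      finally show "y + s *\<^sub>R w \<in> cball x (R / 2)" by (simp add: dist_norm norm_minus_commute)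
    qed (use R yt in auto)
    then obtain z v N where *: "z \<in> ball x R" "norm v \<le> 2 * L" "a \<le> v \<bullet> w" "0 \<le> N"
      "\<And>z'. z'\<in>cball x R \<Longrightarrow> f z + v \<bullet> (z' - z) - N * (norm (z' - z))\<^sup>2 \<le> f z'" by blast
    have "(v, -1) \<in> regular_normal_cone (epigraph UNIV f) (z, f z)"
    proof (rule proximal_subgradient_regular_normal[where R = "R - dist x z" and N = N])
      fix z' assume "z' \<in> ball z (R - dist x z)"
      then have "z' \<in> cball x R" using dist_triangle[of x z' z] by auto
      then show "f z + v \<bullet> (z' - z) - N * (norm (z' - z))\<^sup>2 \<le> f z'" by (rule *(5))
    qed (use * in auto)
    with * show ?thesis by blast
  qed
  note ex = this
  have "\<exists>z v. z \<in> ball x (r0 / real (k + 2)) \<and> norm v \<le> 2 * L \<and> a \<le> v \<bullet> w \<and>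
      (v, -1) \<in> regular_normal_cone (epigraph UNIV f) (z, f z)" for k
    by (rule ex) (use \<open>0 < r0\<close> in \<open>simp_all add: divide_less_eq add_pos_nonneg\<close>)
  then obtain Z V where ZV: "\<And>k. Z k \<in> ball x (r0 / real (k + 2))" "\<And>k. norm (V k) \<le> 2 * L"
    "\<And>k. a \<le> V k \<bullet> w" "\<And>k. (V k, -1) \<in> regular_normal_cone (epigraph UNIV f) (Z k, f (Z k))" by metis
  have "Z \<longlonglongrightarrow> x"
  proof (rule LIMSEQ_I)
    fix \<epsilon> :: real assume "0 < \<epsilon>"
    have "(\<lambda>k. r0 * inverse (real (Suc k))) \<longlonglongrightarrow> r0 * 0"
      by (intro tendsto_intros LIMSEQ_inverse_real_of_nat)
    then have "\<forall>\<^sub>F k in sequentially. r0 * inverse (real (Suc k)) < \<epsilon>"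
      using \<open>0 < \<epsilon>\<close> by (auto elim: order_tendstoD)
    then have "\<forall>\<^sub>F k in sequentially. norm (Z k - x) < \<epsilon>"
    proof eventually_elim
      case (elim k)
      have "norm (Z k - x) < r0 / real (k + 2)" using ZV(1)[of k] by (simp add: dist_norm norm_minus_commute)
      also have "\<dots> \<le> r0 * inverse (real (Suc k))" using \<open>0 < r0\<close> by (simp add: field_simps)
      finally show ?case using elim by simp
    qed
    then show "\<exists>no. \<forall>n\<ge>no. norm (Z n - x) < \<epsilon>" by (simp add: eventually_sequentially)
  qed
  have "compact (cball (0::'a) (2 * L))" by simp
  moreover have "\<And>k. V k \<in> cball 0 (2 * L)" using ZV by simp
  ultimately obtain v \<phi> where v: "strict_mono (\<phi> :: nat \<Rightarrow> nat)" "(V \<circ> \<phi>) \<longlonglongrightarrow> v"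
    unfolding compact_def by metis
  have aw: "a \<le> v \<bullet> w"
    by (rule tendsto_lowerbound[OF tendsto_inner[OF v(2) tendsto_const]]) (simp_all add: ZV(3))
  have "isCont f x"
    using lipschitz_on_continuous_on[OF L] \<open>0 < r0\<close> by (metis centre_in_ball continuous_on_eq_continuous_at open_ball)
  then have fZ: "(\<lambda>k. f ((Z \<circ> \<phi>) k)) \<longlonglongrightarrow> f x"
    using LIMSEQ_subseq_LIMSEQ[OF \<open>Z \<longlonglongrightarrow> x\<close> v(1)] isCont_tendsto_compose by blast
  have "(v, -1) \<in> limiting_normal_cone (epigraph UNIV f) (x, f x)"
    unfolding limiting_normal_cone_def
  proof (rule CollectI, rule exI[of _ "\<lambda>k. ((Z \<circ> \<phi>) k, f ((Z \<circ> \<phi>) k))"], rule exI[of _ "\<lambda>k. ((V \<circ> \<phi>) k, -1)"], intro conjI allI)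
    show "(\<lambda>k. ((Z \<circ> \<phi>) k, f ((Z \<circ> \<phi>) k))) \<longlonglongrightarrow> (x, f x)"
      by (intro tendsto_Pair fZ LIMSEQ_subseq_LIMSEQ[OF \<open>Z \<longlonglongrightarrow> x\<close> v(1)])
    show "(\<lambda>k. ((V \<circ> \<phi>) k, -1)) \<longlonglongrightarrow> (v, -1)"
      by (intro tendsto_Pair v tendsto_const)
  qed (simp_all add: mem_epigraph ZV(4))
  then have "(v, -1) \<in> regular_normal_cone (epigraph UNIV f) (x, f x)"
    using reg by (simp add: subdiff_regular_at_def)
  \<comment> \<open>On the graph over the ray the distance to \<open>(x, f x)\<close> is at most
    \<open>t * K\<close>, so the tolerance \<open>e / K\<close> in the normal cone inequality costs
    \<open>e * t\<close>.\<close>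
  define K where "K = norm w * (1 + L)"
  have "0 < K" using False \<open>0 \<le> L\<close> by (simp add: K_def add_pos_nonneg)
  have "\<forall>\<^sub>F p in at (x, f x) within epigraph UNIV f. (v, -1) \<bullet> (p - (x, f x)) \<le> (e / K) * norm (p - (x, f x))"
    using \<open>(v, -1) \<in> regular_normal_cone _ _\<close> divide_pos_pos[OF \<open>0 < e\<close> \<open>0 < K\<close>]
    unfolding regular_normal_cone_def by blast
  then obtain d where "0 < d" and d: "\<And>p. p \<in> epigraph UNIV f \<Longrightarrow> p \<noteq> (x, f x) \<Longrightarrow> dist p (x, f x) < d \<Longrightarrow>
     (v, -1) \<bullet> (p - (x, f x)) \<le> (e / K) * norm (p - (x, f x))"
    unfolding eventually_at by blast
  show ?thesis
    unfolding eventually_at_right_field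
  proof (intro exI[of _ "min (r0 / norm w) (d / K)"] conjI allI impI)
    show "0 < min (r0 / norm w) (d / K)" using \<open>0 < r0\<close> \<open>0 < d\<close> \<open>0 < K\<close> False by simp
    fix t assume t: "0 < t" "t < min (r0 / norm w) (d / K)"
    then have tw: "t * norm w < r0" "t * K < d" using False \<open>0 < K\<close> by (auto simp: pos_less_divide_eq)
    define p where "p = (x + t *\<^sub>R w, f (x + t *\<^sub>R w))"
    have "\<bar>f (x + t *\<^sub>R w) - f x\<bar> \<le> L * (t * norm w)"
      using lipschitz_onD[OF L, of "x + t *\<^sub>R w" x] tw t \<open>0 < r0\<close> by (simp add: dist_norm)
    then have "norm (p - (x, f x)) \<le> t * norm w + L * (t * norm w)"
      using norm_Pair_le[of "t *\<^sub>R w" "f (x + t *\<^sub>R w) - f x"] t by (simp add: p_def)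
    then have np: "norm (p - (x, f x)) \<le> t * K" by (simp add: K_def algebra_simps)
    have "(v, -1) \<bullet> (p - (x, f x)) \<le> (e / K) * norm (p - (x, f x))"
      using np tw False t by (intro d) (auto simp: p_def epigraph_def dist_norm)
    also have "\<dots> \<le> (e / K) * (t * K)" using np \<open>0 < e\<close> \<open>0 < K\<close> by (intro mult_left_mono) auto
    also have "\<dots> = e * t" using \<open>0 < K\<close> by simp
    finally have "t * (v \<bullet> w) - (f (x + t *\<^sub>R w) - f x) \<le> e * t" by (simp add: p_def)
    moreover have "t * a \<le> t * (v \<bullet> w)" using aw t by simp
    ultimately show "(a - e) * t \<le> f (x + t *\<^sub>R w) - f x" by (simp add: algebra_simps)
  qed
qed

section \<open>Clarke's directional derivative\<close>

text \<open>The upper limit of the difference quotients as the base point tends to \<open>x\<close>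
  and the step to 0, written as the infimum of their eventual upper bounds. Taking the limit jointly
  is what makes it upper semicontinuous in \<open>x\<close>.\<close>

definition clarke_deriv :: "('a::real_inner \<Rightarrow> real) \<Rightarrow> 'a \<Rightarrow> 'a \<Rightarrow> real" where
  "clarke_deriv f x w =
     Inf {a. \<exists>\<delta>>0. \<forall>y\<in>ball x \<delta>. \<forall>t\<in>{0<..<\<delta>}. f (y + t *\<^sub>R w) - f y \<le> a * t}"

text \<open>Tested at \<open>x\<close> itself, an eventual slope bound cannot undercut the Lipschitz
  estimate; hence the infimum in \<open>clarke_deriv\<close> is taken over a set bounded
  below.\<close>

lemma clarke_slopes_ge:
  assumes L: "L-lipschitz_on (ball x r) f" and "0 < r" "0 < \<delta>"
    and a: "\<And>y t. y \<in> ball x \<delta> \<Longrightarrow> 0 < t \<Longrightarrow> t < \<delta> \<Longrightarrow> f (y + t *\<^sub>R w) - f y \<le> a * t"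
  shows "- (L * norm w) \<le> (a::real)"
proof -
  define c where "c = 1 + norm w"
  have pos: "0 < c" by (simp add: c_def add_pos_nonneg)
  define t where "t = min (\<delta> / 2) (r / (2 * c))"
  have t: "0 < t" "t \<le> \<delta> / 2" "t \<le> r / (2 * c)" using assms(2,3) pos by (auto simp: t_def)
  then have "t < \<delta>" using \<open>0 < \<delta>\<close> by linarith
  have "t * c \<le> r / 2" using pos t(3) by (simp add: field_simps)
  then have "t * norm w < r" using \<open>0 < r\<close> t by (simp add: c_def algebra_simps)
  then have "\<bar>f (x + t *\<^sub>R w) - f x\<bar> \<le> L * (t * norm w)"
    using lipschitz_onD[OF L, of "x + t *\<^sub>R w" x] t \<open>0 < r\<close> by (simp add: dist_norm)
  moreover have "f (x + t *\<^sub>R w) - f x \<le> a * t" using a[of x t] t \<open>t < \<delta>\<close> \<open>0 < \<delta>\<close> by simp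
  ultimately have "t * (- (L * norm w)) \<le> t * a" by (simp add: algebra_simps)
  then show ?thesis using t(1) by (simp only: mult_le_cancel_left_pos)
qed

lemma clarke_deriv_le:
  assumes lip: "locally_Lipschitz f" and "0 < \<delta>"
    and a: "\<And>y t. y \<in> ball x \<delta> \<Longrightarrow> 0 < t \<Longrightarrow> t < \<delta> \<Longrightarrow> f (y + t *\<^sub>R w) - f y \<le> a * t"
  shows "clarke_deriv f x w \<le> a"
proof -
  obtain r L where r: "0 < r" "L-lipschitz_on (ball x r) f"
    using lip unfolding locally_Lipschitz_def by blast
  show ?thesis
    unfolding clarke_deriv_def
  proof (rule cInf_lower)
    show "bdd_below {a. \<exists>\<delta>>0. \<forall>y\<in>ball x \<delta>. \<forall>t\<in>{0<..<\<delta>}. f (y + t *\<^sub>R w) - f y \<le> a * t}"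
      by (rule bdd_belowI[of _ "- (L * norm w)"]) (use clarke_slopes_ge[OF r(2,1)] in force)
  qed (use assms in auto)
qed

lemma clarke_deriv_bounds:
  assumes L: "L-lipschitz_on (ball x r) f" and "0 < r"
  shows "- (L * norm w) \<le> clarke_deriv f x w"
    and "clarke_deriv f x w \<le> L * norm w"
    and "0 < e \<Longrightarrow> \<exists>\<delta>>0. \<forall>y\<in>ball x \<delta>. \<forall>t\<in>{0<..<\<delta>}. f (y + t *\<^sub>R w) - f y \<le> (clarke_deriv f x w + e) * t"
proof -
  let ?S = "{a. \<exists>\<delta>>0. \<forall>y\<in>ball x \<delta>. \<forall>t\<in>{0<..<\<delta>}. f (y + t *\<^sub>R w) - f y \<le> a * t}"
  have bdd: "bdd_below ?S"
    by (rule bdd_belowI[of _ "- (L * norm w)"]) (use clarke_slopes_ge[OF assms] in force)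
  have pos: "0 < 1 + norm w" by (simp add: add_pos_nonneg)
  define \<delta> where "\<delta> = r / (1 + norm w)"
  have "\<delta> * (1 + norm w) = r" using pos unfolding \<delta>_def by (simp only: nonzero_divide_eq_eq[OF less_imp_neq[THEN not_sym]] times_divide_eq_left)
  then have \<delta>: "0 < \<delta>" "\<delta> + \<delta> * norm w = r"
    using pos \<open>0 < r\<close> by (simp_all add: \<delta>_def distrib_left)
  have mem: "L * norm w \<in> ?S"
  proof (intro CollectI exI[of _ \<delta>] conjI ballI)
    fix y t assume y: "y \<in> ball x \<delta>" and t: "t \<in> {0<..<\<delta>}"
    have "norm (y + t *\<^sub>R w - x) \<le> norm (y - x) + t * norm w"
      using norm_triangle_ineq[of "y - x" "t *\<^sub>R w"] t by (simp add: algebra_simps)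
    also have "\<dots> < \<delta> + \<delta> * norm w"
      using y t by (intro add_less_le_mono mult_right_mono) (auto simp: dist_norm norm_minus_commute)
    finally have "y + t *\<^sub>R w \<in> ball x r" using \<delta> by (simp add: dist_norm norm_minus_commute)
    moreover have "\<delta> * norm w \<ge> 0" using \<delta> by simp
    with y \<delta>(2) have "y \<in> ball x r" by auto
    ultimately show "f (y + t *\<^sub>R w) - f y \<le> L * norm w * t"
      using lipschitz_onD[OF L, of "y + t *\<^sub>R w" y] t by (simp add: dist_norm algebra_simps)
  qed (use \<delta> in auto)
  show "- (L * norm w) \<le> clarke_deriv f x w"
    unfolding clarke_deriv_def by (rule cInf_greatest) (use mem clarke_slopes_ge[OF assms] in force)+
  show "clarke_deriv f x w \<le> L * norm w"
    unfolding clarke_deriv_def by (rule cInf_lower[OF mem bdd])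
  assume "0 < e"
  then have "Inf ?S < clarke_deriv f x w + e" by (simp add: clarke_deriv_def)
  then obtain a where a: "a \<in> ?S" "a < clarke_deriv f x w + e"
    using cInf_lessD mem by (metis (no_types, lifting) empty_iff)
  then obtain \<delta> where \<delta>: "\<delta> > 0" "\<And>y t. y \<in> ball x \<delta> \<Longrightarrow> t \<in> {0<..<\<delta>} \<Longrightarrow> f (y + t *\<^sub>R w) - f y \<le> a * t"
    by auto
  have "f (y + t *\<^sub>R w) - f y \<le> (clarke_deriv f x w + e) * t" if "y \<in> ball x \<delta>" "t \<in> {0<..<\<delta>}" for y t
  proof -
    have "a * t \<le> (clarke_deriv f x w + e) * t" using a that by (intro mult_right_mono) auto
    with \<delta>(2)[OF that] show ?thesis by linarith
  qed
  with \<delta>(1) show "\<exists>\<delta>>0. \<forall>y\<in>ball x \<delta>. \<forall>t\<in>{0<..<\<delta>}. f (y + t *\<^sub>R w) - f y \<le> (clarke_deriv f x w + e) * t"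
    by blast
qed

lemma clarke_deriv_upper:
  assumes "locally_Lipschitz f" "0 < e"
  obtains \<delta> where "0 < \<delta>"
    "\<And>y t. y \<in> ball x \<delta> \<Longrightarrow> 0 < t \<Longrightarrow> t < \<delta> \<Longrightarrow> f (y + t *\<^sub>R w) - f y \<le> (clarke_deriv f x w + e) * t"
proof -
  obtain r L where r: "0 < r" "L-lipschitz_on (ball x r) f"
    using assms(1) unfolding locally_Lipschitz_def by blast
  from clarke_deriv_bounds(3)[OF r(2,1) assms(2)] that show ?thesis by (metis greaterThanLessThan_iff)
qed

text \<open>A ball about \<open>x\<close> on which the slopes are bounded contains, at half the
  radius, a ball about every nearby \<open>y\<close>.\<close>

lemma clarke_deriv_usc:
  assumes "locally_Lipschitz f" "0 < e"
  obtains \<delta> where "0 < \<delta>" "\<And>y. y \<in> ball x \<delta> \<Longrightarrow> clarke_deriv f y w \<le> clarke_deriv f x w + e"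
proof -
  obtain \<delta> where \<delta>: "0 < \<delta>"
    "\<And>y t. y \<in> ball x \<delta> \<Longrightarrow> 0 < t \<Longrightarrow> t < \<delta> \<Longrightarrow> f (y + t *\<^sub>R w) - f y \<le> (clarke_deriv f x w + e) * t"
    using clarke_deriv_upper[OF assms] by metis
  have "clarke_deriv f y w \<le> clarke_deriv f x w + e" if "y \<in> ball x (\<delta> / 2)" for y
  proof (rule clarke_deriv_le[OF assms(1), of "\<delta> / 2"])
    fix z t assume "z \<in> ball y (\<delta> / 2)" "0 < t" "t < \<delta> / 2"
    then show "f (z + t *\<^sub>R w) - f z \<le> (clarke_deriv f x w + e) * t"
      using that dist_triangle[of x z y] by (intro \<delta>(2)) auto
  qed (use \<delta> in auto)
  with \<delta>(1) that[of "\<delta> / 2"] show ?thesis by simp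
qed

lemma gderiv_inner_le:
  assumes v: "GDERIV f z :> v" and a: "\<forall>\<^sub>F t in at_right 0. f (z + t *\<^sub>R w) - f z \<le> a * t"
  shows "v \<bullet> w \<le> a"
proof -
  have *: "(f has_derivative (\<lambda>h. h \<bullet> v)) (at (z + 0 *\<^sub>R w))" using v by (simp add: gderiv_def)
  have "((\<lambda>t. f (z + t *\<^sub>R w)) has_derivative (\<lambda>t. (t *\<^sub>R w) \<bullet> v)) (at 0)"
    by (rule has_derivative_compose[where g = f and f = "\<lambda>t. z + t *\<^sub>R w" and g' = "\<lambda>h. h \<bullet> v", OF _ *]) (auto intro!: derivative_eq_intros)
  then have "((\<lambda>t. f (z + t *\<^sub>R w)) has_field_derivative (v \<bullet> w)) (at 0)"
    by (rule has_derivative_imp_has_field_derivative) (simp add: inner_commute)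
  then have "((\<lambda>t. (f (z + t *\<^sub>R w) - f z) / t) \<longlongrightarrow> v \<bullet> w) (at_right 0)"
    by (simp add: DERIV_def filterlim_at_split)
  moreover have "\<forall>\<^sub>F t in at_right 0. (f (z + t *\<^sub>R w) - f z) / t \<le> a"
    using a eventually_at_right_less[of "0::real"] by eventually_elim (simp add: field_simps)
  ultimately show ?thesis using tendsto_upperbound trivial_limit_at_right_real by blast
qed

text \<open>Clarke's slope bound is uniform over base points near \<open>y\<close>, so the
  derivative at one point controls the gradients all around it.\<close>

lemma gderiv_inner_le_clarke:
  assumes "locally_Lipschitz f" "0 < e"
  obtains \<delta> where "0 < \<delta>"
    "\<And>z v. z \<in> ball y \<delta> \<Longrightarrow> GDERIV f z :> v \<Longrightarrow> v \<bullet> w \<le> clarke_deriv f y w + e"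
proof -
  obtain \<delta> where \<delta>: "0 < \<delta>"
    "\<And>z t. z \<in> ball y \<delta> \<Longrightarrow> 0 < t \<Longrightarrow> t < \<delta> \<Longrightarrow> f (z + t *\<^sub>R w) - f z \<le> (clarke_deriv f y w + e) * t"
    using clarke_deriv_upper[OF assms] by metis
  have "v \<bullet> w \<le> clarke_deriv f y w + e" if "z \<in> ball y \<delta>" "GDERIV f z :> v" for z v
  proof (rule gderiv_inner_le[OF that(2)])
    show "\<forall>\<^sub>F t in at_right 0. f (z + t *\<^sub>R w) - f z \<le> (clarke_deriv f y w + e) * t"
      using \<delta> that(1) by (auto simp: eventually_at_right_field)
  qed
  with \<delta>(1) that show ?thesis by blast
qed

lemma norm_gderiv_le:
  assumes v: "GDERIV f z :> v" and L: "L-lipschitz_on (ball x r) f" and z: "z \<in> ball x r"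
  shows "norm v \<le> L"
proof -
  have "v \<bullet> v \<le> L * norm v"
  proof (rule gderiv_inner_le[OF v])
    obtain d where d: "0 < d" "ball z d \<subseteq> ball x r" using z open_ball open_contains_ball by metis
    have pos: "0 < 1 + norm v" by (simp add: add_pos_nonneg)
    show "\<forall>\<^sub>F t in at_right 0. f (z + t *\<^sub>R v) - f z \<le> L * norm v * t"
      unfolding eventually_at_right_field
    proof (intro exI[of _ "d / (1 + norm v)"] conjI allI impI)
      fix t assume t: "0 < t" "t < d / (1 + norm v)"
      then have "t * norm v < d" using pos by (simp add: pos_less_divide_eq algebra_simps)
      then have "z + t *\<^sub>R v \<in> ball z d" using t by (simp add: dist_norm)
      then have "z + t *\<^sub>R v \<in> ball x r" using d(2) by blast
      then show "f (z + t *\<^sub>R v) - f z \<le> L * norm v * t"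
        using lipschitz_onD[OF L, of "z + t *\<^sub>R v" z] z t by (simp add: dist_norm algebra_simps)
    qed (use d pos in simp)
  qed
  then have "norm v * norm v \<le> norm v * L" by (simp add: power2_norm_eq_inner[symmetric] power2_eq_square mult_ac)
  then show ?thesis using lipschitz_on_nonneg[OF L] by (cases "v = 0") auto
qed

lemma gradient_eqI: "GDERIV f x :> v \<Longrightarrow> gradient f x = v"
proof -
  assume v: "GDERIV f x :> v"
  have "w = v" if "GDERIV f x :> w" for w
  proof -
    have "(\<lambda>h. h \<bullet> w) = (\<lambda>h. h \<bullet> v)"
      using that v unfolding gderiv_def by (rule has_derivative_unique)
    then have "(w - v) \<bullet> w = (w - v) \<bullet> v" by metis
    then have "(w - v) \<bullet> (w - v) = 0" by (simp add: inner_diff_right)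
    then show ?thesis by simp
  qed
  with v show ?thesis unfolding gradient_def by blast
qed

lemma differentiable_imp_gderiv:
  fixes f :: "'a::euclidean_space \<Rightarrow> real"
  assumes "f differentiable (at x)"
  shows "GDERIV f x :> gradient f x"
proof -
  obtain D where D: "(f has_derivative D) (at x)" using assms by (auto simp: differentiable_def)
  interpret linear D using D by (rule has_derivative_linear)
  have "D = (\<lambda>h. h \<bullet> (\<Sum>b\<in>Basis. D b *\<^sub>R b))"
  proof
    fix h
    have "D h = D (\<Sum>b\<in>Basis. (h \<bullet> b) *\<^sub>R b)" by (simp add: euclidean_representation)
    also have "\<dots> = (\<Sum>b\<in>Basis. (h \<bullet> b) * D b)" by (simp add: sum scaleR)
    finally show "D h = h \<bullet> (\<Sum>b\<in>Basis. D b *\<^sub>R b)" by (simp add: inner_sum_right mult.commute)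
  qed
  with D have "GDERIV f x :> (\<Sum>b\<in>Basis. D b *\<^sub>R b)" by (simp add: gderiv_def)
  then show ?thesis using gradient_eqI by metis
qed

lemma gradient_in_limiting_gradients:
  "f differentiable (at x) \<Longrightarrow> gradient f x \<in> limiting_gradients f x"
  unfolding limiting_gradients_def
  by (rule CollectI, rule exI[of _ "\<lambda>_. x"]) auto

section \<open>Regular locally Lipschitz functions\<close>

locale regular_Lipschitz =
  fixes f :: "'a::euclidean_space \<Rightarrow> real"
  assumes lip: "locally_Lipschitz f" and reg: "subdiff_regular f"
begin

lemma continuous: "isCont f x"
proof -
  obtain r L where r: "0 < r" "L-lipschitz_on (ball x r) f"
    using lip unfolding locally_Lipschitz_def by blast
  from lipschitz_on_continuous_on[OF r(2)] r(1) show ?thesis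
    by (metis centre_in_ball continuous_on_eq_continuous_at open_ball)
qed

text \<open>By the choice of the infimum, quotients steeper than
  \<open>clarke_deriv f x w - e / 2\<close> occur arbitrarily near \<open>x\<close>; regularity
  turns them into a slope at \<open>x\<close>. Together with \<open>clarke_deriv_upper\<close> this
  makes the Clarke derivative an honest one-sided derivative.\<close>

lemma clarke_deriv_lower:
  assumes "0 < e"
  shows "\<forall>\<^sub>F t in at_right 0. (clarke_deriv f x w - e) * t \<le> f (x + t *\<^sub>R w) - f x"
proof -
  have "\<forall>\<^sub>F t in at_right 0. (clarke_deriv f x w - e / 2 - e / 2) * t \<le> f (x + t *\<^sub>R w) - f x"
  proof (rule subdiff_regular_strict_slope[OF lip])
    show "subdiff_regular_at f x" using reg by (simp add: subdiff_regular_def)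
    fix \<delta> :: real assume "0 < \<delta>"
    show "\<exists>y\<in>ball x \<delta>. \<exists>t\<in>{0<..<\<delta>}. (clarke_deriv f x w - e / 2) * t < f (y + t *\<^sub>R w) - f y"
    proof (rule ccontr)
      assume "\<not> ?thesis"
      then have "clarke_deriv f x w \<le> clarke_deriv f x w - e / 2"
        by (intro clarke_deriv_le[OF lip \<open>0 < \<delta>\<close>]) (auto simp: not_less)
      with assms show False by simp
    qed
  qed (use assms in simp)
  then show ?thesis by simp
qed

text \<open>If all backward derivatives along the segment were larger than \<open>- a\<close>,
  walking from the end back to \<open>y\<close> would lose at most \<open>a\<close> per unit of the
  parameter, contrary to the total difference. Walking backwards is deliberate: the density argument
  needs a bound in direction \<open>- w\<close>.\<close>

lemma clarke_mean_value:
  assumes "0 < t" and slope: "a * t < f (y + t *\<^sub>R w) - f y"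
  shows "\<exists>s. 0 < s \<and> s \<le> t \<and> clarke_deriv f (y + s *\<^sub>R w) (- w) \<le> - a"
proof (rule ccontr)
  assume "\<not> ?thesis"
  then have steep: "- a < clarke_deriv f (y + s *\<^sub>R w) (- w)" if "0 < s" "s \<le> t" for s
    using that by force
  define g where "g u = f (y + (t - u) *\<^sub>R w) + a * u" for u
  have "g 0 \<le> g t"
  proof (rule le_if_right_Dini_nonneg[where g = g])
    have "continuous_on UNIV f" using continuous continuous_at_imp_continuous_on by blast
    then have "continuous_on {0..t} (\<lambda>u. f (y + (t - u) *\<^sub>R w))"
      by (rule continuous_on_compose2) (auto intro!: continuous_intros)
    then show "continuous_on {0..t} g"
      unfolding g_def by (intro continuous_on_add continuous_on_mult continuous_on_const continuous_on_id)
    fix u e :: real assume u: "0 \<le> u" "u < t" and "0 < e"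
    define z where "z = y + (t - u) *\<^sub>R w"
    have "\<forall>\<^sub>F h in at_right 0. (clarke_deriv f z (- w) - e) * h \<le> f (z + h *\<^sub>R (- w)) - f z"
      by (rule clarke_deriv_lower[OF \<open>0 < e\<close>])
    then show "\<forall>\<^sub>F h in at_right 0. g u - e * h \<le> g (u + h)"
      using eventually_at_right_less[of "0::real"]
    proof eventually_elim
      case (elim h)
      have "(- a - e) * h \<le> (clarke_deriv f z (- w) - e) * h"
        using steep[of "t - u"] u elim(2) by (intro mult_right_mono) (auto simp: z_def)
      with elim(1) show ?case by (simp add: g_def z_def algebra_simps)
    qed
  qed (use \<open>0 < t\<close> in simp)
  with slope show False by (simp add: g_def)
qed

text \<open>Up to \<open>e\<close>, the slopes along \<open>b\<close> are squeezed between
  \<open>- clarke_deriv f x (- b)\<close> and \<open>clarke_deriv f x b\<close>, uniformly over base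
  points near \<open>x\<close>. This uniformity permits changing one coordinate at a time although
  the intermediate base points move, so directional information adds up to a full
  derivative.\<close>

lemma differentiable_if_clarke_symmetric:
  assumes sym: "\<And>b. b \<in> Basis \<Longrightarrow> clarke_deriv f x b + clarke_deriv f x (- b) \<le> 0"
  shows "f differentiable (at x)"
proof -
  have "\<exists>\<delta>>0. \<forall>y\<in>ball x \<delta>. \<forall>h\<in>ball (0::'a) \<delta>.
          \<bar>f (y + (\<Sum>b\<in>A. (h \<bullet> b) *\<^sub>R b)) - f y - (\<Sum>b\<in>A. (h \<bullet> b) * clarke_deriv f x b)\<bar> \<le> e * real (card A) * norm h"
    if "A \<subseteq> (Basis :: 'a set)" "0 < e" for A e
    using finite_subset[OF that(1) finite_Basis] that
  proof (induction A rule: finite_induct)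
    case empty
    show ?case by (rule exI[of _ 1]) auto
  next
    case (insert b A)
    then obtain d1 where d1: "0 < d1" "\<And>y h. y \<in> ball x d1 \<Longrightarrow> h \<in> ball (0::'a) d1 \<Longrightarrow>
        \<bar>f (y + (\<Sum>b\<in>A. (h \<bullet> b) *\<^sub>R b)) - f y - (\<Sum>b\<in>A. (h \<bullet> b) * clarke_deriv f x b)\<bar> \<le> e * real (card A) * norm h"
      by (auto simp: Ball_def)
    have b: "b \<in> Basis" using insert by auto
    obtain d2 where d2: "0 < d2"
      "\<And>y t. y \<in> ball x d2 \<Longrightarrow> 0 < t \<Longrightarrow> t < d2 \<Longrightarrow> f (y + t *\<^sub>R b) - f y \<le> (clarke_deriv f x b + e) * t"
      using clarke_deriv_upper[OF lip \<open>0 < e\<close>] by metis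
    obtain d3 where d3: "0 < d3"
      "\<And>y t. y \<in> ball x d3 \<Longrightarrow> 0 < t \<Longrightarrow> t < d3 \<Longrightarrow> f (y + t *\<^sub>R (- b)) - f y \<le> (clarke_deriv f x (- b) + e) * t"
      using clarke_deriv_upper[OF lip \<open>0 < e\<close>] by metis
    define d where "d = min d1 (min d2 d3) / 2"
    have d: "0 < d" "2 * d \<le> d1" "2 * d \<le> d2" "2 * d \<le> d3" using d1 d2 d3 by (auto simp: d_def)
    \<comment> \<open>The lower bound for a step along \<open>b\<close> is the upper bound for the
      step back along \<open>- b\<close>, based at the other end point; hence the factor 2 in the
      choice of \<open>d\<close>.\<close>
    have one: "\<bar>f (y + t *\<^sub>R b) - f y - t * clarke_deriv f x b\<bar> \<le> e * \<bar>t\<bar>"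
      if y: "y \<in> ball x d" and t: "\<bar>t\<bar> < d" for y t
    proof -
      have y': "y + t *\<^sub>R b \<in> ball x (2 * d)"
      proof -
        have "dist x (y + t *\<^sub>R b) \<le> dist x y + \<bar>t\<bar>"
          using dist_triangle[of x "y + t *\<^sub>R b" y] b by (simp add: dist_norm)
        then show ?thesis using y t by simp
      qed
      have le: "t * clarke_deriv f x (- b) \<le> - (t * clarke_deriv f x b)" if "0 < t" for t
        using mult_left_mono[OF sym[OF b], of t] that by (simp add: algebra_simps)
      consider "t = 0" | "0 < t" | "t < 0" by linarith
      then show ?thesis
      proof cases
        case 2
        have "f (y + t *\<^sub>R b) - f y \<le> (clarke_deriv f x b + e) * t" using y t 2 d by (intro d2) auto
        moreover have "f ((y + t *\<^sub>R b) + t *\<^sub>R (- b)) - f (y + t *\<^sub>R b) \<le> (clarke_deriv f x (- b) + e) * t"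
          using y' t 2 d by (intro d3) auto
        ultimately show ?thesis using le[OF 2] 2 by (simp add: algebra_simps abs_le_iff)
      next
        case 3
        have "f (y + (- t) *\<^sub>R (- b)) - f y \<le> (clarke_deriv f x (- b) + e) * (- t)" using y t 3 d by (intro d3) auto
        moreover have "f ((y + t *\<^sub>R b) + (- t) *\<^sub>R b) - f (y + t *\<^sub>R b) \<le> (clarke_deriv f x b + e) * (- t)"
          using y' t 3 d by (intro d2) auto
        ultimately show ?thesis using le[of "- t"] 3 by (simp add: algebra_simps abs_le_iff)
      qed simp
    qed
    show ?case
    proof (intro exI[of _ d] conjI ballI)
      fix y h :: 'a assume y: "y \<in> ball x d" and h: "h \<in> ball 0 d"
      have hb: "\<bar>h \<bullet> b\<bar> \<le> norm h" using Basis_le_norm[OF b] by simp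
      then have "\<bar>h \<bullet> b\<bar> < d" using h by simp
      define y' where "y' = y + (h \<bullet> b) *\<^sub>R b"
      have "dist x y' \<le> dist x y + \<bar>h \<bullet> b\<bar>"
        using dist_triangle[of x y' y] b by (simp add: dist_norm y'_def)
      then have "y' \<in> ball x d1" using y \<open>\<bar>h \<bullet> b\<bar> < d\<close> d by simp
      then have "\<bar>f (y' + (\<Sum>b\<in>A. (h \<bullet> b) *\<^sub>R b)) - f y' - (\<Sum>b\<in>A. (h \<bullet> b) * clarke_deriv f x b)\<bar> \<le> e * real (card A) * norm h"
        using h d by (intro d1) auto
      moreover have "\<bar>f y' - f y - (h \<bullet> b) * clarke_deriv f x b\<bar> \<le> e * norm h"
        using one[OF y \<open>\<bar>h \<bullet> b\<bar> < d\<close>] mult_left_mono[OF hb less_imp_le[OF \<open>0 < e\<close>]] unfolding y'_def by linarith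
      moreover have eq1: "y + (\<Sum>b\<in>insert b A. (h \<bullet> b) *\<^sub>R b) = y' + (\<Sum>b\<in>A. (h \<bullet> b) *\<^sub>R b)"
        using insert(1,2) by (simp add: y'_def)
      moreover have eq2: "(\<Sum>b\<in>insert b A. (h \<bullet> b) * clarke_deriv f x b) = (h \<bullet> b) * clarke_deriv f x b + (\<Sum>b\<in>A. (h \<bullet> b) * clarke_deriv f x b)"
        using insert(1,2) by simp
      moreover have "e * real (card (insert b A)) * norm h = e * norm h + e * real (card A) * norm h"
        using insert(1,2) by (simp add: algebra_simps)
      ultimately show "\<bar>f (y + (\<Sum>b\<in>insert b A. (h \<bullet> b) *\<^sub>R b)) - f y - (\<Sum>b\<in>insert b A. (h \<bullet> b) * clarke_deriv f x b)\<bar> \<le> e * real (card (insert b A)) * norm h"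
        unfolding eq1 eq2 by linarith
    qed (use d in simp)
  qed
  note main = this[OF subset_refl]
  define D where "D h = (\<Sum>b\<in>Basis. (h \<bullet> b) * clarke_deriv f x b)" for h
  have "bounded_linear D"
    unfolding D_def by (intro bounded_linear_sum bounded_linear_compose[OF bounded_linear_mult_left] bounded_linear_inner_left)
  have "(f has_derivative D) (at x)"
    unfolding has_derivative_at_alt
  proof (intro conjI allI impI \<open>bounded_linear D\<close>)
    fix e :: real assume "0 < e"
    have n: "0 < real DIM('a)" by simp
    obtain \<delta> where \<delta>: "0 < \<delta>" "\<And>y h. y \<in> ball x \<delta> \<Longrightarrow> h \<in> ball (0::'a) \<delta> \<Longrightarrow>
        \<bar>f (y + (\<Sum>b\<in>Basis. (h \<bullet> b) *\<^sub>R b)) - f y - D h\<bar> \<le> e / real DIM('a) * real DIM('a) * norm h"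
      using main[of "e / real DIM('a)"] \<open>0 < e\<close> n unfolding D_def by (auto simp: Ball_def)
    show "\<exists>d>0. \<forall>y. norm (y - x) < d \<longrightarrow> norm (f y - f x - D (y - x)) \<le> e * norm (y - x)"
    proof (intro exI[of _ \<delta>] conjI allI impI)
      fix y assume "norm (y - x) < \<delta>"
      then show "norm (f y - f x - D (y - x)) \<le> e * norm (y - x)"
        using \<delta>(2)[of x "y - x"] \<delta>(1) n unfolding euclidean_representation by simp
    qed (rule \<delta>)
  qed
  then show ?thesis by (rule differentiableI)
qed

lemma open_clarke_symmetric: "open {x. clarke_deriv f x b + clarke_deriv f x (- b) < e}"
  unfolding open_contains_ball
proof
  fix x assume x: "x \<in> {x. clarke_deriv f x b + clarke_deriv f x (- b) < e}"
  define g where "g = (e - (clarke_deriv f x b + clarke_deriv f x (- b))) / 3"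
  have g: "0 < g" using x by (simp add: g_def)
  obtain d1 where d1: "0 < d1" "\<And>y. y \<in> ball x d1 \<Longrightarrow> clarke_deriv f y b \<le> clarke_deriv f x b + g"
    using clarke_deriv_usc[OF lip g] by metis
  obtain d2 where d2: "0 < d2" "\<And>y. y \<in> ball x d2 \<Longrightarrow> clarke_deriv f y (- b) \<le> clarke_deriv f x (- b) + g"
    using clarke_deriv_usc[OF lip g] by metis
  have "3 * g = e - (clarke_deriv f x b + clarke_deriv f x (- b))" by (simp add: g_def)
  then have "ball x (min d1 d2) \<subseteq> {x. clarke_deriv f x b + clarke_deriv f x (- b) < e}"
    using d1(2) d2(2) g by (force simp: algebra_simps)
  then show "\<exists>d>0. ball x d \<subseteq> {x. clarke_deriv f x b + clarke_deriv f x (- b) < e}"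
    using d1(1) d2(1) by (intro exI[of _ "min d1 d2"]) auto
qed

text \<open>Near a supremum of the forward slopes in direction \<open>b\<close>, the mean value theorem yields a
  backward slope that is almost as large.\<close>

lemma dense_clarke_symmetric:
  assumes "0 < e"
  shows "closure {x. clarke_deriv f x b + clarke_deriv f x (- b) < e} = UNIV"
proof -
  have "\<exists>y\<in>ball x r. clarke_deriv f y b + clarke_deriv f y (- b) < e" if "0 < r" for x r
  proof -
    obtain r0 L where r0: "0 < r0" "L-lipschitz_on (ball x r0) f"
      using lip unfolding locally_Lipschitz_def by blast
    define O' where "O' = ball x (min r r0)"
    have ne: "(\<lambda>y. clarke_deriv f y b) ` O' \<noteq> {}" using r0 that by (auto simp: O'_def)
    have bdd: "bdd_above ((\<lambda>y. clarke_deriv f y b) ` O')"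
    proof (rule bdd_aboveI2)
      fix y assume "y \<in> O'"
      then have "0 < r0 - dist x y" "ball y (r0 - dist x y) \<subseteq> ball x r0"
        by (auto simp: O'_def ball_subset_ball_iff dist_commute)
      then show "clarke_deriv f y b \<le> L * norm b"
        using clarke_deriv_bounds(2) lipschitz_on_subset[OF r0(2)] by blast
    qed
    define M where "M = (SUP y\<in>O'. clarke_deriv f y b)"
    have "M - e / 4 < M" using assms by simp
    then obtain y where y: "y \<in> O'" "M - e / 4 < clarke_deriv f y b"
      unfolding M_def using less_cSUP_iff[OF ne[unfolded image_is_empty] bdd] by auto
    obtain d where d: "0 < d" "ball y d \<subseteq> O'" using y(1) by (metis O'_def open_ball open_contains_ball)
    have pos: "0 < 1 + norm b" by (simp add: add_pos_nonneg)
    have "\<forall>\<^sub>F t in at_right 0. (clarke_deriv f y b - e / 4) * t \<le> f (y + t *\<^sub>R b) - f y"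
      using assms by (intro clarke_deriv_lower) simp
    moreover have "\<forall>\<^sub>F t in at_right (0::real). 0 < t \<and> t < d / (1 + norm b)"
      using d pos by (auto simp: eventually_at_right_field intro!: exI[of _ "d / (1 + norm b)"])
    ultimately have "\<forall>\<^sub>F t in at_right 0. (clarke_deriv f y b - e / 4) * t \<le> f (y + t *\<^sub>R b) - f y \<and> 0 < t \<and> t < d / (1 + norm b)"
      by eventually_elim auto
    then obtain t where t: "(clarke_deriv f y b - e / 4) * t \<le> f (y + t *\<^sub>R b) - f y" "0 < t" "t < d / (1 + norm b)"
      using eventually_happens trivial_limit_at_right_real by blast
    have "(M - e / 2) * t < (clarke_deriv f y b - e / 4) * t"
      using y(2) t(2) by (intro mult_strict_right_mono) auto
    with t have "(M - e / 2) * t < f (y + t *\<^sub>R b) - f y" by linarith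
    then obtain s where s: "0 < s" "s \<le> t" "clarke_deriv f (y + s *\<^sub>R b) (- b) \<le> - (M - e / 2)"
      using clarke_mean_value t(2) by blast
    have "s * (1 + norm b) \<le> t * (1 + norm b)" using s pos by simp
    also have "\<dots> < d" using t(3) pos by (simp add: pos_less_divide_eq)
    finally have "s * norm b < d" using s by (simp add: algebra_simps)
    then have "y + s *\<^sub>R b \<in> ball y d" using s by (simp add: dist_norm)
    \<comment> \<open>Inside \<open>O'\<close> the forward derivative is still capped by the
      supremum \<open>M\<close>, so forward and backward derivatives add up to at most
      \<open>e / 2\<close>.\<close>
    then have mem: "y + s *\<^sub>R b \<in> O'" using d(2) by blast
    then have "clarke_deriv f (y + s *\<^sub>R b) b \<le> M" unfolding M_def by (intro cSUP_upper bdd)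
    with s(3) assms mem show ?thesis unfolding O'_def by (intro bexI[of _ "y + s *\<^sub>R b"]) auto
  qed
  then show ?thesis unfolding set_eq_iff closure_approachable by (metis UNIV_I mem_Collect_eq mem_ball dist_commute)
qed

text \<open>Countably many open dense sets suffice: symmetry is asked of basis vectors only, up to
  each tolerance \<open>inverse (real (Suc m))\<close>, and the intersection of all these sets
  forces the inequality with 0.\<close>

lemma dense_differentiable: "closure {x. f differentiable (at x)} = UNIV"
proof -
  define W where "W = (\<lambda>(b, m). {x. clarke_deriv f x b + clarke_deriv f x (- b) < inverse (real (Suc m))}) ` (Basis \<times> UNIV)"
  have "UNIV \<subseteq> closure (\<Inter>W)"
  proof (rule Baire)
    show "countable W" unfolding W_def by (intro countable_image countable_SIGMA) (auto intro: countable_finite)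
    fix T assume "T \<in> W"
    then obtain b m where T: "T = {x. clarke_deriv f x b + clarke_deriv f x (- b) < inverse (real (Suc m))}"
      by (auto simp: W_def)
    show "openin (top_of_set UNIV) T \<and> UNIV \<subseteq> closure T"
      using open_clarke_symmetric[of b "inverse (real (Suc m))"] dense_clarke_symmetric[of "inverse (real (Suc m))" b]
      unfolding T by simp
  qed simp
  moreover have "\<Inter>W \<subseteq> {x. f differentiable (at x)}"
  proof
    fix x assume x: "x \<in> \<Inter>W"
    have "clarke_deriv f x b + clarke_deriv f x (- b) \<le> 0" if "b \<in> Basis" for b
    proof (rule ccontr)
      assume "\<not> ?thesis"
      then obtain m where "inverse (real (Suc m)) < clarke_deriv f x b + clarke_deriv f x (- b)"
        using reals_Archimedean by (metis not_le)
      moreover have "clarke_deriv f x b + clarke_deriv f x (- b) < inverse (real (Suc m))"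
        using x that by (auto simp: W_def)
      ultimately show False by simp
    qed
    then show "x \<in> {x. f differentiable (at x)}" using differentiable_if_clarke_symmetric by simp
  qed
  ultimately show ?thesis using closure_mono by blast
qed

lemma gderiv_dense:
  assumes "0 < r"
  obtains z where "z \<in> ball x r" "GDERIV f z :> gradient f z" "gradient f z \<in> limiting_gradients f z"
proof -
  have "x \<in> closure {x. f differentiable (at x)}" by (simp add: dense_differentiable)
  then obtain z where "f differentiable (at z)" "dist z x < r"
    using assms unfolding closure_approachable by blast
  then show ?thesis using that[of z] differentiable_imp_gderiv gradient_in_limiting_gradients
    by (auto simp: dist_commute)
qed

text \<open>Orthogonality is tested at differentiability points \<open>z\<close> near
  \<open>y\<close>. Gradients there are bounded by the local Lipschitz constant and \<open>G\<close>
  is continuous, so \<open>gradient f z \<bullet> G y\<close> is almost 0, while it is at most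
  \<open>clarke_deriv f y (G y)\<close> up to a small error.\<close>

lemma clarke_nonneg_if_gradients_orthogonal:
  assumes "open U" "y \<in> U" and G: "isCont G y"
    and orth: "\<And>z v. z \<in> U \<Longrightarrow> v \<in> limiting_gradients f z \<Longrightarrow> G z \<bullet> v = 0"
  shows "0 \<le> clarke_deriv f y (G y)"
proof (rule field_le_epsilon)
  fix e :: real assume "0 < e"
  obtain r L where r: "0 < r" "L-lipschitz_on (ball y r) f"
    using lip unfolding locally_Lipschitz_def by blast
  have "0 \<le> L" using r(2) by (rule lipschitz_on_nonneg)
  obtain d1 where d1: "0 < d1" "\<And>z v. z \<in> ball y d1 \<Longrightarrow> GDERIV f z :> v \<Longrightarrow> v \<bullet> G y \<le> clarke_deriv f y (G y) + e / 2"
    using gderiv_inner_le_clarke[OF lip, of "e / 2"] \<open>0 < e\<close> by (metis half_gt_zero)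
  obtain d2 where d2: "0 < d2" "ball y d2 \<subseteq> U" using assms(1,2) open_contains_ball by blast
  have "0 < e / (2 * (L + 1))" using \<open>0 < e\<close> \<open>0 \<le> L\<close> by simp
  then obtain d3 where d3: "0 < d3" "\<And>z. dist z y < d3 \<Longrightarrow> dist (G z) (G y) < e / (2 * (L + 1))"
    using G unfolding continuous_at_eps_delta by blast
  obtain z where z: "z \<in> ball y (min (min d1 d2) (min d3 r))" "GDERIV f z :> gradient f z"
    "gradient f z \<in> limiting_gradients f z"
    using gderiv_dense[of "min (min d1 d2) (min d3 r)" y] d1 d2 d3 r by auto
  have "gradient f z \<bullet> G y \<le> clarke_deriv f y (G y) + e / 2" using z by (intro d1(2)) auto
  moreover have "gradient f z \<bullet> G z = 0" using orth[OF _ z(3)] z(1) d2(2) by (auto simp: inner_commute)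
  moreover have "\<bar>gradient f z \<bullet> (G z - G y)\<bar> \<le> e / 2"
  proof -
    have "norm (gradient f z) \<le> L" by (rule norm_gderiv_le[OF z(2) r(2)]) (use z in auto)
    moreover have "norm (G z - G y) \<le> e / (2 * (L + 1))" using d3(2)[of z] z(1)
      by (simp only: dist_norm[symmetric] dist_commute[of z y] mem_ball min_less_iff_conj less_imp_le)
    ultimately have "norm (gradient f z) * norm (G z - G y) \<le> (L + 1) * (e / (2 * (L + 1)))"
      using \<open>0 \<le> L\<close> by (intro mult_mono) auto
    also have "\<dots> = e / 2"
    proof -
      have "c * (e / (2 * c)) = e / 2" if "c \<noteq> 0" for c using that by simp
      from this[of "L + 1"] show ?thesis using \<open>0 \<le> L\<close> by linarith
    qed
    finally show ?thesis using Cauchy_Schwarz_ineq2[of "gradient f z" "G z - G y"] by linarith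
  qed
  ultimately show "0 \<le> clarke_deriv f y (G y) + e" by (simp add: inner_diff_right)
qed

text \<open>Over a short time \<open>k\<close> the solution differs from the straight step
  \<open>y + k *\<^sub>R w\<close> by a small multiple of \<open>k\<close>, and \<open>f\<close> is
  Lipschitz, so the nonnegative Clarke derivative along \<open>w\<close> becomes a nonnegative right
  Dini derivative of \<open>f \<circ> u\<close>.\<close>

lemma le_along_solution:
  assumes "open U" and G: "\<And>y. y \<in> U \<Longrightarrow> isCont G y"
    and orth: "\<And>z v. z \<in> U \<Longrightarrow> v \<in> limiting_gradients f z \<Longrightarrow> G z \<bullet> v = 0"
    and "0 \<le> h" and u: "\<And>t. t \<in> {0..h} \<Longrightarrow> u t \<in> U"
    and der: "\<And>t. t \<in> {0..h} \<Longrightarrow> (u has_vector_derivative G (u t)) (at t within {0..h})"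
  shows "f (u 0) \<le> f (u h)"
proof -
  have "(f \<circ> u) 0 \<le> (f \<circ> u) h"
  proof (rule le_if_right_Dini_nonneg[OF \<open>0 \<le> h\<close>])
    have contu: "continuous_on {0..h} u"
      using der has_vector_derivative_continuous continuous_on_eq_continuous_within by blast
    show "continuous_on {0..h} (f \<circ> u)"
      using continuous by (intro continuous_on_compose contu continuous_at_imp_continuous_on) auto
    fix t e :: real assume t: "0 \<le> t" "t < h" and "0 < e"
    define y where "y = u t"
    define w where "w = G y"
    have "0 \<le> clarke_deriv f y w"
      unfolding w_def using u[of t] t assms(1) G orth
      by (intro clarke_nonneg_if_gradients_orthogonal[where U = U]) (auto simp: y_def)
    obtain r L where r: "0 < r" "L-lipschitz_on (ball y r) f"
      using lip unfolding locally_Lipschitz_def by blast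
    have "0 \<le> L" using r(2) by (rule lipschitz_on_nonneg)
    define c where "c = e / (2 * (L + 1))"
    have "0 < c" using \<open>0 < e\<close> \<open>0 \<le> L\<close> by (simp add: c_def)
    have Lc: "L * c \<le> e / 2" using \<open>0 < e\<close> \<open>0 \<le> L\<close> by (simp add: c_def field_simps)
    have low: "\<forall>\<^sub>F k in at_right 0. (clarke_deriv f y w - e / 2) * k \<le> f (y + k *\<^sub>R w) - f y"
      using \<open>0 < e\<close> by (intro clarke_deriv_lower) simp
    have der': "(u has_vector_derivative w) (at t within {0..h})" using der[of t] t by (simp add: w_def y_def)
    then obtain d where d: "0 < d" "\<And>s. s \<in> {0..h} \<Longrightarrow> norm (s - t) < d \<Longrightarrow>
        norm (u s - u t - (s - t) *\<^sub>R w) \<le> c * norm (s - t)"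
      using \<open>0 < c\<close> unfolding has_vector_derivative_def has_derivative_within_alt by blast
    \<comment> \<open>A common bound for the speed and for the speed plus its error, so that
      straight step and solution both stay in the Lipschitz ball.\<close>
    define n where "n = 1 + norm w + c"
    have n: "1 \<le> n" "norm w \<le> n" "norm w + c \<le> n" using \<open>0 < c\<close> by (auto simp: n_def)
    have "\<forall>\<^sub>F k in at_right (0::real). 0 < k \<and> k < d \<and> k < h - t \<and> k < r / n"
      using d r n t by (auto simp: eventually_at_right_field intro!: exI[of _ "min (min d (h - t)) (r / n)"])
    with low show "\<forall>\<^sub>F k in at_right 0. (f \<circ> u) t - e * k \<le> (f \<circ> u) (t + k)"
    proof eventually_elim
      case (elim k)
      have kn: "k * n < r" using elim n by (simp add: pos_less_divide_eq)
      define p where "p = y + k *\<^sub>R w"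
      have uk: "norm (u (t + k) - p) \<le> c * k"
        using d(2)[of "t + k"] elim t by (simp add: p_def y_def algebra_simps)
      have kw: "norm (p - y) = k * norm w" using elim by (simp add: p_def)
      have "norm (u (t + k) - y) \<le> k * (norm w + c)"
        using norm_triangle_ineq[of "u (t + k) - p" "p - y"] uk kw by (simp add: algebra_simps)
      also have "\<dots> \<le> k * n" using elim n by (intro mult_left_mono) auto
      finally have 1: "u (t + k) \<in> ball y r" using kn by (simp add: dist_norm norm_minus_commute)
      have "k * norm w \<le> k * n" using elim n by (intro mult_left_mono) auto
      then have 2: "p \<in> ball y r" using kn kw by (simp add: dist_norm norm_minus_commute)
      have "\<bar>f (u (t + k)) - f p\<bar> \<le> L * norm (u (t + k) - p)"
        using lipschitz_onD[OF r(2) 1 2] by (simp add: dist_norm)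
      also have "\<dots> \<le> L * (c * k)" using uk \<open>0 \<le> L\<close> by (rule mult_left_mono)
      also have "\<dots> \<le> (e / 2) * k" using Lc elim mult_right_mono[OF Lc, of k] by (simp add: algebra_simps)
      finally have "f p - e / 2 * k \<le> f (u (t + k))" by linarith
      moreover have "- (e / 2) * k \<le> (clarke_deriv f y w - e / 2) * k"
        using \<open>0 \<le> clarke_deriv f y w\<close> elim by (intro mult_right_mono) auto
      ultimately show ?case using elim(1) by (simp add: y_def p_def algebra_simps)
    qed
  qed
  then show ?thesis by simp
qed

text \<open>The mean value theorem finds a point \<open>y\<close> of the segment with a strongly
  negative backward derivative, and gradients at differentiability points near \<open>y\<close>
  inherit it. Local Lipschitz constants can thus be read off from gradients.\<close>

lemma gradient_ge_lip:
  assumes "0 < r" and steep: "a * norm (p - q) < f p - f q" and seg: "closed_segment p q \<subseteq> ball x r"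
  obtains z where "z \<in> ball x r" "GDERIV f z :> gradient f z"
    "gradient f z \<in> limiting_gradients f z" "a \<le> norm (gradient f z)"
proof -
  have "p \<noteq> q" using steep by auto
  define l where "l = norm (p - q)"
  define w where "w = (p - q) /\<^sub>R l"
  have l: "0 < l" "norm w = 1" "q + l *\<^sub>R w = p" using \<open>p \<noteq> q\<close> by (auto simp: l_def w_def)
  \<comment> \<open>A third of the surplus slope: one share keeps the mean value inequality strict,
    another is lost in passing from \<open>y\<close> to \<open>z\<close>.\<close>
  define g where "g = (f p - f q - a * l) / (3 * l)"
  have "0 < g" using steep l by (simp add: g_def l_def)
  have "3 * (g * l) = f p - f q - a * l" using l by (simp add: g_def)
  moreover have "0 < g * l" using \<open>0 < g\<close> l(1) by simp
  ultimately have "(a + g) * l < f (q + l *\<^sub>R w) - f q" unfolding l(3) distrib_right by linarith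
  then obtain s where s: "0 < s" "s \<le> l" "clarke_deriv f (q + s *\<^sub>R w) (- w) \<le> - (a + g)"
    using clarke_mean_value l(1) by blast
  define y where "y = q + s *\<^sub>R w"
  have "y \<in> closed_segment q p"
    unfolding in_segment using s l
    by (intro exI[of _ "s / l"] conjI) (simp_all add: y_def w_def algebra_simps divide_inverse[symmetric])
  then have "y \<in> ball x r" using seg by (auto simp: closed_segment_commute)
  then obtain d1 where d1: "0 < d1" "ball y d1 \<subseteq> ball x r" using open_contains_ball open_ball by metis
  obtain d2 where d2: "0 < d2" "\<And>z v. z \<in> ball y d2 \<Longrightarrow> GDERIV f z :> v \<Longrightarrow> v \<bullet> (- w) \<le> clarke_deriv f y (- w) + g"
    using gderiv_inner_le_clarke[OF lip \<open>0 < g\<close>] by metis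
  obtain z where z: "z \<in> ball y (min d1 d2)" "GDERIV f z :> gradient f z"
    "gradient f z \<in> limiting_gradients f z"
    using gderiv_dense[of "min d1 d2" y] d1 d2 by auto
  have "gradient f z \<bullet> (- w) \<le> clarke_deriv f y (- w) + g" using z by (intro d2(2)) auto
  then have "a \<le> gradient f z \<bullet> w" using s(3) by (simp add: y_def)
  also have "\<dots> \<le> norm (gradient f z)" using norm_cauchy_schwarz[of "gradient f z" w] l by simp
  finally show ?thesis using that z d1(2) by auto
qed

end

section \<open>Short-time flows\<close>

definition solves_ode :: "('a::real_normed_vector \<Rightarrow> 'a) \<Rightarrow> 'a set \<Rightarrow> real \<Rightarrow> (real \<Rightarrow> 'a) \<Rightarrow> bool" where
  "solves_ode G X h u \<longleftrightarrow>
     (\<forall>t\<in>{0..h}. u t \<in> X \<and> (u has_vector_derivative G (u t)) (at t within {0..h}))"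

lemma solves_odeD:
  assumes "solves_ode G X h u" "t \<in> {0..h}"
  shows "u t \<in> X" "(u has_vector_derivative G (u t)) (at t within {0..h})"
  using assms by (auto simp: solves_ode_def)

lemma solves_ode_continuous_on: "solves_ode G X h u \<Longrightarrow> continuous_on {0..h} u"
  unfolding solves_ode_def
  using has_vector_derivative_continuous continuous_on_eq_continuous_within by blast

lemma solves_ode_mono:
  assumes "solves_ode G X h u" "X \<subseteq> Y" "k \<le> h"
  shows "solves_ode G Y k u"
  using assms unfolding solves_ode_def
  by (auto intro: has_vector_derivative_within_subset[where S = "{0..h}"])

lemma solves_ode_reverse:
  assumes u: "solves_ode G X h u"
  shows "solves_ode (\<lambda>y. - G y) X h (\<lambda>t. u (h - t))"
  unfolding solves_ode_def
proof (intro ballI conjI)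
  fix t assume t: "t \<in> {0..h}"
  then have t': "h - t \<in> {0..h}" by auto
  show "u (h - t) \<in> X" using solves_odeD(1)[OF u t'] .
  have im: "(\<lambda>t. h - t) ` {0..h} \<subseteq> {0..h}" by auto
  have "((\<lambda>t. h - t) has_vector_derivative (- 1)) (at t within {0..h})"
    by (auto intro!: derivative_eq_intros)
  moreover have "(u has_vector_derivative G (u (h - t))) (at (h - t) within (\<lambda>t. h - t) ` {0..h})"
    using solves_odeD(2)[OF u t'] im by (rule has_vector_derivative_within_subset)
  ultimately have "(u \<circ> (\<lambda>t. h - t) has_vector_derivative (- 1) *\<^sub>R G (u (h - t))) (at t within {0..h})"
    by (rule vector_diff_chain_within)
  then show "((\<lambda>t. u (h - t)) has_vector_derivative - G (u (h - t))) (at t within {0..h})"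
    by (simp add: o_def)
qed

text \<open>Banach's fixed point theorem in the bounded continuous functions on the whole line. The
  clamp \<open>j\<close> freezes time outside the interval from 0 to \<open>h\<close>, so that the
  Picard operator produces bounded functions, and \<open>K * h\<close> is its contraction
  factor.\<close>

lemma picard_global:
  fixes G :: "'a::euclidean_space \<Rightarrow> 'a"
  assumes lip: "K-lipschitz_on UNIV G" and "0 \<le> h" "K * h < 1"
  shows "\<exists>u. u 0 = y0 \<and> solves_ode G UNIV h u"
proof -
  define j where "j t = min h (max 0 t)" for t :: real
  have j: "0 \<le> j t" "j t \<le> h" for t using \<open>0 \<le> h\<close> by (auto simp: j_def)
  have contj: "continuous_on UNIV j" unfolding j_def by (intro continuous_intros)
  have contG: "continuous_on UNIV G" using lip by (rule lipschitz_on_continuous_on)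
  have K: "0 \<le> K" using lip by (rule lipschitz_on_nonneg)
  have contGu: "continuous_on S (\<lambda>t. G (u t))" if "continuous_on S u" for S and u :: "real \<Rightarrow> 'a"
    using continuous_on_compose2[OF contG that] by auto
  define P where "P u t = y0 + integral {0..j t} (\<lambda>s. G (u s))" for u :: "real \<Rightarrow> 'a" and t
  have contP: "continuous_on UNIV (P u)" if "continuous_on UNIV u" for u
  proof -
    have "continuous_on {0..h} (\<lambda>x. integral {0..x} (\<lambda>s. G (u s)))"
      by (intro indefinite_integral_continuous_1 integrable_continuous_interval contGu)
        (rule continuous_on_subset[OF that], simp)
    then have "continuous_on UNIV (\<lambda>t. integral {0..j t} (\<lambda>s. G (u s)))"
      by (rule continuous_on_compose2[OF _ contj]) (use j in auto)
    then show ?thesis unfolding P_def by (intro continuous_intros)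
  qed
  have Pb: "P u \<in> bcontfun" if "continuous_on UNIV u" for u
  proof -
    have "range (P u) \<subseteq> P u ` {0..h}"
    proof
      fix y assume "y \<in> range (P u)"
      then obtain t where "y = P u t" by auto
      then have "y = P u (j t)" using j[of t] by (simp add: P_def) (simp add: j_def)
      then show "y \<in> P u ` {0..h}" using j[of t] by auto
    qed
    moreover have "compact (P u ` {0..h})"
      by (intro compact_continuous_image continuous_on_subset[OF contP[OF that]]) auto
    ultimately show ?thesis
      using contP[OF that] bounded_subset compact_imp_bounded by (auto simp: bcontfun_def)
  qed
  define T where "T u = Bcontfun (P (apply_bcontfun u))" for u :: "real \<Rightarrow>\<^sub>C 'a"
  have T: "apply_bcontfun (T u) = P (apply_bcontfun u)" for u
    unfolding T_def by (rule Bcontfun_inverse[OF Pb]) simp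
  have "\<exists>!u. T u = u"
  proof (rule banach_fix_type[of "K * h"])
    show "0 \<le> K * h" "K * h < 1" using assms K by auto
    show "\<forall>u v. dist (T u) (T v) \<le> K * h * dist u v"
    proof (intro allI dist_bound)
      fix u v :: "real \<Rightarrow>\<^sub>C 'a" and t
      have int: "(\<lambda>s. G (apply_bcontfun u s)) integrable_on {0..j t}" for u
        by (intro integrable_continuous_interval contGu) simp
      have "dist (apply_bcontfun (T u) t) (apply_bcontfun (T v) t) =
          norm (integral {0..j t} (\<lambda>s. G (apply_bcontfun u s) - G (apply_bcontfun v s)))"
        unfolding T P_def dist_norm by (simp add: integral_diff[OF int int])
      also have "\<dots> \<le> (K * dist u v) * (j t - 0)"
      proof (rule integral_bound)
        show "0 \<le> j t" by (rule j)
        show "continuous_on {0..j t} (\<lambda>s. G (apply_bcontfun u s) - G (apply_bcontfun v s))"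
          by (intro continuous_on_diff contGu) simp_all
        fix s
        have "norm (G (apply_bcontfun u s) - G (apply_bcontfun v s)) \<le> K * dist (apply_bcontfun u s) (apply_bcontfun v s)"
          using lipschitz_onD[OF lip, of "apply_bcontfun u s" "apply_bcontfun v s"] by (simp add: dist_norm)
        also have "\<dots> \<le> K * dist u v" by (intro mult_left_mono dist_bounded K)
        finally show "norm (G (apply_bcontfun u s) - G (apply_bcontfun v s)) \<le> K * dist u v" .
      qed
      also have "\<dots> \<le> K * dist u v * h" using j K by (intro mult_left_mono) auto
      finally show "dist (apply_bcontfun (T u) t) (apply_bcontfun (T v) t) \<le> K * h * dist u v"
        by (simp add: mult_ac)
    qed
  qed
  then obtain u where u: "T u = u" by blast
  have eq: "apply_bcontfun u t = P (apply_bcontfun u) t" for t using T[of u] u by simp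
  have eq': "apply_bcontfun u t = y0 + integral {0..t} (\<lambda>s. G (apply_bcontfun u s))" if "t \<in> {0..h}" for t
    using that by (subst eq) (simp add: P_def j_def)
  have "(apply_bcontfun u has_vector_derivative G (apply_bcontfun u t)) (at t within {0..h})" if t: "t \<in> {0..h}" for t
  proof (rule has_vector_derivative_transform[OF t eq'])
    have "((\<lambda>t. integral {0..t} (\<lambda>s. G (apply_bcontfun u s))) has_vector_derivative G (apply_bcontfun u t)) (at t within {0..h})"
      using t by (intro integral_has_vector_derivative contGu) auto
    then show "((\<lambda>t. y0 + integral {0..t} (\<lambda>s. G (apply_bcontfun u s))) has_vector_derivative G (apply_bcontfun u t)) (at t within {0..h})"
      by (auto intro!: derivative_eq_intros)
  qed
  moreover have "apply_bcontfun u 0 = y0" using eq'[of 0] \<open>0 \<le> h\<close> by simp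
  ultimately show ?thesis unfolding solves_ode_def by auto
qed

text \<open>Composed with the nearest-point projection onto the ball, which does not increase
  distances, the field becomes Lipschitz everywhere. Its solution moves at most \<open>r / 2\<close>
  up to time \<open>h\<close>, hence stays in the ball, where the projection does nothing.\<close>

lemma picard_local:
  fixes G :: "'a::euclidean_space \<Rightarrow> 'a"
  assumes lip: "K-lipschitz_on (cball x0 r) G" and "0 < r"
    and M: "\<And>y. y \<in> cball x0 r \<Longrightarrow> norm (G y) \<le> M"
    and y0: "y0 \<in> cball x0 (r / 2)" and "0 \<le> h" "K * h < 1" "M * h \<le> r / 2"
  shows "\<exists>u. u 0 = y0 \<and> solves_ode G (cball x0 r) h u"
proof -
  define c where "c = closest_point (cball x0 r)"
  have cm: "c y \<in> cball x0 r" for y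
    unfolding c_def using \<open>0 < r\<close> by (intro closest_point_in_set) auto
  have ci: "c y = y" if "y \<in> cball x0 r" for y using that unfolding c_def by (rule closest_point_self)
  have "K-lipschitz_on UNIV (\<lambda>y. G (c y))"
  proof (rule lipschitz_onI)
    show K: "0 \<le> K" using lip by (rule lipschitz_on_nonneg)
    fix y z
    have "dist (G (c y)) (G (c z)) \<le> K * dist (c y) (c z)" by (rule lipschitz_onD[OF lip cm cm])
    also have "\<dots> \<le> K * dist y z" unfolding c_def
      using \<open>0 < r\<close> by (intro mult_left_mono K closest_point_lipschitz) auto
    finally show "dist (G (c y)) (G (c z)) \<le> K * dist y z" .
  qed
  then obtain u where u: "u 0 = y0" "solves_ode (\<lambda>y. G (c y)) UNIV h u"
    using picard_global assms(5,6) by blast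
  have mem: "u t \<in> cball x0 r" if t: "t \<in> {0..h}" for t
  proof -
    have M0: "0 \<le> M" using M[of x0] \<open>0 < r\<close> norm_ge_zero[of "G x0"] by (simp del: norm_ge_zero)
    have "norm (u t - u 0) \<le> M * norm (t - 0)"
    proof (rule differentiable_bound[of "{0..h}" u "\<lambda>t d. d *\<^sub>R G (c (u t))"])
      fix s assume "s \<in> {0..h}"
      then show "(u has_derivative (\<lambda>d. d *\<^sub>R G (c (u s)))) (at s within {0..h})"
        using solves_odeD(2)[OF u(2)] by (simp add: has_vector_derivative_def)
      show "onorm (\<lambda>d. d *\<^sub>R G (c (u s))) \<le> M"
      proof (rule onorm_bound[OF M0])
        fix d :: real
        show "norm (d *\<^sub>R G (c (u s))) \<le> M * norm d"
          using mult_left_mono[OF M[OF cm], of "\<bar>d\<bar>"] by (simp add: mult.commute)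
      qed
    qed (use t in auto)
    also have "\<dots> \<le> M * h" using t M0 by (intro mult_left_mono) auto
    finally have "dist y0 (u t) \<le> r / 2" using u(1) assms(7) by (simp add: dist_norm norm_minus_commute)
    then show ?thesis using y0 dist_triangle[of x0 "u t" y0] by simp
  qed
  have "solves_ode G (cball x0 r) h u"
    using u(2) mem ci unfolding solves_ode_def by auto
  with u(1) show ?thesis by blast
qed

text \<open>This expansion to first order in \<open>h\<close> replaces the variational equation: the flow need not be
  known to be differentiable in its initial value.\<close>

lemma solution_difference:
  fixes G :: "'a::euclidean_space \<Rightarrow> 'a"
  assumes A: "bounded_linear A" "\<And>e. norm (A e) \<le> B * norm e" "0 \<le> B"
    and strict: "\<And>y z. y \<in> X \<Longrightarrow> z \<in> X \<Longrightarrow> norm (G y - G z - A (y - z)) \<le> \<eta> * norm (y - z)"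
    and "0 \<le> \<eta>" "0 \<le> h" "(B + \<eta>) * h \<le> 1 / 2"
    and u: "solves_ode G X h u" and v: "solves_ode G X h v"
  shows "norm (u h - v h - (u 0 - v 0) - h *\<^sub>R A (u 0 - v 0))
           \<le> h * ((2 * \<eta> + 2 * B * (B + \<eta>) * h) * norm (u 0 - v 0))"
proof -
  interpret A: bounded_linear A by fact
  define D where "D t = u t - v t" for t
  define D' where "D' t = G (u t) - G (v t)" for t
  define d where "d = norm (D 0)"
  have der: "(D has_vector_derivative D' t) (at t within {0..h})" if "t \<in> {0..h}" for t
    unfolding D_def D'_def using solves_odeD(2)[OF u that] solves_odeD(2)[OF v that]
    by (rule has_vector_derivative_diff)
  have D'A: "norm (D' t - A (D t)) \<le> \<eta> * norm (D t)" if "t \<in> {0..h}" for t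
    unfolding D'_def D_def using solves_odeD(1)[OF u that] solves_odeD(1)[OF v that] by (rule strict)
  have D': "norm (D' t) \<le> (B + \<eta>) * norm (D t)" if "t \<in> {0..h}" for t
    using norm_triangle_sub[of "D' t" "A (D t)"] D'A[OF that] A(2)[of "D t"] by (simp add: algebra_simps)
  have bound: "norm (D t - D 0) \<le> c * t"
    if c: "0 \<le> c" "\<And>s. s \<in> {0..h} \<Longrightarrow> norm (D' s) \<le> c" and t: "t \<in> {0..h}" for c t
  proof -
    have "norm (D t - D 0) \<le> c * norm (t - 0)"
    proof (rule differentiable_bound[of "{0..h}" D "\<lambda>t d. d *\<^sub>R D' t"])
      fix s assume s: "s \<in> {0..h}"
      then show "(D has_derivative (\<lambda>d. d *\<^sub>R D' s)) (at s within {0..h})"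
        using der by (simp add: has_vector_derivative_def)
      show "onorm (\<lambda>d. d *\<^sub>R D' s) \<le> c"
      proof (rule onorm_bound[OF c(1)])
        fix d :: real
        show "norm (d *\<^sub>R D' s) \<le> c * norm d"
          using mult_left_mono[OF c(2)[OF s], of "\<bar>d\<bar>"] by (simp add: mult.commute)
      qed
    qed (use t in auto)
    then show ?thesis using t by simp
  qed
  have contD: "continuous_on {0..h} (\<lambda>t. norm (D t))"
    unfolding D_def by (intro continuous_intros solves_ode_continuous_on[OF u] solves_ode_continuous_on[OF v])
  \<comment> \<open>The time of largest separation replaces Gronwall's inequality: the growth
    \<open>(B + \<eta>) * h\<close> is at most one half, so it can be absorbed and leaves a factor
    2.\<close>
  obtain tm where tm: "tm \<in> {0..h}" "\<And>t. t \<in> {0..h} \<Longrightarrow> norm (D t) \<le> norm (D tm)"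
    using continuous_attains_sup[OF compact_Icc _ contD] \<open>0 \<le> h\<close> by force
  have "norm (D tm - D 0) \<le> ((B + \<eta>) * norm (D tm)) * tm"
  proof (rule bound[OF _ _ tm(1)])
    fix s assume s: "s \<in> {0..h}"
    show "norm (D' s) \<le> (B + \<eta>) * norm (D tm)"
      using D'[OF s] mult_left_mono[OF tm(2)[OF s], of "B + \<eta>"] A(3) assms(5) by simp
  qed (use A assms in simp)
  also have "\<dots> \<le> ((B + \<eta>) * norm (D tm)) * h" using tm(1) A(3) assms(5) by (intro mult_left_mono) auto
  also have "\<dots> \<le> norm (D tm) / 2" using mult_right_mono[OF assms(7), of "norm (D tm)"] by (simp add: mult_ac)
  finally have "norm (D tm - D 0) \<le> norm (D tm) / 2" .
  moreover have "norm (D tm) \<le> norm (D tm - D 0) + d" unfolding d_def using norm_triangle_sub by (simp add: add.commute)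
  ultimately have "norm (D tm) \<le> 2 * d" by simp
  with tm(2) have D2: "norm (D t) \<le> 2 * d" if "t \<in> {0..h}" for t using that by force
  have D0: "norm (D t - D 0) \<le> 2 * (B + \<eta>) * d * h" if t: "t \<in> {0..h}" for t
  proof -
    have "norm (D t - D 0) \<le> (2 * (B + \<eta>) * d) * t"
    proof (rule bound[OF _ _ t])
      fix s assume s: "s \<in> {0..h}"
      show "norm (D' s) \<le> 2 * (B + \<eta>) * d"
        using D'[OF s] mult_left_mono[OF D2[OF s], of "B + \<eta>"] A(3) assms(5) by (simp add: algebra_simps)
    qed (use A(3) assms(5) in \<open>simp add: d_def\<close>)
    also have "\<dots> \<le> 2 * (B + \<eta>) * d * h" using t A(3) assms(5) by (intro mult_left_mono) (auto simp: d_def)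
    finally show ?thesis .
  qed
  \<comment> \<open>Error of the velocity difference against the constant vector
    \<open>A (D 0)\<close>: strict differentiability contributes \<open>\<eta>\<close> times
    \<open>2 * d\<close>, and the drift of \<open>D s\<close> away from \<open>D 0\<close>
    contributes the rest.\<close>
  define c where "c = (2 * \<eta> + 2 * B * (B + \<eta>) * h) * d"
  have c0: "0 \<le> c" using A(3) assms(5,6) by (simp add: c_def d_def)
  have "norm ((D h - h *\<^sub>R A (D 0)) - (D 0 - 0 *\<^sub>R A (D 0))) \<le> c * norm (h - 0)"
  proof (rule differentiable_bound[of "{0..h}" "\<lambda>t. D t - t *\<^sub>R A (D 0)" "\<lambda>t d. d *\<^sub>R (D' t - A (D 0))"])
    fix s assume s: "s \<in> {0..h}"
    show "((\<lambda>t. D t - t *\<^sub>R A (D 0)) has_derivative (\<lambda>d. d *\<^sub>R (D' s - A (D 0)))) (at s within {0..h})"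
      using der[OF s] unfolding has_vector_derivative_def
      by (auto intro!: derivative_eq_intros simp: scaleR_diff_right)
    have "norm (D' s - A (D 0)) \<le> norm (D' s - A (D s)) + norm (A (D s - D 0))"
      using norm_triangle_ineq[of "D' s - A (D s)" "A (D s - D 0)"] by (simp add: A.diff)
    also have "\<dots> \<le> \<eta> * (2 * d) + B * (2 * (B + \<eta>) * d * h)"
      using D'A[OF s] mult_left_mono[OF D2[OF s] assms(5)] A(2)[of "D s - D 0"] mult_left_mono[OF D0[OF s] A(3)] by linarith
    also have "\<dots> = c" by (simp add: c_def algebra_simps)
    finally have cs: "norm (D' s - A (D 0)) \<le> c" .
    show "onorm (\<lambda>d. d *\<^sub>R (D' s - A (D 0))) \<le> c"
    proof (rule onorm_bound[OF c0])
      fix d :: real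
      show "norm (d *\<^sub>R (D' s - A (D 0))) \<le> c * norm d"
        using mult_left_mono[OF cs, of "\<bar>d\<bar>"] by (simp add: mult.commute)
    qed
  qed (use assms in auto)
  then show ?thesis using assms(6) by (simp add: D_def c_def d_def algebra_simps)
qed

text \<open>\<open>\<rho>\<close> and \<open>\<delta>\<close> depend only on \<open>x0\<close>, so
  one choice serves all short pieces of trajectory near that point, as bisection requires; the
  domain size \<open>\<eta>\<close> of \<open>\<phi>\<close> may depend on the piece.\<close>

lemma local_flow:
  fixes G :: "'a::euclidean_space \<Rightarrow> 'a"
  assumes A: "bounded_linear A" and "0 < e"
    and strict: "\<And>\<eta>. 0 < \<eta> \<Longrightarrow> \<exists>r>0. cball x0 r \<subseteq> U \<and>
        (\<forall>y\<in>cball x0 r. \<forall>z\<in>cball x0 r. norm (G y - G z - A (y - z)) \<le> \<eta> * norm (y - z))"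
  obtains \<rho> \<delta> where "0 < \<rho>" "0 < \<delta>"
    "\<And>h u. 0 \<le> h \<Longrightarrow> h < \<delta> \<Longrightarrow> solves_ode G (ball x0 \<rho>) h u \<Longrightarrow>
       \<exists>\<phi> \<eta>. 0 < \<eta> \<and> \<phi> (u 0) = u h \<and>
         (\<forall>y\<in>ball (u 0) \<eta>. \<exists>v. v 0 = y \<and> v h = \<phi> y \<and> solves_ode G U h v) \<and>
         (\<forall>y\<in>ball (u 0) \<eta>. \<forall>z\<in>ball (u 0) \<eta>.
            norm (\<phi> y - \<phi> z - (y - z) - h *\<^sub>R A (y - z)) \<le> h * e * norm (y - z))"
proof -
  define B where "B = onorm A"
  have B: "0 \<le> B" "norm (A v) \<le> B * norm v" for v
    unfolding B_def using A onorm_pos_le onorm by blast+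
  \<comment> \<open>Half of \<open>e\<close> is reserved for \<open>2 * \<eta>\<close>, the other
    half for the error quadratic in \<open>h\<close>, through the last bound in
    \<open>\<delta>\<close>.\<close>
  define \<eta> where "\<eta> = min 1 (e / 4)"
  have \<eta>: "0 < \<eta>" "\<eta> \<le> 1" "\<eta> \<le> e / 4" using \<open>0 < e\<close> by (auto simp: \<eta>_def)
  obtain r where r: "0 < r" "cball x0 r \<subseteq> U"
    "\<And>y z. y \<in> cball x0 r \<Longrightarrow> z \<in> cball x0 r \<Longrightarrow> norm (G y - G z - A (y - z)) \<le> \<eta> * norm (y - z)"
    using strict[OF \<eta>(1)] by blast
  define K where "K = B + \<eta>"
  have K: "0 < K" using B \<eta> by (simp add: K_def add_nonneg_pos)
  have GK: "norm (G y - G z) \<le> K * norm (y - z)" if "y \<in> cball x0 r" "z \<in> cball x0 r" for y z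
    using norm_triangle_sub[of "G y - G z" "A (y - z)"] r(3)[OF that] B(2)[of "y - z"]
    by (simp add: K_def algebra_simps)
  have lip: "K-lipschitz_on (cball x0 r) G"
    by (rule lipschitz_onI) (use GK K in \<open>auto simp: dist_norm\<close>)
  define M where "M = norm (G x0) + K * r"
  have M: "norm (G y) \<le> M" if "y \<in> cball x0 r" for y
  proof -
    have "norm (G y - G x0) \<le> K * norm (y - x0)" using that r(1) by (intro GK) auto
    also have "\<dots> \<le> K * r" using that K by (intro mult_left_mono) (auto simp: dist_norm norm_minus_commute)
    finally show ?thesis using norm_triangle_sub[of "G y" "G x0"] by (simp add: M_def)
  qed
  have M0: "0 \<le> M" using K r(1) by (simp add: M_def)
  \<comment> \<open>In turn: existence and absorption need \<open>K * h \<le> 1 / 2\<close>,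
    confinement to the ball needs \<open>M * h \<le> r / 2\<close>, and the quadratic error must
    stay below \<open>e / 2\<close>.\<close>
  define \<delta> where "\<delta> = min (1 / (2 * K)) (min (r / (2 * (M + 1))) (e / (4 * (B + 1) * K)))"
  have BK: "0 < 4 * (B + 1) * K" using B K by simp
  have \<delta>: "0 < \<delta>" using K r(1) M0 \<open>0 < e\<close> BK by (simp add: \<delta>_def)
  have small: "K * h \<le> 1 / 2" "M * h \<le> r / 2" "2 * \<eta> + 2 * B * (B + \<eta>) * h \<le> e"
    if h: "0 \<le> h" "h < \<delta>" for h
  proof -
    have h': "h \<le> 1 / (2 * K)" "h \<le> r / (2 * (M + 1))" "h \<le> e / (4 * (B + 1) * K)"
      using h by (auto simp: \<delta>_def)
    show "K * h \<le> 1 / 2" using h'(1) K by (simp add: field_simps)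
    have "(M + 1) * h \<le> r / 2" using h'(2) M0 by (simp add: field_simps)
    then show "M * h \<le> r / 2" using h(1) by (simp add: algebra_simps)
    have "h * (4 * (B + 1) * K) \<le> e" using h'(3) BK by (simp add: pos_le_divide_eq)
    moreover have "0 \<le> h * (4 * K)" using h K by simp
    ultimately have "4 * (B * K * h) \<le> e" by (simp add: algebra_simps)
    moreover have "2 * B * (B + \<eta>) * h = 2 * (B * K * h)" by (simp add: K_def)
    ultimately show "2 * \<eta> + 2 * B * (B + \<eta>) * h \<le> e" using \<eta>(3) by linarith
  qed
  show ?thesis
  proof (rule that[of "r / 2" \<delta>])
    show "0 < r / 2" "0 < \<delta>" using r(1) \<delta> by auto
    fix h u assume h: "0 \<le> h" "h < \<delta>" and u: "solves_ode G (ball x0 (r / 2)) h u"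
    define \<phi> where "\<phi> y = (SOME v. v 0 = y \<and> solves_ode G (cball x0 r) h v) h" for y
    have "\<exists>v. v 0 = y \<and> solves_ode G (cball x0 r) h v" if "y \<in> cball x0 (r / 2)" for y
    proof (rule picard_local[OF lip r(1) M that h(1)])
      show "K * h < 1" using small(1)[OF h] by simp
    qed (use small(2)[OF h] in auto)
    then have flow: "\<exists>v. v 0 = y \<and> v h = \<phi> y \<and> solves_ode G (cball x0 r) h v" if "y \<in> cball x0 (r / 2)" for y
      unfolding \<phi>_def using someI_ex[of "\<lambda>v. v 0 = y \<and> solves_ode G (cball x0 r) h v"] that by blast
    have diff: "norm (v h - w h - (v 0 - w 0) - h *\<^sub>R A (v 0 - w 0)) \<le> h * e * norm (v 0 - w 0)"
      if v: "solves_ode G (cball x0 r) h v" and w: "solves_ode G (cball x0 r) h w" for v w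
    proof -
      have "norm (v h - w h - (v 0 - w 0) - h *\<^sub>R A (v 0 - w 0))
          \<le> h * ((2 * \<eta> + 2 * B * (B + \<eta>) * h) * norm (v 0 - w 0))"
      proof (rule solution_difference[OF A B(2) B(1) r(3) _ h(1) _ v w])
        show "(B + \<eta>) * h \<le> 1 / 2" using small(1)[OF h] by (simp add: K_def)
      qed (use \<eta> in auto)
      also have "\<dots> \<le> h * (e * norm (v 0 - w 0))"
        using small(3)[OF h] h(1) by (intro mult_left_mono mult_right_mono) auto
      finally show ?thesis by (simp add: mult_ac)
    qed
    have u0: "u 0 \<in> ball x0 (r / 2)" using solves_odeD(1)[OF u, of 0] h(1) by simp
    have u': "solves_ode G (cball x0 r) h u"
      by (rule solves_ode_mono[OF u]) (use r(1) in auto)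
    define \<epsilon> where "\<epsilon> = r / 2 - dist x0 (u 0)"
    have sub: "ball (u 0) \<epsilon> \<subseteq> cball x0 (r / 2)"
    proof
      fix y assume "y \<in> ball (u 0) \<epsilon>"
      then show "y \<in> cball x0 (r / 2)" using dist_triangle[of x0 y "u 0"] by (simp add: \<epsilon>_def)
    qed
    show "\<exists>\<phi> \<eta>. 0 < \<eta> \<and> \<phi> (u 0) = u h \<and>
         (\<forall>y\<in>ball (u 0) \<eta>. \<exists>v. v 0 = y \<and> v h = \<phi> y \<and> solves_ode G U h v) \<and>
         (\<forall>y\<in>ball (u 0) \<eta>. \<forall>z\<in>ball (u 0) \<eta>.
            norm (\<phi> y - \<phi> z - (y - z) - h *\<^sub>R A (y - z)) \<le> h * e * norm (y - z))"
    proof (intro exI[of _ \<phi>] exI[of _ \<epsilon>] conjI ballI)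
      show "0 < \<epsilon>" using u0 by (simp add: \<epsilon>_def)
      \<comment> \<open>By \<open>diff\<close> with zero separation, solutions with equal initial
        values have equal end points; so the chosen solution from \<open>u 0\<close> meets
        \<open>u\<close> at time \<open>h\<close>.\<close>
      obtain v where v: "v 0 = u 0" "v h = \<phi> (u 0)" "solves_ode G (cball x0 r) h v"
        using flow[of "u 0"] u0 by auto
      have "A 0 = 0" using A bounded_linear.linear linear_0 by blast
      with diff[OF v(3) u'] v(1,2) show "\<phi> (u 0) = u h" by simp
    next
      fix y assume "y \<in> ball (u 0) \<epsilon>"
      from flow[OF subsetD[OF sub this]] show "\<exists>v. v 0 = y \<and> v h = \<phi> y \<and> solves_ode G U h v"
        using solves_ode_mono[OF _ r(2) order_refl] by metis
    next
      fix y z assume yz: "y \<in> ball (u 0) \<epsilon>" "z \<in> ball (u 0) \<epsilon>"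
      obtain v w where "v 0 = y" "v h = \<phi> y" "solves_ode G (cball x0 r) h v"
        "w 0 = z" "w h = \<phi> z" "solves_ode G (cball x0 r) h w" using flow[OF subsetD[OF sub yz(1)]] flow[OF subsetD[OF sub yz(2)]] by metis
      then show "norm (\<phi> y - \<phi> z - (y - z) - h *\<^sub>R A (y - z)) \<le> h * e * norm (y - z)"
        using diff[of v w] by simp
    qed
  qed
qed

section \<open>Transport of germs and contraction along a trajectory\<close>

definition germ_map :: "('a::euclidean_space \<Rightarrow> real) \<Rightarrow> 'a \<Rightarrow> 'a \<Rightarrow> ('a \<Rightarrow> 'a) \<Rightarrow> real \<Rightarrow> real \<Rightarrow> bool" where
  "germ_map f p q \<phi> \<eta> K \<longleftrightarrow>
     0 < \<eta> \<and> \<phi> p = q \<and> K-lipschitz_on (ball p \<eta>) \<phi> \<and> (\<forall>y\<in>ball p \<eta>. f (\<phi> y) = f y)"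

text \<open>A directed relation: growth bounds for \<open>f\<close> about \<open>q\<close> pass to
  \<open>p\<close>. On the trajectory both directions are available, from the flows of
  \<open>G\<close> and of its negative.\<close>

definition germ_related :: "('a::euclidean_space \<Rightarrow> real) \<Rightarrow> 'a \<Rightarrow> 'a \<Rightarrow> bool" where
  "germ_related f p q \<longleftrightarrow> (\<exists>\<phi> \<eta> K. germ_map f p q \<phi> \<eta> K)"

lemma germ_related_trans:
  assumes "germ_related f p q" "germ_related f q r"
  shows "germ_related f p r"
proof -
  obtain \<phi> \<eta> K where 1: "0 < \<eta>" "\<phi> p = q" "K-lipschitz_on (ball p \<eta>) \<phi>" "\<And>y. y\<in>ball p \<eta> \<Longrightarrow> f (\<phi> y) = f y"
    using assms(1) by (auto simp: germ_related_def germ_map_def)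
  obtain \<psi> \<theta> L where 2: "0 < \<theta>" "\<psi> q = r" "L-lipschitz_on (ball q \<theta>) \<psi>" "\<And>y. y\<in>ball q \<theta> \<Longrightarrow> f (\<psi> y) = f y"
    using assms(2) by (auto simp: germ_related_def germ_map_def)
  have K: "0 \<le> K" using 1(3) by (rule lipschitz_on_nonneg)
  define d where "d = min \<eta> (\<theta> / (K + 1))"
  have d: "0 < d" "d \<le> \<eta>" "d \<le> \<theta> / (K + 1)" using 1(1) 2(1) K by (auto simp: d_def)
  have im: "\<phi> ` ball p d \<subseteq> ball q \<theta>"
  proof
    fix z assume "z \<in> \<phi> ` ball p d"
    then obtain y where y: "y \<in> ball p d" "z = \<phi> y" by auto
    have "dist q z \<le> K * dist p y"
      using lipschitz_onD[OF 1(3), of p y] y d 1(1,2) by auto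
    also have "\<dots> \<le> (K + 1) * dist p y" by (simp add: algebra_simps)
    also have "\<dots> < (K + 1) * d" using y K by (intro mult_strict_left_mono) auto
    also have "\<dots> \<le> \<theta>" using d(3) K by (simp add: pos_le_divide_eq mult.commute)
    finally show "z \<in> ball q \<theta>" by simp
  qed
  have "germ_map f p r (\<psi> \<circ> \<phi>) d (L * K)"
    unfolding germ_map_def
  proof (intro conjI ballI)
    show "(L * K)-lipschitz_on (ball p d) (\<psi> \<circ> \<phi>)"
      by (rule lipschitz_on_compose) (use im d in \<open>auto intro: lipschitz_on_subset[OF 1(3)] lipschitz_on_subset[OF 2(3)]\<close>)
    fix y assume "y \<in> ball p d"
    then have "y \<in> ball p \<eta>" "\<phi> y \<in> ball q \<theta>" using im d by (auto simp del: mem_ball) (auto simp: mem_ball)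
    then show "f ((\<psi> \<circ> \<phi>) y) = f y" by (simp add: 1(4) 2(4))
  qed (use d 1 2 in auto)
  then show ?thesis by (auto simp: germ_related_def)
qed

text \<open>The common ground of both cases, with \<open>G\<close> and \<open>H\<close> standing for
  gradient and Hessian of \<open>c\<close>. Invariance of \<open>f\<close> is an assumption here
  because the cases reach it differently, by Clarke derivatives or by the chain rule. The trajectory
  follows \<open>- G\<close>, so running \<open>G\<close> goes back in time, which is the
  contracting direction.\<close>

locale curvature_flow =
  fixes f :: "'a::euclidean_space \<Rightarrow> real" and G :: "'a \<Rightarrow> 'a" and H :: "'a \<Rightarrow> 'a \<Rightarrow> 'a"
    and U :: "'a set" and \<omega> :: real and I :: "real set" and x :: "real \<Rightarrow> 'a"
  assumes U: "open U" and \<omega>: "0 < \<omega>"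
    and H: "\<And>y. y \<in> U \<Longrightarrow> (G has_derivative H y) (at y)"
    and contH: "\<And>a b. a \<in> Basis \<Longrightarrow> b \<in> Basis \<Longrightarrow> continuous_on U (\<lambda>y. H y a \<bullet> b)"
    and curv: "\<And>y v. y \<in> U \<Longrightarrow> v \<in> limiting_gradients f y \<Longrightarrow> H y v \<bullet> v \<le> - \<omega> * (norm v)\<^sup>2"
    and invariant: "\<And>h u. 0 \<le> h \<Longrightarrow> solves_ode G U h u \<Longrightarrow> f (u h) = f (u 0)"
    and I: "is_interval I" and xU: "\<And>t. t \<in> I \<Longrightarrow> x t \<in> U"
    and x': "\<And>t. t \<in> I \<Longrightarrow> (x has_vector_derivative - G (x t)) (at t within I)"
begin

lemma Icc_subset: "a \<in> I \<Longrightarrow> b \<in> I \<Longrightarrow> {a..b} \<subseteq> I"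
  using I by (meson atLeastAtMost_iff is_interval_1 subsetI)

lemma bounded_linear_H: "y \<in> U \<Longrightarrow> bounded_linear (H y)"
  using H has_derivative_bounded_linear by blast

text \<open>From entrywise continuity to continuity of the operator: there are \<open>n\<close>
  matrix entries, and each is allowed a share \<open>e / n\<close>.\<close>

lemma H_continuous:
  assumes y: "y \<in> U" and "0 < e"
  obtains r where "0 < r" "cball y r \<subseteq> U" "\<And>z v. z \<in> cball y r \<Longrightarrow> norm (H z v - H y v) \<le> e * norm v"
proof -
  obtain r0 where r0: "0 < r0" "ball y r0 \<subseteq> U" using U y open_contains_ball by blast
  define n where "n = real (DIM('a) * DIM('a))"
  have n: "0 < n" by (simp add: n_def)
  have "\<forall>\<^sub>F z in at y within U. \<forall>a\<in>Basis. \<forall>b\<in>Basis. dist (H z a \<bullet> b) (H y a \<bullet> b) < e / n"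
  proof (intro eventually_ball_finite ballI finite_Basis)
    fix a b :: 'a assume ab: "a \<in> Basis" "b \<in> Basis"
    have "((\<lambda>z. H z a \<bullet> b) \<longlongrightarrow> H y a \<bullet> b) (at y within U)"
      using contH[OF ab] y unfolding continuous_on_def by blast
    then show "\<forall>\<^sub>F z in at y within U. dist (H z a \<bullet> b) (H y a \<bullet> b) < e / n"
      using \<open>0 < e\<close> n by (intro tendstoD) auto
  qed
  then obtain d where d: "0 < d" "\<And>z a b. z \<in> U \<Longrightarrow> z \<noteq> y \<Longrightarrow> dist z y < d \<Longrightarrow> a \<in> Basis \<Longrightarrow> b \<in> Basis \<Longrightarrow>
       dist (H z a \<bullet> b) (H y a \<bullet> b) < e / n"
    unfolding eventually_at by blast
  define r where "r = min r0 d / 2"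
  have r: "0 < r" "r < r0" "r < d" using r0 d by (auto simp: r_def)
  have rU: "cball y r \<subseteq> U" using r(2) r0(2) by auto
  have "norm (H z v - H y v) \<le> e * norm v" if z: "z \<in> cball y r" for z v
  proof (cases "z = y")
    case True
    then show ?thesis using \<open>0 < e\<close> by simp
  next
    case False
    have zU: "z \<in> U" using z rU by auto
    have lin: "linear (H z)" "linear (H y)" using bounded_linear_H zU y bounded_linear.linear by blast+
    have exp: "H w v = (\<Sum>a\<in>Basis. (v \<bullet> a) *\<^sub>R H w a)" if "linear (H w)" for w
    proof -
      have "H w v = H w (\<Sum>a\<in>Basis. (v \<bullet> a) *\<^sub>R a)" by (simp add: euclidean_representation)
      also have "\<dots> = (\<Sum>a\<in>Basis. (v \<bullet> a) *\<^sub>R H w a)"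
        by (simp only: linear_sum[OF that] linear_scale[OF that])
      finally show ?thesis .
    qed
    have "norm (H z v - H y v) \<le> (\<Sum>b\<in>Basis. \<bar>(H z v - H y v) \<bullet> b\<bar>)" by (rule norm_le_l1)
    also have "\<dots> \<le> (\<Sum>b\<in>(Basis :: 'a set). \<Sum>a\<in>(Basis :: 'a set). e / n * norm v)"
    proof (rule sum_mono)
      fix b :: 'a assume b: "b \<in> Basis"
      have "(H z v - H y v) \<bullet> b = (\<Sum>a\<in>Basis. (v \<bullet> a) * (H z a \<bullet> b - H y a \<bullet> b))"
        unfolding exp[OF lin(1)] exp[OF lin(2)]
        by (simp add: inner_diff_left inner_sum_left sum_subtractf algebra_simps)
      also have "\<bar>\<dots>\<bar> \<le> (\<Sum>a\<in>Basis. \<bar>(v \<bullet> a) * (H z a \<bullet> b - H y a \<bullet> b)\<bar>)" by (rule sum_abs)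
      also have "\<dots> \<le> (\<Sum>a\<in>(Basis :: 'a set). e / n * norm v)"
      proof (rule sum_mono)
        fix a :: 'a assume a: "a \<in> Basis"
        have "\<bar>H z a \<bullet> b - H y a \<bullet> b\<bar> \<le> e / n"
          using d(2)[OF zU False _ a b] z r(3) by (simp add: dist_real_def dist_commute)
        then have "\<bar>v \<bullet> a\<bar> * \<bar>H z a \<bullet> b - H y a \<bullet> b\<bar> \<le> norm v * (e / n)"
          using Basis_le_norm[OF a] by (intro mult_mono) auto
        then show "\<bar>(v \<bullet> a) * (H z a \<bullet> b - H y a \<bullet> b)\<bar> \<le> e / n * norm v"
          by (simp add: abs_mult mult.commute)
      qed
      finally show "\<bar>(H z v - H y v) \<bullet> b\<bar> \<le> (\<Sum>a\<in>(Basis :: 'a set). e / n * norm v)" .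
    qed
    also have "\<dots> = n * (e / n * norm v)" by (simp add: n_def)
    also have "\<dots> = e * norm v" using n by simp
    finally show ?thesis .
  qed
  with r(1) rU that show ?thesis by blast
qed

text \<open>Since the derivative is continuous, \<open>G - H y\<close> has small derivative on a
  small ball, and the mean value inequality then covers all pairs of points, not only those
  containing \<open>y\<close>.\<close>

lemma G_strict:
  assumes y: "y \<in> U" and "0 < e"
  shows "\<exists>r>0. cball y r \<subseteq> U \<and>
      (\<forall>z\<in>cball y r. \<forall>w\<in>cball y r. norm (G z - G w - H y (z - w)) \<le> e * norm (z - w))"
proof -
  obtain r where r: "0 < r" "cball y r \<subseteq> U" "\<And>z v. z \<in> cball y r \<Longrightarrow> norm (H z v - H y v) \<le> e * norm v"
    using H_continuous[OF assms] by metis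
  have lin: "bounded_linear (H y)" using bounded_linear_H[OF y] .
  have "norm (G z - G w - H y (z - w)) \<le> e * norm (z - w)" if zw: "z \<in> cball y r" "w \<in> cball y r" for z w
  proof -
    have "norm ((G z - H y z) - (G w - H y w)) \<le> e * norm (z - w)"
    proof (rule differentiable_bound[OF convex_cball _ _ zw, where f' = "\<lambda>p v. H p v - H y v"])
      fix p assume p: "p \<in> cball y r"
      have "(G has_derivative H p) (at p within cball y r)" using H p r(2) has_derivative_at_withinI by blast
      moreover have "(H y has_derivative H y) (at p within cball y r)"
        using lin by (rule bounded_linear_imp_has_derivative)
      ultimately show "((\<lambda>z. G z - H y z) has_derivative (\<lambda>v. H p v - H y v)) (at p within cball y r)"
        by (rule has_derivative_diff)
      show "onorm (\<lambda>v. H p v - H y v) \<le> e"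
        using \<open>0 < e\<close> r(3)[OF p] by (intro onorm_bound) auto
    qed
    moreover have eq: "H y (z - w) = H y z - H y w" using lin by (simp add: linear_diff bounded_linear.linear)
    ultimately show ?thesis unfolding eq by (simp add: algebra_simps)
  qed
  with r show ?thesis by blast
qed

lemma invariant_reverse:
  assumes "0 \<le> h" "solves_ode (\<lambda>y. - G y) U h u"
  shows "f (u h) = f (u 0)"
  using invariant[OF assms(1), of "\<lambda>t. u (h - t)"] solves_ode_reverse[OF assms(2)] by simp

lemma solves_ode_forward:
  assumes "a \<in> I" "b \<in> I" "a \<le> b" "\<And>t. t \<in> {a..b} \<Longrightarrow> x t \<in> X"
  shows "solves_ode (\<lambda>y. - G y) X (b - a) (\<lambda>t. x (a + t))"
  unfolding solves_ode_def
proof (intro ballI conjI)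
  fix t assume t: "t \<in> {0..b - a}"
  then show "x (a + t) \<in> X" using assms(4) by auto
  have at: "a + t \<in> I" using Icc_subset[OF assms(1,2)] t by auto
  have im: "(\<lambda>t. a + t) ` {0..b - a} \<subseteq> I" using Icc_subset[OF assms(1,2)] by auto
  have "((\<lambda>t. a + t) has_vector_derivative 1) (at t within {0..b - a})"
    by (auto intro!: derivative_eq_intros)
  moreover have "(x has_vector_derivative - G (x (a + t))) (at (a + t) within (\<lambda>t. a + t) ` {0..b - a})"
    using x'[OF at] im by (rule has_vector_derivative_within_subset)
  ultimately have "(x \<circ> (\<lambda>t. a + t) has_vector_derivative 1 *\<^sub>R (- G (x (a + t)))) (at t within {0..b - a})"
    by (rule vector_diff_chain_within)
  then show "((\<lambda>t. x (a + t)) has_vector_derivative - G (x (a + t))) (at t within {0..b - a})"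
    by (simp add: o_def)
qed

text \<open>The point \<open>p\<close> where curvature is tested is independent of \<open>y\<close>
  and \<open>z\<close> so that one definition serves both cases: \<open>p\<close> is the base point
  \<open>x b\<close> for the leading form, and a differentiability point near it for the Lipschitz
  modulus. The bound on the step length keeps the contraction factor at least one half.\<close>

definition contracts :: "real \<Rightarrow> real \<Rightarrow> bool" where
  "contracts a b \<longleftrightarrow> (b - a) * \<omega> \<le> 1 \<and>
     (\<exists>\<phi> \<eta> K. germ_map f (x b) (x a) \<phi> \<eta> K \<and> ball (x b) \<eta> \<subseteq> U \<and>
       (\<forall>y\<in>ball (x b) \<eta>. \<forall>z\<in>ball (x b) \<eta>. \<forall>p\<in>ball (x b) \<eta>.
          H p (y - z) \<bullet> (y - z) \<le> - \<omega> * (norm (y - z))\<^sup>2 \<longrightarrow>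
          norm (\<phi> y - \<phi> z) \<le> (1 - (b - a) * \<omega> / 2) * norm (y - z)))"

lemma germ_map_flow:
  assumes A: "bounded_linear A" and "0 \<le> h" "0 < \<eta>" "\<phi> p = q"
    and "\<And>y. y \<in> ball p \<eta> \<Longrightarrow> f (\<phi> y) = f y"
    and "\<And>y z. y \<in> ball p \<eta> \<Longrightarrow> z \<in> ball p \<eta> \<Longrightarrow> norm (\<phi> y - \<phi> z - (y - z) - h *\<^sub>R A (y - z)) \<le> h * e * norm (y - z)"
    and "0 \<le> e"
  shows "germ_map f p q \<phi> \<eta> (1 + h * onorm A + h * e)"
  unfolding germ_map_def
proof (intro conjI ballI lipschitz_onI)
  show "0 \<le> 1 + h * onorm A + h * e" using onorm_pos_le[OF A] assms by simp
  fix y z assume yz: "y \<in> ball p \<eta>" "z \<in> ball p \<eta>"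
  have "norm (h *\<^sub>R A (y - z)) \<le> h * (onorm A * norm (y - z))"
    using onorm[OF A, of "y - z"] \<open>0 \<le> h\<close> by (simp add: mult_left_mono)
  moreover have "norm (\<phi> y - \<phi> z) \<le> norm (\<phi> y - \<phi> z - (y - z) - h *\<^sub>R A (y - z)) + norm (y - z) + norm (h *\<^sub>R A (y - z))"
    using norm_triangle_ineq[of "\<phi> y - \<phi> z - (y - z) - h *\<^sub>R A (y - z)" "(y - z) + h *\<^sub>R A (y - z)"]
      norm_triangle_ineq[of "y - z" "h *\<^sub>R A (y - z)"] by simp
  ultimately show "dist (\<phi> y) (\<phi> z) \<le> (1 + h * onorm A + h * e) * dist y z"
    using assms(6)[OF yz] by (simp add: dist_norm algebra_simps)
qed (use assms in auto)

text \<open>The budget of one step. Expanding the squared norm and using 1 + 2q \<le> (1 + q)^2 to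
  remove the square, the norm decreases at relative rate \<open>h * \<omega>\<close>. One eighth of
  this is lost to the curvature error \<open>e\<close>, one eighth to the flow error
  \<open>h * e\<close>, one quarter to the term quadratic in \<open>h\<close>; one half
  remains.\<close>

lemma norm_expansion_le:
  assumes curv: "A v \<bullet> v \<le> - (\<omega> - e) * (norm v)\<^sup>2" and B: "norm (A v) \<le> B * norm v"
    and e: "e \<le> \<omega> / 8" and "0 < e" "0 \<le> h" "h * \<omega> \<le> 1" "h * B\<^sup>2 \<le> \<omega> / 2" "0 \<le> B"
  shows "norm (v + h *\<^sub>R A v) + h * e * norm v \<le> (1 - h * \<omega> / 2) * norm v"
proof -
  define q where "q = h\<^sup>2 * B\<^sup>2 / 2 - h * (\<omega> - e)"
  have "h * (h * B\<^sup>2) \<le> h * (\<omega> / 2)" using assms by (intro mult_left_mono) auto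
  then have hB: "h\<^sup>2 * B\<^sup>2 \<le> h * \<omega> / 2" by (simp add: power2_eq_square mult_ac)
  have he: "h * e \<le> h * \<omega> / 8" using mult_left_mono[OF e \<open>0 \<le> h\<close>] by simp
  have "h * (\<omega> - e) \<le> 1" using assms by (simp add: algebra_simps) (smt (verit) mult_nonneg_nonneg)
  then have q: "0 \<le> 1 + q" "1 + q + h * e \<le> 1 - h * \<omega> / 2"
  proof -
    have "0 \<le> h\<^sup>2 * B\<^sup>2" by simp
    with \<open>h * (\<omega> - e) \<le> 1\<close> show "0 \<le> 1 + q" unfolding q_def by linarith
    have "h * (\<omega> - e) = h * \<omega> - h * e" by (rule right_diff_distrib)
    with hB he show "1 + q + h * e \<le> 1 - h * \<omega> / 2" unfolding q_def by linarith
  qed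
  have "(norm (v + h *\<^sub>R A v))\<^sup>2 = (norm v)\<^sup>2 + 2 * h * (A v \<bullet> v) + h\<^sup>2 * (norm (A v))\<^sup>2"
    unfolding power2_norm_eq_inner by (simp add: algebra_simps inner_commute power2_eq_square)
  also have "\<dots> \<le> (norm v)\<^sup>2 + 2 * h * (- (\<omega> - e) * (norm v)\<^sup>2) + h\<^sup>2 * (B * norm v)\<^sup>2"
    using curv B \<open>0 \<le> h\<close> by (intro add_mono mult_left_mono power_mono) auto
  also have "\<dots> = (1 + 2 * q) * (norm v)\<^sup>2" by (simp add: q_def algebra_simps power_mult_distrib)
  also have "\<dots> \<le> (1 + q)\<^sup>2 * (norm v)\<^sup>2"
    by (intro mult_right_mono) (simp_all add: power2_eq_square algebra_simps)
  also have "\<dots> = ((1 + q) * norm v)\<^sup>2" by (simp add: power_mult_distrib)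
  finally have "norm (v + h *\<^sub>R A v) \<le> (1 + q) * norm v"
    by (rule power2_le_imp_le) (use q(1) in simp)
  moreover have "(1 + q + h * e) * norm v \<le> (1 - h * \<omega> / 2) * norm v"
    using q(2) by (rule mult_right_mono) simp
  ultimately show ?thesis by (simp add: algebra_simps)
qed

text \<open>The form required by bisection: around every time, all sufficiently short intervals
  containing it are good. The backward flow gives the contracting map, the forward flow the germ
  relation in the other direction.\<close>

lemma local_step:
  assumes t0: "t0 \<in> I"
  shows "\<exists>\<delta>>0. \<forall>a b. a \<in> I \<longrightarrow> b \<in> I \<longrightarrow> a \<le> t0 \<longrightarrow> t0 \<le> b \<longrightarrow> b - a < \<delta> \<longrightarrow>
           contracts a b \<and> germ_related f (x a) (x b)"
proof -
  define x0 where "x0 = x t0"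
  define A where "A = H x0"
  define e where "e = \<omega> / 8"
  define B where "B = onorm A"
  have x0U: "x0 \<in> U" using xU t0 by (simp add: x0_def)
  have A: "bounded_linear A" using bounded_linear_H[OF x0U] by (simp add: A_def)
  have A': "bounded_linear (\<lambda>v. - A v)" using A by (rule bounded_linear_minus)
  have B: "0 \<le> B" "norm (A v) \<le> B * norm v" for v
    unfolding B_def using A onorm_pos_le onorm by blast+
  have e: "0 < e" using \<omega> by (simp add: e_def)
  obtain \<rho>1 \<delta>1 where flow1: "0 < \<rho>1" "0 < \<delta>1"
    "\<And>h u. 0 \<le> h \<Longrightarrow> h < \<delta>1 \<Longrightarrow> solves_ode G (ball x0 \<rho>1) h u \<Longrightarrow>
       \<exists>\<phi> \<eta>. 0 < \<eta> \<and> \<phi> (u 0) = u h \<and>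
         (\<forall>y\<in>ball (u 0) \<eta>. \<exists>v. v 0 = y \<and> v h = \<phi> y \<and> solves_ode G U h v) \<and>
         (\<forall>y\<in>ball (u 0) \<eta>. \<forall>z\<in>ball (u 0) \<eta>.
            norm (\<phi> y - \<phi> z - (y - z) - h *\<^sub>R A (y - z)) \<le> h * e * norm (y - z))"
    using local_flow[OF A e G_strict[OF x0U, folded A_def]] by blast
  have strict': "\<exists>r>0. cball x0 r \<subseteq> U \<and> (\<forall>y\<in>cball x0 r. \<forall>z\<in>cball x0 r.
        norm (- G y - - G z - (- A (y - z))) \<le> \<eta> * norm (y - z))" if "0 < \<eta>" for \<eta>
  proof -
    have "norm (- G y - - G z - (- A (y - z))) = norm (G y - G z - A (y - z))" for y z
      using norm_minus_cancel[of "G y - G z - A (y - z)"] by (simp add: algebra_simps)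
    then show ?thesis using G_strict[OF x0U that] by (simp add: A_def)
  qed
  obtain \<rho>2 \<delta>2 where flow2: "0 < \<rho>2" "0 < \<delta>2"
    "\<And>h u. 0 \<le> h \<Longrightarrow> h < \<delta>2 \<Longrightarrow> solves_ode (\<lambda>y. - G y) (ball x0 \<rho>2) h u \<Longrightarrow>
       \<exists>\<phi> \<eta>. 0 < \<eta> \<and> \<phi> (u 0) = u h \<and>
         (\<forall>y\<in>ball (u 0) \<eta>. \<exists>v. v 0 = y \<and> v h = \<phi> y \<and> solves_ode (\<lambda>y. - G y) U h v) \<and>
         (\<forall>y\<in>ball (u 0) \<eta>. \<forall>z\<in>ball (u 0) \<eta>.
            norm (\<phi> y - \<phi> z - (y - z) - h *\<^sub>R (- A (y - z))) \<le> h * e * norm (y - z))"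
    using local_flow[OF A' e strict'] by blast
  obtain r where r: "0 < r" "cball x0 r \<subseteq> U" "\<And>z v. z \<in> cball x0 r \<Longrightarrow> norm (H z v - H x0 v) \<le> e * norm v"
    using H_continuous[OF x0U e] by metis
  define \<rho> where "\<rho> = min r (min \<rho>1 \<rho>2)"
  have \<rho>: "0 < \<rho>" "\<rho> \<le> r" "\<rho> \<le> \<rho>1" "\<rho> \<le> \<rho>2" using r flow1 flow2 by (auto simp: \<rho>_def)
  have "continuous (at t0 within I) x" using x'[OF t0] by (rule has_vector_derivative_continuous)
  then obtain d where d: "0 < d" "\<And>t. t \<in> I \<Longrightarrow> dist t t0 < d \<Longrightarrow> dist (x t) x0 < \<rho>"
    unfolding continuous_within_eps_delta x0_def using \<rho>(1) by blast
  \<comment> \<open>The last two bounds give \<open>h * \<omega> \<le> 1\<close> and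
    \<open>h * B\<^sup>2 \<le> \<omega> / 2\<close>, the smallness conditions of
    \<open>norm_expansion_le\<close>.\<close>
  define \<delta> where "\<delta> = min (min d (min \<delta>1 \<delta>2)) (min (1 / \<omega>) (\<omega> / (2 * (B\<^sup>2 + 1))))"
  have B1: "0 < B\<^sup>2 + 1" by (simp add: add_nonneg_pos)
  have \<delta>: "0 < \<delta>" using d flow1 flow2 \<omega> B1 by (simp add: \<delta>_def)
  have "contracts a b \<and> germ_related f (x a) (x b)"
    if ab: "a \<in> I" "b \<in> I" "a \<le> t0" "t0 \<le> b" "b - a < \<delta>" for a b
  proof -
    define h where "h = b - a"
    have h0: "0 \<le> h" using ab by (simp add: h_def)
    have h: "h < d" "h < \<delta>1" "h < \<delta>2" "h \<le> 1 / \<omega>" "h \<le> \<omega> / (2 * (B\<^sup>2 + 1))"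
      using ab(5) by (auto simp: \<delta>_def h_def)
    have h\<omega>: "h * \<omega> \<le> 1" using h(4) \<omega> by (simp add: pos_le_divide_eq)
    have "h * (2 * (B\<^sup>2 + 1)) \<le> \<omega>" using h(5) B1 by (simp add: pos_le_divide_eq)
    then have hB: "h * B\<^sup>2 \<le> \<omega> / 2" using h0 by (simp add: algebra_simps)
    have near: "x t \<in> ball x0 \<rho>" if "t \<in> {a..b}" for t
      using d(2)[of t] Icc_subset[OF ab(1,2)] that ab h(1) by (auto simp: dist_commute dist_real_def h_def)
    have fw: "solves_ode (\<lambda>y. - G y) (ball x0 \<rho>) h (\<lambda>t. x (a + t))"
      unfolding h_def using ab near by (intro solves_ode_forward) auto
    have bw: "solves_ode G (ball x0 \<rho>) h (\<lambda>t. x (b - t))"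
      using solves_ode_reverse[OF fw] by (simp add: h_def)
    have bw1: "solves_ode G (ball x0 \<rho>1) h (\<lambda>t. x (b - t))"
      by (rule solves_ode_mono[OF bw]) (use \<rho> in auto)
    have fw2: "solves_ode (\<lambda>y. - G y) (ball x0 \<rho>2) h (\<lambda>t. x (a + t))"
      by (rule solves_ode_mono[OF fw]) (use \<rho> in auto)
    obtain \<phi> \<eta>1 where \<phi>: "0 < \<eta>1" "\<phi> (x b) = x a"
      "\<And>y. y\<in>ball (x b) \<eta>1 \<Longrightarrow> \<exists>v. v 0 = y \<and> v h = \<phi> y \<and> solves_ode G U h v"
      "\<And>y z. y\<in>ball (x b) \<eta>1 \<Longrightarrow> z\<in>ball (x b) \<eta>1 \<Longrightarrow>
            norm (\<phi> y - \<phi> z - (y - z) - h *\<^sub>R A (y - z)) \<le> h * e * norm (y - z)"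
      using flow1(3)[OF h0 h(2) bw1] by (auto simp: h_def)
    obtain \<psi> \<eta>2 where \<psi>: "0 < \<eta>2" "\<psi> (x a) = x b"
      "\<And>y. y\<in>ball (x a) \<eta>2 \<Longrightarrow> \<exists>v. v 0 = y \<and> v h = \<psi> y \<and> solves_ode (\<lambda>y. - G y) U h v"
      "\<And>y z. y\<in>ball (x a) \<eta>2 \<Longrightarrow> z\<in>ball (x a) \<eta>2 \<Longrightarrow>
            norm (\<psi> y - \<psi> z - (y - z) - h *\<^sub>R (- A (y - z))) \<le> h * e * norm (y - z)"
      using flow2(3)[OF h0 h(3) fw2] by (auto simp: h_def)
    have "germ_map f (x a) (x b) \<psi> \<eta>2 (1 + h * onorm (\<lambda>v. - A v) + h * e)"
    proof (rule germ_map_flow[where p = "x a" and \<phi> = \<psi> and A = "\<lambda>v. - A v", OF A' h0 \<psi>(1,2) _ \<psi>(4)])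
      fix y assume "y \<in> ball (x a) \<eta>2"
      then show "f (\<psi> y) = f y" using \<psi>(3) invariant_reverse[OF h0] by metis
    qed (use e in auto)
    then have rel: "germ_related f (x a) (x b)" by (auto simp: germ_related_def)
    have xb: "x b \<in> ball x0 \<rho>" using near ab by simp
    define \<eta> where "\<eta> = min \<eta>1 (\<rho> - dist x0 (x b))"
    have \<eta>: "0 < \<eta>" "\<eta> \<le> \<eta>1" using \<phi>(1) xb by (auto simp: \<eta>_def)
    have sub: "ball (x b) \<eta> \<subseteq> cball x0 r"
    proof
      fix y assume "y \<in> ball (x b) \<eta>"
      then show "y \<in> cball x0 r" using dist_triangle[of x0 y "x b"] \<rho>(2) by (simp add: \<eta>_def)
    qed
    have "germ_map f (x b) (x a) \<phi> \<eta> (1 + h * onorm A + h * e)"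
    proof (rule germ_map_flow[where p = "x b" and \<phi> = \<phi>, OF A h0 \<eta>(1) \<phi>(2)])
      fix y assume "y \<in> ball (x b) \<eta>"
      then have "y \<in> ball (x b) \<eta>1" using \<eta> by auto
      then show "f (\<phi> y) = f y" using \<phi>(3) invariant[OF h0] by metis
    next
      fix y z assume "y \<in> ball (x b) \<eta>" "z \<in> ball (x b) \<eta>"
      then show "norm (\<phi> y - \<phi> z - (y - z) - h *\<^sub>R A (y - z)) \<le> h * e * norm (y - z)"
        using \<eta>(2) by (intro \<phi>(4)) auto
    qed (use e in auto)
    moreover have "norm (\<phi> y - \<phi> z) \<le> (1 - h * \<omega> / 2) * norm (y - z)"
      if yz: "y \<in> ball (x b) \<eta>" "z \<in> ball (x b) \<eta>" and p: "p \<in> ball (x b) \<eta>"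
        and neg: "H p (y - z) \<bullet> (y - z) \<le> - \<omega> * (norm (y - z))\<^sup>2" for y z p
    proof -
      define v where "v = y - z"
      \<comment> \<open>Curvature is given at \<open>p\<close>, while the flow expansion uses the
        derivative \<open>A\<close> at \<open>x0\<close>; exchanging them costs \<open>e\<close>,
        whence \<open>\<omega> - e\<close> below.\<close>
      have "norm (A v - H p v) \<le> e * norm v" using r(3)[OF subsetD[OF sub p], of v] by (simp add: A_def norm_minus_commute)
      then have "norm (A v - H p v) * norm v \<le> e * norm v * norm v" by (rule mult_right_mono) simp
      then have "(A v - H p v) \<bullet> v \<le> e * (norm v)\<^sup>2"
        using norm_cauchy_schwarz[of "A v - H p v" v] by (simp add: power2_eq_square mult_ac)
      then have "A v \<bullet> v \<le> - (\<omega> - e) * (norm v)\<^sup>2"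
        using neg by (simp add: v_def inner_diff_left algebra_simps)
      from norm_expansion_le[where A = A and v = v and B = B, OF this B(2) _ e h0 h\<omega> hB B(1)]
      have "norm (v + h *\<^sub>R A v) + h * e * norm v \<le> (1 - h * \<omega> / 2) * norm v" by (simp add: e_def)
      moreover have "norm (\<phi> y - \<phi> z) \<le> norm (v + h *\<^sub>R A v) + norm (\<phi> y - \<phi> z - v - h *\<^sub>R A v)"
        using norm_triangle_ineq[of "v + h *\<^sub>R A v" "\<phi> y - \<phi> z - v - h *\<^sub>R A v"] by simp
      moreover have "norm (\<phi> y - \<phi> z - v - h *\<^sub>R A v) \<le> h * e * norm v"
        unfolding v_def using yz \<eta>(2) by (intro \<phi>(4)) auto
      ultimately show ?thesis by (simp add: v_def)
    qed
    moreover have "ball (x b) \<eta> \<subseteq> U" using sub r(2) by blast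
    ultimately have "contracts a b"
      unfolding contracts_def h_def[symmetric] using h\<omega> by blast
    with rel show ?thesis by blast
  qed
  with \<delta> show ?thesis by blast
qed

lemma contracts_imp_germ_related: "contracts a b \<Longrightarrow> germ_related f (x b) (x a)"
  by (auto simp: contracts_def germ_related_def)

text \<open>Germ relations compose and hold across every sufficiently short interval, so bisection
  extends them to all of \<open>I\<close>. Both directions are carried along because information
  given at one time must reach earlier and later ones.\<close>

lemma trajectory_germ_related:
  assumes "a \<in> I" "b \<in> I"
  shows "germ_related f (x a) (x b)"
proof -
  have "germ_related f (x a) (x b) \<and> germ_related f (x b) (x a)"
    if "a \<le> b" "a \<in> I" "b \<in> I" for a b
  proof -
    have "a \<in> I \<longrightarrow> b \<in> I \<longrightarrow> germ_related f (x a) (x b) \<and> germ_related f (x b) (x a)"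
      using \<open>a \<le> b\<close>
    proof (induction rule: Bolzano)
      case (trans a b c)
      then show ?case using Icc_subset[of a c] germ_related_trans by (meson atLeastAtMost_iff subsetD)
    next
      case (local y)
      then have "y \<in> I" using Icc_subset that by (meson atLeastAtMost_iff subsetD)
      from local_step[OF this] show ?case using contracts_imp_germ_related by blast
    qed
    with that show ?thesis by blast
  qed
  then show ?thesis using assms by (metis linear)
qed

text \<open>A short step contributes \<open>(1 - z) ^ k\<close> with
  \<open>z = (b - a) * \<omega> / 2\<close>, at most the exponential of \<open>- k * z\<close>;
  exponentials multiply exactly over adjoining intervals, so nothing is lost in gluing.
  \<open>l\<close> will be the Lipschitz modulus, with \<open>k = 1\<close>, or the norm of the
  \<open>k\<close>-th derivative.\<close>

lemma decay:
  fixes l :: "real \<Rightarrow> real"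
  assumes step: "\<And>a b. a \<in> I \<Longrightarrow> b \<in> I \<Longrightarrow> a \<le> b \<Longrightarrow> contracts a b \<Longrightarrow> l b \<le> (1 - (b - a) * \<omega> / 2) ^ k * l a"
    and l: "\<And>t. t \<in> I \<Longrightarrow> 0 \<le> l t"
    and st: "s \<in> I" "t \<in> I" "s \<le> t"
  shows "l t \<le> exp (- real k * \<omega> * (t - s) / 2) * l s"
proof -
  have "s \<in> I \<longrightarrow> t \<in> I \<longrightarrow> l t \<le> exp (- real k * \<omega> * (t - s) / 2) * l s"
    using \<open>s \<le> t\<close>
  proof (induction rule: Bolzano)
    case (trans a b c)
    show ?case
    proof (intro impI)
      assume ac: "a \<in> I" "c \<in> I"
      then have b: "b \<in> I" using Icc_subset trans(3,4) by (meson atLeastAtMost_iff subsetD)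
      have "l c \<le> exp (- real k * \<omega> * (c - b) / 2) * l b" using trans(2) ac b by blast
      also have "\<dots> \<le> exp (- real k * \<omega> * (c - b) / 2) * (exp (- real k * \<omega> * (b - a) / 2) * l a)"
        using trans(1) ac b by (intro mult_left_mono) auto
      also have "\<dots> = exp (- real k * \<omega> * (c - a) / 2) * l a"
      proof -
        have "- real k * \<omega> * (c - a) / 2 = - real k * \<omega> * (c - b) / 2 + - real k * \<omega> * (b - a) / 2"
          by (simp add: field_simps)
        then show ?thesis by (simp only: exp_add mult.assoc)
      qed
      finally show "l c \<le> exp (- real k * \<omega> * (c - a) / 2) * l a" .
    qed
  next
    case (local y)
    then have yI: "y \<in> I" using Icc_subset st by (meson atLeastAtMost_iff subsetD)
    obtain \<delta> where \<delta>: "0 < \<delta>" "\<And>a b. a \<in> I \<Longrightarrow> b \<in> I \<Longrightarrow> a \<le> y \<Longrightarrow> y \<le> b \<Longrightarrow> b - a < \<delta> \<Longrightarrow> contracts a b"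
      using local_step[OF yI] by blast
    have "l b \<le> exp (- real k * \<omega> * (b - a) / 2) * l a"
      if ab: "a \<in> I" "b \<in> I" "a \<le> y" "y \<le> b" "b - a < \<delta>" for a b
    proof -
      have con: "contracts a b" using \<delta>(2) ab by blast
      then have "(b - a) * \<omega> \<le> 1" by (simp add: contracts_def)
      then have "(1 - (b - a) * \<omega> / 2) ^ k \<le> exp (- ((b - a) * \<omega> / 2)) ^ k"
        using exp_ge_add_one_self[of "- ((b - a) * \<omega> / 2)"] by (intro power_mono) auto
      also have "\<dots> = exp (- real k * \<omega> * (b - a) / 2)"
        by (simp add: exp_of_nat_mult[symmetric] mult_ac)
      finally have "(1 - (b - a) * \<omega> / 2) ^ k * l a \<le> exp (- real k * \<omega> * (b - a) / 2) * l a"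
        using l ab by (intro mult_right_mono) auto
      with step[OF ab(1,2) _ con] ab show ?thesis by simp
    qed
    with \<delta>(1) show ?case by blast
  qed
  with st show ?thesis by blast
qed

end

section \<open>Taylor's theorem with Peano remainder\<close>

definition multilinear_form :: "nat \<Rightarrow> ('a::real_vector list \<Rightarrow> real) \<Rightarrow> bool" where
  "multilinear_form k M \<longleftrightarrow>
     (\<forall>as bs. Suc (length as + length bs) = k \<longrightarrow> linear (\<lambda>v. M (as @ v # bs)))"

lemma multilinear_formD:
  "multilinear_form k M \<Longrightarrow> Suc (length as + length bs) = k \<Longrightarrow> linear (\<lambda>v. M (as @ v # bs))"
  unfolding multilinear_form_def by blast

lemma multilinear_form_hd: "multilinear_form (Suc k) M \<Longrightarrow> length ws = k \<Longrightarrow> linear (\<lambda>v. M (v # ws))"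
  using multilinear_formD[of "Suc k" M "[]" ws] by simp

lemma multilinear_form_Cons:
  assumes "multilinear_form (Suc k) M"
  shows "multilinear_form k (\<lambda>ws. M (v # ws))"
  unfolding multilinear_form_def
proof (intro allI impI)
  fix as bs :: "'a list" assume "Suc (length as + length bs) = k"
  then show "linear (\<lambda>u. M (v # as @ u # bs))"
    using multilinear_formD[OF assms, of "v # as" bs] by simp
qed

lemma multilinear_form_diff:
  assumes "multilinear_form k M" "multilinear_form k N"
  shows "multilinear_form k (\<lambda>vs. M vs - N vs)"
  unfolding multilinear_form_def
  using multilinear_formD[OF assms(1)] multilinear_formD[OF assms(2)] by (intro allI impI linear_compose_sub)

lemma multilinear_form_basis_expansion:
  fixes M :: "'a::euclidean_space list \<Rightarrow> real"
  assumes "multilinear_form (Suc k) M" "length ws = k"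
  shows "M (v # ws) = (\<Sum>b\<in>Basis. (v \<bullet> b) * M (b # ws))"
proof -
  note lin = multilinear_form_hd[OF assms]
  have "M (v # ws) = M ((\<Sum>b\<in>Basis. (v \<bullet> b) *\<^sub>R b) # ws)" by (simp add: euclidean_representation)
  also have "\<dots> = (\<Sum>b\<in>Basis. (v \<bullet> b) * M (b # ws))"
    by (simp only: linear_sum[OF lin] linear_scale[OF lin] real_scaleR_def)
  finally show ?thesis .
qed

text \<open>Expanding one argument in the basis costs a factor \<open>DIM('a)\<close>, as every
  coordinate is at most the norm. A bound on finitely many basis lists thus becomes uniform in the
  direction.\<close>

lemma multilinear_form_bound:
  fixes M :: "'a::euclidean_space list \<Rightarrow> real"
  assumes "multilinear_form k M" "0 \<le> C"
    and "\<And>bs. length bs = k \<Longrightarrow> set bs \<subseteq> Basis \<Longrightarrow> \<bar>M bs\<bar> \<le> C" and "length vs = k"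
  shows "\<bar>M vs\<bar> \<le> C * real DIM('a) ^ k * prod_list (map norm vs)"
  using assms
proof (induction k arbitrary: M vs)
  case 0
  then show ?case by simp
next
  case (Suc k)
  then obtain v ws where vs: "vs = v # ws" "length ws = k" by (auto simp: length_Suc_conv)
  define c where "c = C * real DIM('a) ^ k * prod_list (map norm ws)"
  have c: "0 \<le> c" unfolding c_def using Suc.prems(2) by (auto intro!: mult_nonneg_nonneg prod_list_nonneg)
  have "\<bar>M (b # ws)\<bar> \<le> c" if "b \<in> Basis" for b
    unfolding c_def
  proof (rule Suc.IH[of "\<lambda>ws. M (b # ws)"])
    show "multilinear_form k (\<lambda>ws. M (b # ws))" by (rule multilinear_form_Cons[OF Suc.prems(1)])
  qed (use Suc.prems vs that in auto)
  then have "\<bar>(v \<bullet> b) * M (b # ws)\<bar> \<le> norm v * c" if "b \<in> Basis" for b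
    unfolding abs_mult using that Basis_le_norm[OF that, of v] by (intro mult_mono) auto
  then have "(\<Sum>b\<in>Basis. \<bar>(v \<bullet> b) * M (b # ws)\<bar>) \<le> (\<Sum>b\<in>(Basis :: 'a set). norm v * c)"
    by (rule sum_mono)
  moreover have "\<bar>M vs\<bar> \<le> (\<Sum>b\<in>Basis. \<bar>(v \<bullet> b) * M (b # ws)\<bar>)"
    unfolding vs(1) by (subst multilinear_form_basis_expansion[OF Suc.prems(1) vs(2)]) (rule sum_abs)
  ultimately have "\<bar>M vs\<bar> \<le> real DIM('a) * (norm v * c)" by simp
  then show ?case by (simp add: vs c_def mult_ac)
qed

text \<open>Stated for a list of argument functions because the basis expansion of the first
  argument leaves the diagonal; the induction needs arbitrary entries.\<close>

lemma multilinear_form_continuous_on: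
  fixes M :: "'a::euclidean_space list \<Rightarrow> real"
  assumes "multilinear_form k M" "length gs = k" "\<And>g. g \<in> set gs \<Longrightarrow> continuous_on S g"
  shows "continuous_on S (\<lambda>v. M (map (\<lambda>g. g v) gs))"
  using assms
proof (induction k arbitrary: M gs)
  case 0
  then show ?case by simp
next
  case (Suc k)
  then obtain g hs where gs: "gs = g # hs" "length hs = k" by (auto simp: length_Suc_conv)
  have "M (map (\<lambda>g. g v) gs) = (\<Sum>b\<in>Basis. (g v \<bullet> b) * M (b # map (\<lambda>g. g v) hs))" for v
    using multilinear_form_basis_expansion[OF Suc.prems(1)] gs by simp
  moreover have "continuous_on S (\<lambda>v. M (b # map (\<lambda>g. g v) hs))" for b
  proof (rule Suc.IH[of "\<lambda>ws. M (b # ws)"])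
    show "multilinear_form k (\<lambda>ws. M (b # ws))" by (rule multilinear_form_Cons[OF Suc.prems(1)])
  qed (use Suc.prems gs in auto)
  moreover have "continuous_on S g" using Suc.prems gs by simp
  ultimately show ?case by (simp add: continuous_intros)
qed

lemma multilinear_form_diagonal_continuous_on:
  fixes M :: "'a::euclidean_space list \<Rightarrow> real"
  assumes "multilinear_form k M"
  shows "continuous_on S (\<lambda>v. M (replicate k v))"
  using multilinear_form_continuous_on[OF assms, of "replicate k (\<lambda>v. v)" S] by simp

lemma multilinear_form_scale:
  assumes "multilinear_form k M" "length vs = k"
  shows "M (map ((*\<^sub>R) c) vs) = c ^ k * M vs"
  using assms
proof (induction k arbitrary: M vs)
  case 0
  then show ?case by simp
next
  case (Suc k)
  then obtain v ws where vs: "vs = v # ws" "length ws = k" by (auto simp: length_Suc_conv)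
  have "M (map ((*\<^sub>R) c) vs) = c * M (v # map ((*\<^sub>R) c) ws)"
    using linear_scale[OF multilinear_form_hd[OF Suc.prems(1), of "map ((*\<^sub>R) c) ws"]] vs by simp
  also have "M (v # map ((*\<^sub>R) c) ws) = c ^ k * M (v # ws)"
    by (rule Suc.IH[of "\<lambda>ws. M (v # ws)"]) (use multilinear_form_Cons[OF Suc.prems(1)] vs in auto)
  finally show ?case by (simp add: vs)
qed

lemma multilinear_form_diagonal_scale:
  assumes "multilinear_form k M"
  shows "M (replicate k (c *\<^sub>R v)) = c ^ k * M (replicate k v)"
  using multilinear_form_scale[OF assms, of "replicate k v" c] by simp

section \<open>Iterated derivatives as multilinear forms, and Taylor's formula\<close>

lemma D_at_le: "D_at k f x \<Longrightarrow> j \<le> k \<Longrightarrow> D_at j f x"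
proof (induction k)
  case (Suc k)
  then have "D_at k f x" by (auto dest: eventually_nhds_x_imp_x)
  with Suc show ?case by (cases "j = Suc k") auto
qed simp

lemma nth_derivative_has_derivative:
  assumes "D_at k f y" "j < k" "length vs = j"
  shows "((\<lambda>y. nth_derivative j f y vs) has_derivative (\<lambda>v. nth_derivative (Suc j) f y (v # vs))) (at y)"
proof -
  have "D_at (Suc j) f y" using assms D_at_le Suc_leI by blast
  then have "(\<lambda>y. nth_derivative j f y vs) differentiable (at y)" using assms(3) by simp
  then show ?thesis by (simp add: frechet_derivative_works)
qed

text \<open>The head position is linear as the argument of a derivative. At a later position,
  linearity one order lower is an identity in the base point; differentiating it and using
  uniqueness of the derivative raises it by one order.\<close>

lemma multilinear_nth_derivative:
  fixes f :: "'a::euclidean_space \<Rightarrow> real"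
  assumes D: "\<And>y. D_at k f y" and "j \<le> k"
  shows "multilinear_form j (nth_derivative j f y)"
  using \<open>j \<le> k\<close>
proof (induction j arbitrary: y)
  case 0
  then show ?case by (simp add: multilinear_form_def)
next
  case (Suc j)
  then have jk: "j < k" by simp
  show ?case unfolding multilinear_form_def
  proof (intro allI impI)
    fix as bs :: "'a list" assume len: "Suc (length as + length bs) = Suc j"
    show "linear (\<lambda>v. nth_derivative (Suc j) f y (as @ v # bs))"
    proof (cases as)
      case Nil
      then show ?thesis
        using has_derivative_linear[OF nth_derivative_has_derivative[OF D jk, of bs y]] len by simp
    next
      case (Cons a cs)
      have lin: "linear (\<lambda>v. nth_derivative j f z (cs @ v # bs))" for z
        using Suc.IH[of z] jk len Cons by (simp add: multilinear_form_def)
      have der: "((\<lambda>z. nth_derivative j f z (cs @ v # bs)) has_derivative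
          (\<lambda>w. nth_derivative (Suc j) f y (w # cs @ v # bs))) (at y)" for v
        using len Cons by (intro nth_derivative_has_derivative[OF D jk]) simp
      show ?thesis unfolding Cons append_Cons
      proof (rule linearI)
        fix v w
        have "((\<lambda>z. nth_derivative j f z (cs @ (v + w) # bs)) has_derivative
           (\<lambda>u. nth_derivative (Suc j) f y (u # cs @ v # bs) + nth_derivative (Suc j) f y (u # cs @ w # bs))) (at y)"
          unfolding linear_add[OF lin] by (rule has_derivative_add[OF der der])
        from has_derivative_unique[OF der this]
        show "nth_derivative (Suc j) f y (a # cs @ (v + w) # bs) =
            nth_derivative (Suc j) f y (a # cs @ v # bs) + nth_derivative (Suc j) f y (a # cs @ w # bs)" by metis
      next
        fix c v
        have "((\<lambda>z. nth_derivative j f z (cs @ (c *\<^sub>R v) # bs)) has_derivative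
           (\<lambda>u. c *\<^sub>R nth_derivative (Suc j) f y (u # cs @ v # bs))) (at y)"
          unfolding linear_scale[OF lin] by (rule has_derivative_scaleR_right[OF der])
        from has_derivative_unique[OF der this]
        show "nth_derivative (Suc j) f y (a # cs @ (c *\<^sub>R v) # bs) =
            c *\<^sub>R nth_derivative (Suc j) f y (a # cs @ v # bs)" by metis
      qed
    qed
  qed
qed

text \<open>The Peano form: the top derivative is only approximated by an affine function with slope
  \<open>a (Suc k)\<close>. The mean value inequality lifts this bound through the lower
  derivatives, and on an interval of length 1 the constant \<open>C\<close> survives each
  step.\<close>

lemma taylor_remainder_unit_interval:
  fixes g :: "nat \<Rightarrow> real \<Rightarrow> real" and a :: "nat \<Rightarrow> real"
  assumes "\<And>i s. i < k \<Longrightarrow> s \<in> {0..1} \<Longrightarrow> (g i has_real_derivative g (Suc i) s) (at s within {0..1})"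
    and "\<And>i. i \<le> k \<Longrightarrow> g i 0 = a i"
    and "\<And>s. s \<in> {0..1} \<Longrightarrow> \<bar>g k s - (a k + a (Suc k) * s)\<bar> \<le> C"
    and "s \<in> {0..1}"
  shows "\<bar>g 0 s - (\<Sum>l\<le>Suc k. a l * s ^ l / fact l)\<bar> \<le> C"
  using assms
proof (induction k arbitrary: g a s)
  case 0
  then show ?case by simp
next
  case (Suc k)
  define p where "p s = (\<Sum>l\<le>Suc k. a (Suc l) * s ^ l / fact l)" for s
  have IH: "\<bar>g 1 s - p s\<bar> \<le> C" if "s \<in> {0..1}" for s
    using Suc.IH[of "\<lambda>i. g (Suc i)" "\<lambda>i. a (Suc i)" s] Suc.prems that by (simp add: p_def)
  define q where "q s = (\<Sum>l\<le>Suc (Suc k). a l * s ^ l / fact l)" for s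
  have q: "q = (\<lambda>s. a 0 + (\<Sum>l\<le>Suc k. a (Suc l) * s ^ Suc l / fact (Suc l)))"
    unfolding q_def by (rule ext, subst sum.atMost_Suc_shift) simp
  have qd: "(q has_real_derivative p s) (at s within {0..1})" for s
  proof -
    have "((\<lambda>s. a (Suc l) * s ^ Suc l / fact (Suc l)) has_real_derivative a (Suc l) * s ^ l / fact l) (at s within {0..1})" for l
    proof -
      have "((\<lambda>s. a (Suc l) * s ^ Suc l / fact (Suc l)) has_real_derivative
          a (Suc l) * (real (Suc l) * s ^ l) / fact (Suc l)) (at s within {0..1})"
        by (auto intro!: derivative_eq_intros simp del: fact_Suc power_Suc)
      then show ?thesis by (simp add: field_simps del: power_Suc of_nat_Suc)
    qed
    then have "((\<lambda>s. a 0 + (\<Sum>l\<le>Suc k. a (Suc l) * s ^ Suc l / fact (Suc l))) has_real_derivative 0 + p s) (at s within {0..1})"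
      unfolding p_def by (intro DERIV_add DERIV_const DERIV_sum)
    then show ?thesis by (simp add: q)
  qed
  have "norm ((g 0 s - q s) - (g 0 0 - q 0)) \<le> C * norm (s - 0)"
  proof (rule field_differentiable_bound[of "{0..1}" "\<lambda>s. g 0 s - q s" "\<lambda>s. g 1 s - p s"])
    fix u :: real assume u: "u \<in> {0..1}"
    then have "(g 0 has_real_derivative g 1 u) (at u within {0..1})" using Suc.prems(1)[of 0 u] by simp
    then show "((\<lambda>s. g 0 s - q s) has_field_derivative g 1 u - p u) (at u within {0..1})"
      by (rule DERIV_diff[OF _ qd])
    show "norm (g 1 u - p u) \<le> C" using IH[OF u] by simp
  qed (use Suc.prems in auto)
  moreover have "g 0 0 - q 0 = 0" using Suc.prems(2)[of 0] by (simp add: q)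
  moreover have "C * norm s \<le> C * 1"
    using Suc.prems(4) IH[of 0] by (intro mult_left_mono) auto
  ultimately show ?case by (simp add: q_def)
qed

text \<open>The remainder is uniform in the direction because, by multilinearity, it is enough to expand the
  last derivative along finitely many basis vectors.\<close>

lemma taylor_peano:
  fixes f :: "'a::euclidean_space \<Rightarrow> real"
  assumes D: "\<And>y. D_at (Suc k) f y" and "0 < \<epsilon>"
  obtains \<delta> where "0 < \<delta>" "\<And>e. norm e < \<delta> \<Longrightarrow>
    \<bar>f (x + e) - (\<Sum>l\<le>Suc k. nth_derivative l f x (replicate l e) / fact l)\<bar> \<le> \<epsilon> * norm e ^ Suc k"
proof -
  \<comment> \<open>The basis expansion of a form of degree \<open>k\<close> multiplies a bound on
    basis lists by this factor, so the tolerance there is \<open>\<epsilon> / n\<close>.\<close>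
  define n where "n = real DIM('a) ^ k"
  have n: "0 < n" by (simp add: n_def)
  define M where "M y vs = nth_derivative k f y vs - nth_derivative k f x vs - nth_derivative (Suc k) f x ((y - x) # vs)" for y vs
  have mult: "multilinear_form k (M y)" for y
    unfolding M_def using multilinear_nth_derivative[OF D, of k] multilinear_form_Cons[OF multilinear_nth_derivative[OF D, of "Suc k"]]
    by (intro multilinear_form_diff) auto
  have "\<forall>\<^sub>F y in nhds x. \<forall>bs\<in>{bs. set bs \<subseteq> Basis \<and> length bs = k}. \<bar>M y bs\<bar> \<le> \<epsilon> / n * norm (y - x)"
  proof (intro eventually_ball_finite ballI finite_lists_length_eq finite_Basis)
    fix bs :: "'a list" assume "bs \<in> {bs. set bs \<subseteq> Basis \<and> length bs = k}"
    then have "((\<lambda>y. nth_derivative k f y bs) has_derivative (\<lambda>v. nth_derivative (Suc k) f x (v # bs))) (at x)"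
      by (intro nth_derivative_has_derivative[OF D]) auto
    moreover have "0 < \<epsilon> / n" using \<open>0 < \<epsilon>\<close> n by simp
    ultimately obtain d where "0 < d" "\<And>y. norm (y - x) < d \<Longrightarrow>
        norm (nth_derivative k f y bs - nth_derivative k f x bs - nth_derivative (Suc k) f x ((y - x) # bs)) \<le> \<epsilon> / n * norm (y - x)"
      unfolding has_derivative_at_alt by blast
    then show "\<forall>\<^sub>F y in nhds x. \<bar>M y bs\<bar> \<le> \<epsilon> / n * norm (y - x)"
      unfolding eventually_nhds_metric M_def by (auto simp: dist_norm)
  qed
  then obtain \<delta> where \<delta>: "0 < \<delta>" "\<And>y bs. norm (y - x) < \<delta> \<Longrightarrow> set bs \<subseteq> Basis \<Longrightarrow> length bs = k \<Longrightarrow>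
      \<bar>M y bs\<bar> \<le> \<epsilon> / n * norm (y - x)"
    unfolding eventually_nhds_metric by (auto simp: dist_norm)
  have "\<bar>f (x + e) - (\<Sum>l\<le>Suc k. nth_derivative l f x (replicate l e) / fact l)\<bar> \<le> \<epsilon> * norm e ^ Suc k"
    if e: "norm e < \<delta>" for e
  proof -
    define a where "a l = nth_derivative l f x (replicate l e)" for l
    define g where "g i s = nth_derivative i f (x + s *\<^sub>R e) (replicate i e)" for i and s :: real
    have "\<bar>g 0 1 - (\<Sum>l\<le>Suc k. a l * 1 ^ l / fact l)\<bar> \<le> \<epsilon> * norm e ^ Suc k"
    proof (rule taylor_remainder_unit_interval[where k = k and g = g and a = a])
      fix i s assume "i < k"
      then have d: "((\<lambda>y. nth_derivative i f y (replicate i e)) has_derivative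
          (\<lambda>v. nth_derivative (Suc i) f (x + s *\<^sub>R e) (v # replicate i e))) (at (x + s *\<^sub>R e))"
        by (intro nth_derivative_has_derivative[OF D]) auto
      have lin: "linear (\<lambda>v. nth_derivative (Suc i) f (x + s *\<^sub>R e) (v # replicate i e))"
        using d by (rule has_derivative_linear)
      have "(g i has_derivative (\<lambda>t. nth_derivative (Suc i) f (x + s *\<^sub>R e) ((t *\<^sub>R e) # replicate i e))) (at s within {0..1})"
        unfolding g_def
        by (rule has_derivative_compose[where f = "\<lambda>s. x + s *\<^sub>R e" and g = "\<lambda>y. nth_derivative i f y (replicate i e)", OF _ d])
          (auto intro!: derivative_eq_intros)
      then show "(g i has_real_derivative g (Suc i) s) (at s within {0..1})"
        by (rule has_derivative_imp_has_field_derivative)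
          (simp only: linear_scale[OF lin], simp add: g_def del: nth_derivative.simps)
    next
      fix s :: real assume s: "s \<in> {0..1}"
      define y where "y = x + s *\<^sub>R e"
      have nyx: "norm (y - x) = s * norm e" using s by (simp add: y_def)
      have "s * norm e \<le> 1 * norm e" using s by (intro mult_right_mono) auto
      then have yd: "norm (y - x) < \<delta>" using e nyx by simp
      have "\<bar>M y (replicate k e)\<bar> \<le> \<epsilon> / n * norm (y - x) * real DIM('a) ^ k * prod_list (map norm (replicate k e))"
        using \<delta>(2)[OF yd] n \<open>0 < \<epsilon>\<close> by (intro multilinear_form_bound[OF mult]) auto
      also have "\<dots> = \<epsilon> * norm (y - x) * norm e ^ k" using n by (simp add: n_def[symmetric])
      also have "\<dots> \<le> \<epsilon> * norm e * norm e ^ k"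
        using \<open>s * norm e \<le> 1 * norm e\<close> \<open>0 < \<epsilon>\<close> nyx by (intro mult_right_mono mult_left_mono) auto
      finally have "\<bar>M y (replicate k e)\<bar> \<le> \<epsilon> * norm e ^ Suc k" by simp
      moreover have "nth_derivative (Suc k) f x ((y - x) # replicate k e) = a (Suc k) * s"
      proof -
        have lin: "linear (\<lambda>v. nth_derivative (Suc k) f x (v # replicate k e))"
          by (rule multilinear_form_hd[OF multilinear_nth_derivative[OF D order_refl]]) simp
        have "y - x = s *\<^sub>R e" by (simp add: y_def)
        then show ?thesis by (simp only: linear_scale[OF lin] a_def replicate_Suc) simp
      qed
      ultimately show "\<bar>g k s - (a k + a (Suc k) * s)\<bar> \<le> \<epsilon> * norm e ^ Suc k"
        by (simp add: M_def g_def a_def y_def diff_diff_eq del: nth_derivative.simps)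
    qed (simp_all add: g_def a_def)
    then show ?thesis by (simp add: g_def a_def)
  qed
  with \<delta>(1) that show ?thesis by blast
qed

text \<open>Letting \<open>r\<close> tend to 0 kills the constant coefficient; division by
  \<open>r\<close> then lowers the degree and the exponent on the right together.\<close>

lemma polynomial_coeffs_eq_0:
  fixes b :: "nat \<Rightarrow> real"
  assumes "\<forall>\<^sub>F r in at_right 0. \<bar>\<Sum>l<k. b l * r ^ l\<bar> \<le> C * r ^ k" and "l < k"
  shows "b l = 0"
  using assms
proof (induction k arbitrary: b l)
  case 0
  then show ?case by simp
next
  case (Suc k)
  have split: "(\<Sum>l<Suc k. b l * r ^ l) = b 0 + r * (\<Sum>l<k. b (Suc l) * r ^ l)" for r
    by (subst sum.lessThan_Suc_shift) (simp add: sum_distrib_left mult_ac)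
  have b0: "b 0 = 0"
  proof -
    have "((\<lambda>r. \<bar>\<Sum>l<Suc k. b l * r ^ l\<bar>) \<longlongrightarrow> \<bar>\<Sum>l<Suc k. b l * 0 ^ l\<bar>) (at_right 0)"
      by (intro tendsto_intros)
    moreover have "((\<lambda>r. C * r ^ Suc k) \<longlongrightarrow> C * 0 ^ Suc k) (at_right 0)"
      by (intro tendsto_intros)
    ultimately have "\<bar>\<Sum>l<Suc k. b l * 0 ^ l\<bar> \<le> C * 0 ^ Suc k"
      using tendsto_le[OF trivial_limit_at_right_real _ _ Suc.prems(1)] by blast
    then show ?thesis unfolding split by simp
  qed
  have "\<forall>\<^sub>F r in at_right 0. \<bar>\<Sum>l<k. b (Suc l) * r ^ l\<bar> \<le> C * r ^ k"
    using Suc.prems(1) eventually_at_right_less[of "0::real"]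
  proof eventually_elim
    case (elim r)
    then have "r * \<bar>\<Sum>l<k. b (Suc l) * r ^ l\<bar> \<le> r * (C * r ^ k)"
      unfolding split b0 by (simp add: abs_mult mult_ac)
    with elim(2) show ?case by (simp only: mult_le_cancel_left_pos)
  qed
  with Suc.IH[of "\<lambda>l. b (Suc l)"] b0 Suc.prems(2) show ?case by (cases l) auto
qed

section \<open>Local variation to leading order\<close>

text \<open>Compactness of the sphere makes the supremum a maximum, and homogeneity of degree
  \<open>k\<close> carries the bound to all vectors.\<close>

lemma nth_derivative_norm_bound:
  fixes f :: "'a::euclidean_space \<Rightarrow> real"
  assumes D: "\<And>y. D_at k f y"
  shows "\<bar>nth_derivative k f x (replicate k e)\<bar> \<le> nth_derivative_norm k f x * norm e ^ k"
    and "\<exists>w. norm w = 1 \<and> \<bar>nth_derivative k f x (replicate k w)\<bar> = nth_derivative_norm k f x"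
proof -
  define N where "N v = \<bar>nth_derivative k f x (replicate k v)\<bar>" for v
  have mult: "multilinear_form k (nth_derivative k f x)" by (rule multilinear_nth_derivative[OF D order_refl])
  have "continuous_on (sphere 0 1) N" unfolding N_def
    by (intro continuous_intros multilinear_form_diagonal_continuous_on[OF mult])
  moreover have "sphere (0::'a) 1 \<noteq> {}" by simp
  ultimately obtain w where w: "w \<in> sphere 0 1" "\<And>v. v \<in> sphere 0 1 \<Longrightarrow> N v \<le> N w"
    using continuous_attains_sup[OF compact_sphere] by blast
  have sup: "nth_derivative_norm k f x = N w"
    unfolding nth_derivative_norm_def N_def[symmetric]
    by (rule cSup_eq_maximum) (use w in auto)
  with w(1) show "\<exists>w. norm w = 1 \<and> \<bar>nth_derivative k f x (replicate k w)\<bar> = nth_derivative_norm k f x"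
    by (auto simp: N_def)
  show "\<bar>nth_derivative k f x (replicate k e)\<bar> \<le> nth_derivative_norm k f x * norm e ^ k"
  proof (cases "e = 0")
    case True
    show ?thesis
    proof (cases k)
      case 0
      then show ?thesis using sup by (simp add: N_def)
    next
      case (Suc m)
      then show ?thesis using multilinear_form_diagonal_scale[OF mult, of 0 e] True by simp
    qed
  next
    case False
    define u where "u = e /\<^sub>R norm e"
    have "e = norm e *\<^sub>R u" "u \<in> sphere 0 1" using False by (auto simp: u_def)
    then have "\<bar>nth_derivative k f x (replicate k e)\<bar> = norm e ^ k * N u"
      using multilinear_form_diagonal_scale[OF mult, of "norm e" u] by (simp add: N_def abs_mult)
    also have "\<dots> \<le> norm e ^ k * N w" using w(2) \<open>u \<in> sphere 0 1\<close> by (intro mult_left_mono) auto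
    finally show ?thesis by (simp add: sup mult.commute)
  qed
qed

lemma nth_derivative_norm_nonneg:
  fixes f :: "'a::euclidean_space \<Rightarrow> real"
  assumes "\<And>y. D_at k f y"
  shows "0 \<le> nth_derivative_norm k f x"
  using nth_derivative_norm_bound(2)[OF assms, of x] by (metis abs_ge_zero)

text \<open>Taylor's formula along rays sees exactly these diagonal values, and growth bounds on
  \<open>f\<close> can recover them. Order 0 is left out since \<open>f x\<close> may be any
  number.\<close>

definition lower_diagonals_vanish :: "nat \<Rightarrow> ('a::euclidean_space \<Rightarrow> real) \<Rightarrow> 'a \<Rightarrow> bool" where
  "lower_diagonals_vanish k f x \<longleftrightarrow> (\<forall>j e. 0 < j \<longrightarrow> j < k \<longrightarrow> nth_derivative j f x (replicate j e) = 0)"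

lemma leading_term_expansion:
  fixes f :: "'a::euclidean_space \<Rightarrow> real"
  assumes D: "\<And>y. D_at k f y" and "0 < k" and van: "lower_diagonals_vanish k f x" and "0 < \<epsilon>"
  obtains \<delta> where "0 < \<delta>" "\<And>e. norm e < \<delta> \<Longrightarrow>
    \<bar>f (x + e) - f x - nth_derivative k f x (replicate k e) / fact k\<bar> \<le> \<epsilon> * norm e ^ k"
proof -
  obtain m where k: "k = Suc m" using \<open>0 < k\<close> by (cases k) auto
  obtain \<delta> where \<delta>: "0 < \<delta>" "\<And>e. norm e < \<delta> \<Longrightarrow>
    \<bar>f (x + e) - (\<Sum>l\<le>Suc m. nth_derivative l f x (replicate l e) / fact l)\<bar> \<le> \<epsilon> * norm e ^ Suc m"
    using taylor_peano[OF D[unfolded k] \<open>0 < \<epsilon>\<close>] by metis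
  have "(\<Sum>l\<le>Suc m. nth_derivative l f x (replicate l e) / fact l) =
      f x + nth_derivative k f x (replicate k e) / fact k" for e
  proof -
    have "(\<Sum>l\<le>m. nth_derivative l f x (replicate l e) / fact l) = (\<Sum>l\<le>m. if l = 0 then f x else 0)"
      using van by (intro sum.cong) (auto simp: lower_diagonals_vanish_def k)
    then show ?thesis by (simp add: k del: nth_derivative.simps(2) replicate_Suc)
  qed
  with \<delta> that show ?thesis by (simp add: k diff_diff_eq del: nth_derivative.simps(2) replicate_Suc power_Suc)
qed

text \<open>Growth of order \<open>k\<close> about \<open>x\<close> with an explicit constant. Being
  free of derivatives, it survives composition with the Lipschitz flow maps.\<close>

definition flat_at :: "nat \<Rightarrow> real \<Rightarrow> ('a::real_normed_vector \<Rightarrow> real) \<Rightarrow> 'a \<Rightarrow> bool" where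
  "flat_at k C f x \<longleftrightarrow> (\<exists>\<delta>>0. \<forall>y\<in>ball x \<delta>. \<bar>f y - f x\<bar> \<le> C * norm (y - x) ^ k)"

text \<open>A dictionary between derivatives and growth, so that maps not known to be differentiable
  can transport the former. From growth to vanishing: along each ray the Taylor polynomial minus its
  constant term is of order \<open>r ^ k\<close>, which kills its lower coefficients.\<close>

lemma lower_diagonals_vanish_iff_flat_at:
  fixes f :: "'a::euclidean_space \<Rightarrow> real"
  assumes D: "\<And>y. D_at k f y" and "0 < k"
  shows "lower_diagonals_vanish k f x \<longleftrightarrow> (\<exists>C. flat_at k C f x)"
proof
  assume "lower_diagonals_vanish k f x"
  then obtain \<delta> where \<delta>: "0 < \<delta>" "\<And>e. norm e < \<delta> \<Longrightarrow>
    \<bar>f (x + e) - f x - nth_derivative k f x (replicate k e) / fact k\<bar> \<le> 1 * norm e ^ k"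
    using leading_term_expansion[OF assms, of x 1] by (metis zero_less_one)
  have "\<bar>f y - f x\<bar> \<le> (1 + nth_derivative_norm k f x) * norm (y - x) ^ k" if y: "y \<in> ball x \<delta>" for y
  proof -
    define e where "e = y - x"
    have "\<bar>nth_derivative k f x (replicate k e) / fact k\<bar> \<le> \<bar>nth_derivative k f x (replicate k e)\<bar> / 1"
      unfolding abs_divide by (rule divide_left_mono) auto
    also have "\<dots> \<le> nth_derivative_norm k f x * norm e ^ k" using nth_derivative_norm_bound(1)[OF D] by simp
    finally have "\<bar>nth_derivative k f x (replicate k e) / fact k\<bar> \<le> nth_derivative_norm k f x * norm e ^ k" .
    moreover have "\<bar>f y - f x - nth_derivative k f x (replicate k e) / fact k\<bar> \<le> norm e ^ k"
      using \<delta>(2)[of e] y by (simp add: e_def dist_norm norm_minus_commute)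
    ultimately show ?thesis unfolding e_def[symmetric] distrib_right by linarith
  qed
  with \<delta>(1) show "\<exists>C. flat_at k C f x" unfolding flat_at_def by blast
next
  assume "\<exists>C. flat_at k C f x"
  then obtain C \<delta> where C: "0 < \<delta>" "\<And>y. y \<in> ball x \<delta> \<Longrightarrow> \<bar>f y - f x\<bar> \<le> C * norm (y - x) ^ k"
    unfolding flat_at_def by blast
  obtain m where k: "k = Suc m" using \<open>0 < k\<close> by (cases k) auto
  obtain d where d: "0 < d" "\<And>e. norm e < d \<Longrightarrow>
    \<bar>f (x + e) - (\<Sum>l\<le>Suc m. nth_derivative l f x (replicate l e) / fact l)\<bar> \<le> 1 * norm e ^ Suc m"
    using taylor_peano[OF D[unfolded k], of 1 x] by (metis zero_less_one)
  have "nth_derivative j f x (replicate j e) = 0" if j: "0 < j" "j < k" for j e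
  proof -
    define a where "a l = nth_derivative l f x (replicate l e) / fact l" for l
    \<comment> \<open>The constant term is split off as \<open>f x\<close>. In \<open>K\<close>
      below, flatness, Taylor remainder and top-order term contribute one summand each.\<close>
    define b where "b l = (if l = 0 then 0 else a l)" for l
    define n where "n = norm e + 1"
    have n: "0 < n" "norm e < n" by (auto simp: n_def add_nonneg_pos)
    define K where "K = C * norm e ^ k + norm e ^ k + \<bar>a k\<bar>"
    have "b j = 0"
    proof (rule polynomial_coeffs_eq_0[OF _ j(2)])
      show "\<forall>\<^sub>F r in at_right 0. \<bar>\<Sum>l<k. b l * r ^ l\<bar> \<le> K * r ^ k"
        unfolding eventually_at_right_field
      proof (intro exI[of _ "min \<delta> d / n"] conjI allI impI)
        show "0 < min \<delta> d / n" using C d n by simp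
        fix r :: real assume r: "0 < r" "r < min \<delta> d / n"
        then have "r * n < min \<delta> d" using n by (simp add: pos_less_divide_eq)
        moreover have "r * norm e \<le> r * n" using n r by (intro mult_left_mono) auto
        ultimately have "r * norm e < min \<delta> d" by (rule order_le_less_trans[rotated])
        then have re: "norm (r *\<^sub>R e) < \<delta>" "norm (r *\<^sub>R e) < d" using r(1) by auto
        have tm: "nth_derivative l f x (replicate l (r *\<^sub>R e)) / fact l = a l * r ^ l" if "l \<le> k" for l
          using multilinear_form_diagonal_scale[OF multilinear_nth_derivative[OF D that]] by (simp add: a_def mult.commute)
        have "(\<Sum>l\<le>Suc m. nth_derivative l f x (replicate l (r *\<^sub>R e)) / fact l) = (\<Sum>l\<le>Suc m. a l * r ^ l)"
          using tm by (intro sum.cong) (auto simp: k simp del: nth_derivative.simps replicate.simps)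
        also have "\<dots> = f x + (\<Sum>l<k. b l * r ^ l) + a k * r ^ k"
        proof -
          have "(\<Sum>l<k. a l * r ^ l) = (\<Sum>l<k. (if l = 0 then f x else 0) + b l * r ^ l)"
            by (intro sum.cong) (auto simp: b_def a_def)
          also have "\<dots> = f x + (\<Sum>l<k. b l * r ^ l)" using \<open>0 < k\<close> by (simp add: sum.distrib)
          finally show ?thesis by (simp add: k lessThan_Suc_atMost[symmetric])
        qed
        finally have eq: "(\<Sum>l\<le>Suc m. nth_derivative l f x (replicate l (r *\<^sub>R e)) / fact l) = f x + (\<Sum>l<k. b l * r ^ l) + a k * r ^ k" .
        have nr: "norm (r *\<^sub>R e) ^ k = norm e ^ k * r ^ k" using r by (simp add: power_mult_distrib mult.commute)
        have "\<bar>f (x + r *\<^sub>R e) - (f x + (\<Sum>l<k. b l * r ^ l) + a k * r ^ k)\<bar> \<le> norm e ^ k * r ^ k"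
          using d(2)[OF re(2)] unfolding eq unfolding k[symmetric] nr by simp
        moreover have "\<bar>f (x + r *\<^sub>R e) - f x\<bar> \<le> C * (norm e ^ k * r ^ k)"
          using C(2)[of "x + r *\<^sub>R e"] re(1) nr by (simp add: dist_norm)
        moreover have "\<bar>a k * r ^ k\<bar> = \<bar>a k\<bar> * r ^ k" using r by (simp add: abs_mult)
        ultimately show "\<bar>\<Sum>l<k. b l * r ^ l\<bar> \<le> K * r ^ k" unfolding K_def distrib_right mult.assoc by linarith
      qed
    qed
    then show ?thesis using j by (simp add: b_def a_def)
  qed
  then show "lower_diagonals_vanish k f x" by (simp add: lower_diagonals_vanish_def)
qed

lemma flat_at_germ_related:
  assumes "germ_related f p q"
  obtains L where "0 < L" "\<And>C. 0 \<le> C \<Longrightarrow> flat_at k C f q \<Longrightarrow> flat_at k (C * L) f p"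
proof -
  obtain \<phi> \<eta> K where \<phi>: "0 < \<eta>" "\<phi> p = q" "K-lipschitz_on (ball p \<eta>) \<phi>" "\<And>y. y\<in>ball p \<eta> \<Longrightarrow> f (\<phi> y) = f y"
    using assms(1) by (auto simp: germ_related_def germ_map_def)
  have K: "0 \<le> K" using \<phi>(3) by (rule lipschitz_on_nonneg)
  have "flat_at k (C * (K + 1) ^ k) f p" if "0 \<le> C" and flat: "flat_at k C f q" for C
  proof -
    obtain \<delta> where C: "0 < \<delta>" "\<And>y. y \<in> ball q \<delta> \<Longrightarrow> \<bar>f y - f q\<bar> \<le> C * norm (y - q) ^ k"
      using flat unfolding flat_at_def by blast
    define d where "d = min \<eta> (\<delta> / (K + 1))"
    have d: "0 < d" "d \<le> \<eta>" "d \<le> \<delta> / (K + 1)" using \<phi>(1) C(1) K by (auto simp: d_def)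
    have "\<bar>f y - f p\<bar> \<le> C * (K + 1) ^ k * norm (y - p) ^ k" if y: "y \<in> ball p d" for y
    proof -
      have "norm (\<phi> y - q) \<le> K * norm (y - p)"
        using lipschitz_onD[OF \<phi>(3), of y p] y d \<phi>(1,2) by (auto simp: dist_norm)
      also have "\<dots> \<le> (K + 1) * norm (y - p)" by (simp add: algebra_simps)
      finally have lip: "norm (\<phi> y - q) \<le> (K + 1) * norm (y - p)" .
      also have "\<dots> < (K + 1) * d" using y K by (intro mult_strict_left_mono) (auto simp: dist_norm norm_minus_commute)
      also have "\<dots> \<le> \<delta>" using d(3) K by (simp add: pos_le_divide_eq mult.commute)
      finally have "\<phi> y \<in> ball q \<delta>" by (simp add: dist_norm norm_minus_commute)
      then have "\<bar>f (\<phi> y) - f q\<bar> \<le> C * norm (\<phi> y - q) ^ k" by (rule C(2))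
      also have "\<dots> \<le> C * ((K + 1) * norm (y - p)) ^ k"
        using lip \<open>0 \<le> C\<close> by (intro mult_left_mono power_mono) auto
      finally show ?thesis using \<phi>(4)[of y] \<phi>(4)[of p] y d \<phi>(1,2) by (simp add: power_mult_distrib mult_ac)
    qed
    with d(1) show ?thesis unfolding flat_at_def by blast
  qed
  moreover have "0 < (K + 1) ^ k" using K by simp
  ultimately show ?thesis using that by blast
qed

lemma flat_at_mono:
  assumes "flat_at k C f x" "C \<le> C'"
  shows "flat_at k C' f x"
proof -
  have "C * norm (y - x) ^ k \<le> C' * norm (y - x) ^ k" for y
    using assms(2) by (rule mult_right_mono) simp
  with assms(1) show ?thesis unfolding flat_at_def by (meson order_trans)
qed

lemma lower_diagonals_vanish_germ_related:
  fixes f :: "'a::euclidean_space \<Rightarrow> real"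
  assumes D: "\<And>y. D_at k f y" and "0 < k" and rel: "germ_related f p q"
    and "lower_diagonals_vanish k f q"
  shows "lower_diagonals_vanish k f p"
proof -
  obtain C where "flat_at k C f q" using assms lower_diagonals_vanish_iff_flat_at by blast
  then have "flat_at k \<bar>C\<bar> f q" by (rule flat_at_mono) simp
  then show ?thesis
    using flat_at_germ_related[OF rel, of k] lower_diagonals_vanish_iff_flat_at[OF D \<open>0 < k\<close>] by (metis abs_ge_zero)
qed

text \<open>The second half of the dictionary: a vanishing leading form corresponds to little-o
  growth of order \<open>k\<close>. One way, only the Taylor remainder is left; the other way, the
  growth is tested along the ray through a maximiser.\<close>

lemma nth_derivative_norm_eq_0_iff:
  fixes f :: "'a::euclidean_space \<Rightarrow> real"
  assumes D: "\<And>y. D_at k f y" and "0 < k" and van: "lower_diagonals_vanish k f x"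
  shows "nth_derivative_norm k f x = 0 \<longleftrightarrow> (\<forall>C>0. flat_at k C f x)"
proof
  assume 0: "nth_derivative_norm k f x = 0"
  have N0: "nth_derivative k f x (replicate k e) = 0" for e
    using nth_derivative_norm_bound(1)[OF D, of x e] 0 by simp
  show "\<forall>C>0. flat_at k C f x"
  proof (intro allI impI)
    fix C :: real assume "0 < C"
    obtain \<delta> where \<delta>: "0 < \<delta>" "\<And>e. norm e < \<delta> \<Longrightarrow>
      \<bar>f (x + e) - f x - nth_derivative k f x (replicate k e) / fact k\<bar> \<le> C * norm e ^ k"
      using leading_term_expansion[OF D assms(2) van \<open>0 < C\<close>] by metis
    have "\<bar>f y - f x\<bar> \<le> C * norm (y - x) ^ k" if "y \<in> ball x \<delta>" for y
      using \<delta>(2)[of "y - x"] that by (simp add: N0 dist_norm norm_minus_commute)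
    with \<delta>(1) show "flat_at k C f x" unfolding flat_at_def by blast
  qed
next
  assume flat: "\<forall>C>0. flat_at k C f x"
  obtain w where w: "norm w = 1" "\<bar>nth_derivative k f x (replicate k w)\<bar> = nth_derivative_norm k f x"
    using nth_derivative_norm_bound(2)[OF D] by blast
  define \<nu> where "\<nu> = nth_derivative_norm k f x / fact k"
  have "\<nu> \<le> 0"
  proof (rule field_le_epsilon)
    fix e :: real assume "0 < e"
    then have "0 < e / 2" by simp
    obtain \<delta> where \<delta>: "0 < \<delta>" "\<And>v. norm v < \<delta> \<Longrightarrow>
      \<bar>f (x + v) - f x - nth_derivative k f x (replicate k v) / fact k\<bar> \<le> e / 2 * norm v ^ k"
      using leading_term_expansion[OF D assms(2) van \<open>0 < e / 2\<close>] by metis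
    obtain d where d: "0 < d" "\<And>y. y \<in> ball x d \<Longrightarrow> \<bar>f y - f x\<bar> \<le> e / 2 * norm (y - x) ^ k"
      using flat \<open>0 < e / 2\<close> unfolding flat_at_def by blast
    define r where "r = min d \<delta> / 2"
    have r: "0 < r" "r < d" "r < \<delta>" using \<delta> d by (auto simp: r_def)
    have "\<bar>f (x + r *\<^sub>R w) - f x - nth_derivative k f x (replicate k (r *\<^sub>R w)) / fact k\<bar> \<le> e / 2 * r ^ k"
      using \<delta>(2)[of "r *\<^sub>R w"] r w by simp
    moreover have "\<bar>f (x + r *\<^sub>R w) - f x\<bar> \<le> e / 2 * r ^ k"
      using d(2)[of "x + r *\<^sub>R w"] r w by (simp add: dist_norm)
    moreover have "\<bar>nth_derivative k f x (replicate k (r *\<^sub>R w)) / fact k\<bar> = \<nu> * r ^ k"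
      using multilinear_form_diagonal_scale[OF multilinear_nth_derivative[OF D order_refl], of x r w] w(2) r
      by (simp add: abs_mult \<nu>_def mult.commute)
    ultimately have "\<nu> * r ^ k \<le> e * r ^ k" by linarith
    then show "\<nu> \<le> 0 + e" using r(1) by simp
  qed
  moreover have "0 \<le> nth_derivative_norm k f x" by (rule nth_derivative_norm_nonneg[OF D])
  ultimately show "nth_derivative_norm k f x = 0" using fact_gt_zero[of k, where 'a = real] by (auto simp: \<nu>_def divide_le_0_iff)
qed

text \<open>Strict decay needs a positive norm at \<open>s\<close>, but positivity is given at
  \<open>t\<^sub>0\<close>; if \<open>t\<^sub>0\<close> is the earlier time, the decay estimate
  points the wrong way. Instead, a vanishing leading form at \<open>q\<close> would mean little-o
  growth there, hence also at \<open>p\<close>.\<close>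

lemma nth_derivative_norm_pos_germ_related:
  fixes f :: "'a::euclidean_space \<Rightarrow> real"
  assumes D: "\<And>y. D_at k f y" and "0 < k" and rel: "germ_related f p q"
    and van: "lower_diagonals_vanish k f q" and pos: "0 < nth_derivative_norm k f p"
  shows "0 < nth_derivative_norm k f q"
proof (rule ccontr)
  assume "\<not> ?thesis"
  then have "nth_derivative_norm k f q = 0" using nth_derivative_norm_nonneg[OF D, of q] by simp
  then have flat: "flat_at k C f q" if "0 < C" for C
    using nth_derivative_norm_eq_0_iff[OF D assms(2) van] that by blast
  obtain L where L: "0 < L" "\<And>C. 0 \<le> C \<Longrightarrow> flat_at k C f q \<Longrightarrow> flat_at k (C * L) f p"
    using flat_at_germ_related[OF rel] by metis
  have "flat_at k C f p" if "0 < C" for C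
    using L(2)[of "C / L"] flat[of "C / L"] L(1) that by simp
  moreover have "lower_diagonals_vanish k f p" by (rule lower_diagonals_vanish_germ_related[OF D assms(2) rel van])
  ultimately have "nth_derivative_norm k f p = 0" using nth_derivative_norm_eq_0_iff[OF D assms(2)] by blast
  with pos show False by simp
qed

text \<open>At the maximiser \<open>w\<close> of the leading form the penalised rescaled function
  \<open>u \<mapsto> (f (x + \<rho> u) - f x) / \<rho>\<^sup>k - Q |u|\<^sup>k - |u - w|\<^sup>2\<close> has a maximum close to \<open>w\<close>.\<close>

lemma gradient_direction_at_maximiser:
  fixes f :: "'a::euclidean_space \<Rightarrow> real"
  assumes diff: "\<And>y. f differentiable (at y)" and "0 < k" "0 < Q" "norm w = 1"
    and up: "\<And>\<epsilon>. 0 < \<epsilon> \<Longrightarrow> \<exists>\<delta>>0. \<forall>e. norm e < \<delta> \<longrightarrow> f (x + e) - f x \<le> (Q + \<epsilon>) * norm e ^ k"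
    and low: "\<And>\<epsilon>. 0 < \<epsilon> \<Longrightarrow> \<exists>\<delta>>0. \<forall>r. 0 < r \<longrightarrow> r < \<delta> \<longrightarrow> (Q - \<epsilon>) * r ^ k \<le> f (x + r *\<^sub>R w) - f x"
    and "0 < \<epsilon>"
  shows "\<exists>y c. dist x y < \<epsilon> \<and> norm (c *\<^sub>R gradient f y - w) < \<epsilon>"
proof -
  \<comment> \<open>The gradient of the two penalties at \<open>u\<close>. At \<open>w\<close> it is
    a positive multiple of \<open>w\<close>, and at a maximiser of \<open>\<Phi>\<close> near
    \<open>w\<close> it equals the rescaled gradient of \<open>f\<close>; continuity of
    \<open>g\<close> compares the two.\<close>
  define g where "g u = (Q * real k * norm u ^ (k - 1)) *\<^sub>R sgn u + 2 *\<^sub>R (u - w)" for u :: 'a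
  have "w \<noteq> 0" using \<open>norm w = 1\<close> by auto
  define P where "P = Q * real k"
  have P: "0 < P" using \<open>0 < k\<close> \<open>0 < Q\<close> by (simp add: P_def)
  have "isCont g w"
    unfolding g_def using \<open>w \<noteq> 0\<close> by (intro continuous_intros) auto
  moreover have gw: "g w = P *\<^sub>R w" using \<open>norm w = 1\<close> by (simp add: g_def P_def sgn_div_norm)
  moreover have "0 < \<epsilon> * P" using P \<open>0 < \<epsilon>\<close> by simp
  ultimately obtain \<theta>0 where \<theta>0: "0 < \<theta>0" "\<And>u. dist u w < \<theta>0 \<Longrightarrow> dist (g u) (P *\<^sub>R w) < \<epsilon> * P"
    unfolding continuous_at_eps_delta by metis
  define \<theta> where "\<theta> = min \<theta>0 (1 / 2)"
  have \<theta>: "0 < \<theta>" "\<theta> \<le> \<theta>0" "\<theta> \<le> 1 / 2" using \<theta>0 by (auto simp: \<theta>_def)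
  \<comment> \<open>The error \<open>\<eta>\<close> is paid once at \<open>w\<close> and once,
    scaled by \<open>norm u ^ k\<close>, at \<open>u\<close>, where
    \<open>norm u \<le> 3 / 2\<close>.\<close>
  define c where "c = (1::real) + (3 / 2) ^ k"
  have c: "0 < c" by (simp add: c_def add_pos_pos)
  define \<eta> where "\<eta> = \<theta>\<^sup>2 / (2 * c)"
  have \<eta>: "0 < \<eta>" "\<eta> * c < \<theta>\<^sup>2" using \<theta> c by (auto simp: \<eta>_def)
  obtain d1 where d1: "0 < d1" "\<And>e. norm e < d1 \<Longrightarrow> f (x + e) - f x \<le> (Q + \<eta>) * norm e ^ k"
    using up[OF \<eta>(1)] by blast
  obtain d2 where d2: "0 < d2" "\<And>r. 0 < r \<Longrightarrow> r < d2 \<Longrightarrow> (Q - \<eta>) * r ^ k \<le> f (x + r *\<^sub>R w) - f x"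
    using low[OF \<eta>(1)] by blast
  define r where "r = min (min d1 d2) \<epsilon> / 2"
  have r: "0 < r" "2 * r \<le> d1" "r < d2" "2 * r \<le> \<epsilon>" using d1 d2 \<open>0 < \<epsilon>\<close> by (auto simp: r_def)
  have rk: "0 < r ^ k" using r by simp
  define \<Phi> where "\<Phi> u = (f (x + r *\<^sub>R u) - f x) / r ^ k - Q * norm u ^ k - (u - w) \<bullet> (u - w)" for u
  have "continuous_on UNIV f"
    using diff differentiable_imp_continuous_within continuous_at_imp_continuous_on by blast
  then have "continuous_on (cball w (1 / 2)) (\<lambda>u. f (x + r *\<^sub>R u))"
    by (rule continuous_on_compose2) (auto intro!: continuous_intros)
  then have "continuous_on (cball w (1 / 2)) \<Phi>"
    unfolding \<Phi>_def using rk r(1) by (intro continuous_intros) auto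
  then obtain u where u: "u \<in> cball w (1 / 2)" "\<And>v. v \<in> cball w (1 / 2) \<Longrightarrow> \<Phi> v \<le> \<Phi> u"
    using continuous_attains_sup[of "cball w (1 / 2)" \<Phi>] by fastforce
  have nu: "norm u \<le> 3 / 2"
    using u(1) norm_triangle_sub[of u w] \<open>norm w = 1\<close> by (simp add: dist_norm norm_minus_commute)
  have "(Q - \<eta>) \<le> (f (x + r *\<^sub>R w) - f x) / r ^ k"
    using d2(2)[of r] r rk by (simp add: pos_le_divide_eq)
  then have "- \<eta> \<le> \<Phi> w" using \<open>norm w = 1\<close> by (simp add: \<Phi>_def)
  also have "\<dots> \<le> \<Phi> u" by (rule u(2)) simp
  also have "\<dots> \<le> \<eta> * norm u ^ k - (norm (u - w))\<^sup>2"
  proof -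
    have "norm (r *\<^sub>R u) \<le> r * (3 / 2)" using nu r by simp
    also have "\<dots> < d1" using r by linarith
    finally have "f (x + r *\<^sub>R u) - f x \<le> (Q + \<eta>) * norm (r *\<^sub>R u) ^ k" by (rule d1(2))
    also have "\<dots> = ((Q + \<eta>) * norm u ^ k) * r ^ k" using r by (simp add: power_mult_distrib)
    finally have "(f (x + r *\<^sub>R u) - f x) / r ^ k \<le> (Q + \<eta>) * norm u ^ k" using rk by (simp add: pos_divide_le_eq)
    then show ?thesis by (simp add: \<Phi>_def power2_norm_eq_inner algebra_simps)
  qed
  finally have "(norm (u - w))\<^sup>2 \<le> \<eta> * norm u ^ k + \<eta>" by simp
  also have "\<dots> \<le> \<eta> * (3 / 2) ^ k + \<eta>" using nu \<eta> by (intro add_mono mult_left_mono power_mono) auto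
  also have "\<dots> = \<eta> * c" by (simp add: c_def algebra_simps)
  also have "\<dots> < \<theta>\<^sup>2" by (rule \<eta>(2))
  finally have uw: "norm (u - w) < \<theta>" using \<theta>(1) by (simp add: power2_less_imp_less)
  have "u \<noteq> 0" using uw \<theta>(3) \<open>norm w = 1\<close> by auto
  define y where "y = x + r *\<^sub>R u"
  have "GDERIV f y :> gradient f y" by (rule differentiable_imp_gderiv[OF diff])
  then have fy: "(f has_derivative (\<lambda>h. h \<bullet> gradient f y)) (at (x + r *\<^sub>R u))" by (simp add: gderiv_def y_def)
  have "((\<lambda>u. f (x + r *\<^sub>R u)) has_derivative (\<lambda>h. (r *\<^sub>R h) \<bullet> gradient f y)) (at u)"
    by (rule has_derivative_compose[where f = "\<lambda>u. x + r *\<^sub>R u" and g = f and g' = "\<lambda>h. h \<bullet> gradient f y", OF _ fy])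
      (auto intro!: derivative_eq_intros)
  moreover have "((\<lambda>u. norm u ^ k) has_derivative (\<lambda>h. real k * (h \<bullet> sgn u) * norm u ^ (k - 1))) (at u)"
    by (rule has_derivative_power[OF has_derivative_norm[OF \<open>u \<noteq> 0\<close>]])
  moreover have "((\<lambda>u. (u - w) \<bullet> (u - w)) has_derivative (\<lambda>h. (u - w) \<bullet> h + h \<bullet> (u - w))) (at u)"
    by (auto intro!: derivative_eq_intros)
  ultimately have "(\<Phi> has_derivative (\<lambda>h. ((r *\<^sub>R h) \<bullet> gradient f y - 0) / r ^ k - Q * (real k * (h \<bullet> sgn u) * norm u ^ (k - 1))
      - ((u - w) \<bullet> h + h \<bullet> (u - w)))) (at u)"
    unfolding \<Phi>_def divide_inverse
    by (intro has_derivative_diff has_derivative_mult_left has_derivative_mult_right has_derivative_const)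
  moreover have "u \<in> ball w (1 / 2)" using uw \<theta>(3) by (simp add: dist_norm norm_minus_commute)
  ultimately have "(\<lambda>h. ((r *\<^sub>R h) \<bullet> gradient f y - 0) / r ^ k - Q * (real k * (h \<bullet> sgn u) * norm u ^ (k - 1))
      - ((u - w) \<bullet> h + h \<bullet> (u - w))) = (\<lambda>v. 0)"
    using u(2) by (intro differential_zero_maxmin[of u "ball w (1 / 2)" \<Phi>]) auto
  then have zero: "((r *\<^sub>R h) \<bullet> gradient f y - 0) / r ^ k - Q * (real k * (h \<bullet> sgn u) * norm u ^ (k - 1))
      - ((u - w) \<bullet> h + h \<bullet> (u - w)) = 0" for h by meson
  have "h \<bullet> ((r / r ^ k) *\<^sub>R gradient f y - g u) = 0" for h
    using zero[of h] by (simp add: g_def inner_diff_right inner_add_right inner_commute algebra_simps)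
  then have g: "(r / r ^ k) *\<^sub>R gradient f y = g u" by (metis inner_eq_zero_iff right_minus_eq)
  have gu: "dist (g u) (P *\<^sub>R w) < \<epsilon> * P" using \<theta>0(2) uw \<theta>(2) by (simp add: dist_norm)
  have "((r / r ^ k) / P) *\<^sub>R gradient f y - w = inverse P *\<^sub>R (g u - P *\<^sub>R w)"
    using P by (simp add: g[symmetric] scaleR_diff_right divide_inverse mult_ac)
  then have "norm (((r / r ^ k) / P) *\<^sub>R gradient f y - w) = inverse P * dist (g u) (P *\<^sub>R w)"
    using P by (simp add: dist_norm)
  also have "\<dots> < inverse P * (\<epsilon> * P)"
    using gu P by (intro mult_strict_left_mono) auto
  also have "\<dots> = \<epsilon>" using P by simp
  finally have "norm (((r / r ^ k) / P) *\<^sub>R gradient f y - w) < \<epsilon>" .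
  moreover have "dist x y < \<epsilon>"
  proof -
    have "r * norm u \<le> r * (3 / 2)" using nu r by (intro mult_left_mono) auto
    then have "r * norm u < \<epsilon>" using r by linarith
    then show ?thesis using r by (simp add: y_def dist_norm)
  qed
  ultimately show ?thesis by blast
qed

text \<open>\<open>\<alpha>\<close> and \<open>\<beta>\<close> are leading coefficients of the
  variation at \<open>p\<close> and \<open>q\<close>. A third of their gap as tolerance leaves the
  variation at \<open>p\<close> strictly smaller at every small radius, which gives the relation and
  refutes its converse.\<close>

lemma flatterI:
  fixes f :: "'a::euclidean_space \<Rightarrow> real"
  assumes cont: "continuous_on UNIV f" and "\<alpha> < \<beta>"
    and up: "\<And>\<epsilon>. 0 < \<epsilon> \<Longrightarrow> \<exists>\<delta>>0. \<forall>e. norm e < \<delta> \<longrightarrow> \<bar>f (p + e) - f p\<bar> \<le> (\<alpha> + \<epsilon>) * norm e ^ k"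
    and low: "\<And>\<epsilon>. 0 < \<epsilon> \<Longrightarrow> \<exists>\<delta>>0. \<forall>r. 0 < r \<longrightarrow> r < \<delta> \<longrightarrow>
        (\<exists>e. norm e \<le> r \<and> (\<beta> - \<epsilon>) * r ^ k \<le> \<bar>f (q + e) - f q\<bar>)"
    and "0 \<le> \<alpha>"
  shows "flatter f p q"
proof -
  define \<epsilon> where "\<epsilon> = (\<beta> - \<alpha>) / 3"
  have \<epsilon>: "0 < \<epsilon>" "\<alpha> + \<epsilon> < \<beta> - \<epsilon>" using \<open>\<alpha> < \<beta>\<close> by (auto simp: \<epsilon>_def field_simps)
  obtain d1 where d1: "0 < d1" "\<And>e. norm e < d1 \<Longrightarrow> \<bar>f (p + e) - f p\<bar> \<le> (\<alpha> + \<epsilon>) * norm e ^ k"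
    using up[OF \<epsilon>(1)] by blast
  obtain d2 where d2: "0 < d2" "\<And>r. 0 < r \<Longrightarrow> r < d2 \<Longrightarrow> \<exists>e. norm e \<le> r \<and> (\<beta> - \<epsilon>) * r ^ k \<le> \<bar>f (q + e) - f q\<bar>"
    using low[OF \<epsilon>(1)] by blast
  have less: "local_variation f p r < local_variation f q r" if r: "0 < r" "r < d1" "r < d2" for r
  proof -
    have "local_variation f p r \<le> (\<alpha> + \<epsilon>) * r ^ k"
      unfolding local_variation_def
    proof (rule cSUP_least)
      show "cball p r \<noteq> {}" using r by simp
      fix y assume "y \<in> cball p r"
      then have y: "norm (y - p) \<le> r" by (simp add: dist_norm norm_minus_commute)
      then have "\<bar>f y - f p\<bar> \<le> (\<alpha> + \<epsilon>) * norm (y - p) ^ k" using d1(2)[of "y - p"] r by simp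
      also have "\<dots> \<le> (\<alpha> + \<epsilon>) * r ^ k" using y \<epsilon> \<open>0 \<le> \<alpha>\<close> by (intro mult_left_mono power_mono) auto
      finally show "\<bar>f y - f p\<bar> \<le> (\<alpha> + \<epsilon>) * r ^ k" .
    qed
    also have "\<dots> < (\<beta> - \<epsilon>) * r ^ k" using \<epsilon>(2) r by (intro mult_strict_right_mono) auto
    also have "\<dots> \<le> local_variation f q r"
    proof -
      obtain e where e: "norm e \<le> r" "(\<beta> - \<epsilon>) * r ^ k \<le> \<bar>f (q + e) - f q\<bar>" using d2(2) r by blast
      have "compact ((\<lambda>y. \<bar>f y - f q\<bar>) ` cball q r)"
        by (intro compact_continuous_image continuous_intros continuous_on_subset[OF cont]) auto
      then have "bdd_above ((\<lambda>y. \<bar>f y - f q\<bar>) ` cball q r)"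
        by (intro bounded_imp_bdd_above compact_imp_bounded)
      then have "\<bar>f (q + e) - f q\<bar> \<le> local_variation f q r"
        unfolding local_variation_def using e(1) by (intro cSUP_upper) (auto simp: dist_norm)
      with e(2) show ?thesis by simp
    qed
    finally show ?thesis .
  qed
  define d where "d = min d1 d2 / 2"
  have d: "0 < d" "d < d1" "d < d2" using d1 d2 by (auto simp: d_def)
  have "flatter_eq f p q" unfolding flatter_eq_def
  proof (intro exI[of _ d] conjI ballI)
    fix r assume "r \<in> {0<..d}"
    then show "local_variation f p r \<le> local_variation f q r" using less[of r] d by simp
  qed (rule d)
  moreover have "\<not> flatter_eq f q p"
  proof
    assume "flatter_eq f q p"
    then obtain r' where r': "0 < r'" "\<And>r. r \<in> {0<..r'} \<Longrightarrow> local_variation f q r \<le> local_variation f p r"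
      by (auto simp: flatter_eq_def)
    have "local_variation f q (min r' d) \<le> local_variation f p (min r' d)" using r' d by auto
    moreover have "local_variation f p (min r' d) < local_variation f q (min r' d)" using r' d by (intro less) auto
    ultimately show False by simp
  qed
  ultimately show ?thesis by (simp add: flatter_def)
qed

section \<open>Decay of the leading derivative\<close>

context curvature_flow begin

text \<open>The curvature inequality is homogeneous of degree 2, so it passes from a gradient to all
  its multiples, negative ones included. It also passes to limits of the vector and, as
  \<open>H\<close> is continuous, of the base point.\<close>

lemma curvature_at_maximiser:
  assumes diff: "\<And>y. f differentiable (at y)" and p: "p \<in> U"
    and dir: "\<And>\<epsilon>. 0 < \<epsilon> \<Longrightarrow> \<exists>y c. dist p y < \<epsilon> \<and> norm (c *\<^sub>R gradient f y - w) < \<epsilon>"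
  shows "H p w \<bullet> w \<le> - \<omega> * (norm w)\<^sup>2"
proof -
  have lin: "bounded_linear (H p)" by (rule bounded_linear_H[OF p])
  have "H p w \<bullet> w \<le> (- \<omega> + e) * (norm w)\<^sup>2" if "0 < e" for e
  proof -
    obtain r where r: "0 < r" "cball p r \<subseteq> U" "\<And>z v. z \<in> cball p r \<Longrightarrow> norm (H z v - H p v) \<le> e * norm v"
      using H_continuous[OF p \<open>0 < e\<close>] by metis
    define S where "S = {v. H p v \<bullet> v \<le> (- \<omega> + e) * (norm v)\<^sup>2}"
    have "continuous_on UNIV (H p)" using lin by (rule linear_continuous_on)
    then have "closed S" unfolding S_def by (intro closed_Collect_le continuous_intros)
    have "\<exists>v\<in>S. dist v w < \<epsilon>" if "0 < \<epsilon>" for \<epsilon>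
    proof -
      obtain y c where y: "dist p y < min r \<epsilon>" "norm (c *\<^sub>R gradient f y - w) < min r \<epsilon>"
        using dir[of "min r \<epsilon>"] \<open>0 < \<epsilon>\<close> r(1) by auto
      define v where "v = c *\<^sub>R gradient f y"
      have yr: "y \<in> cball p r" using y by simp
      then have yU: "y \<in> U" using r(2) by blast
      have "H y (gradient f y) \<bullet> gradient f y \<le> - \<omega> * (norm (gradient f y))\<^sup>2"
        by (rule curv[OF yU gradient_in_limiting_gradients[OF diff]])
      then have "c\<^sup>2 * (H y (gradient f y) \<bullet> gradient f y) \<le> c\<^sup>2 * (- \<omega> * (norm (gradient f y))\<^sup>2)"
        by (rule mult_left_mono) simp
      moreover have "H y v = c *\<^sub>R H y (gradient f y)"
        unfolding v_def by (rule linear_scale[OF bounded_linear.linear[OF bounded_linear_H[OF yU]]])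
      ultimately have "H y v \<bullet> v \<le> - \<omega> * (norm v)\<^sup>2"
        by (simp add: v_def power_mult_distrib power2_eq_square mult_ac)
      moreover have "(H p v - H y v) \<bullet> v \<le> e * (norm v)\<^sup>2"
      proof -
        have "(H p v - H y v) \<bullet> v \<le> norm (H p v - H y v) * norm v" by (rule norm_cauchy_schwarz)
        also have "\<dots> \<le> (e * norm v) * norm v"
          using r(3)[OF yr, of v] by (intro mult_right_mono) (auto simp: norm_minus_commute)
        finally show ?thesis by (simp add: power2_eq_square mult_ac)
      qed
      ultimately have "v \<in> S" by (simp add: S_def inner_diff_left left_diff_distrib)
      with y(2) show ?thesis by (auto simp: v_def dist_norm)
    qed
    then have "w \<in> closure S" by (simp add: closure_approachable)
    with \<open>closed S\<close> show ?thesis by (simp add: S_def)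
  qed
  note * = this
  show ?thesis
  proof (rule field_le_epsilon)
    fix e :: real assume "0 < e"
    define d where "d = e / ((norm w)\<^sup>2 + 1)"
    have "0 < (norm w)\<^sup>2 + 1" by (simp add: add_nonneg_pos)
    then have d: "0 < d" "d * ((norm w)\<^sup>2 + 1) = e" using \<open>0 < e\<close> by (simp_all add: d_def)
    have "d * (norm w)\<^sup>2 \<le> e" using d by (simp add: distrib_left)
    with *[OF d(1)] show "H p w \<bullet> w \<le> - \<omega> * (norm w)\<^sup>2 + e" unfolding distrib_right by linarith
  qed
qed

text \<open>The form may be negative where its absolute value is largest. The sign
  \<open>\<sigma>\<close> makes the argument applicable to \<open>\<sigma> * f\<close>, and is
  afterwards absorbed into the free multiple \<open>c\<close> of the gradient.\<close>

lemma curvature_at_leading_form_maximiser: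
  assumes D: "\<And>y. D_at k f y" and k: "0 < k" and van: "lower_diagonals_vanish k f p" and p: "p \<in> U"
    and w: "norm w = 1" "\<bar>nth_derivative k f p (replicate k w)\<bar> = nth_derivative_norm k f p"
    and pos: "0 < nth_derivative_norm k f p"
  shows "H p w \<bullet> w \<le> - \<omega> * (norm w)\<^sup>2"
proof (rule curvature_at_maximiser[OF _ p])
  show diff: "f differentiable (at y)" for y
    using D_at_le[OF D, of 1 y] k by simp
  fix \<epsilon> :: real assume "0 < \<epsilon>"
  define N where "N = nth_derivative k f p"
  define Q where "Q = nth_derivative_norm k f p / fact k"
  have Q: "0 < Q" using pos by (simp add: Q_def)
  have mult: "multilinear_form k N" unfolding N_def by (rule multilinear_nth_derivative[OF D order_refl])
  have NQ: "\<bar>N (replicate k e) / fact k\<bar> \<le> Q * norm e ^ k" for e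
    using nth_derivative_norm_bound(1)[OF D, of p e] by (simp add: N_def Q_def divide_right_mono)
  define \<sigma> :: real where "\<sigma> = (if 0 \<le> N (replicate k w) then 1 else - 1)"
  have \<sigma>: "\<bar>\<sigma>\<bar> = 1" "\<sigma> * N (replicate k w) / fact k = Q" using w(2) by (auto simp: \<sigma>_def Q_def N_def)
  define F where "F y = \<sigma> * f y" for y
  have gF: "GDERIV F y :> \<sigma> *\<^sub>R gradient f y" for y
    using differentiable_imp_gderiv[OF diff[of y]] unfolding F_def gderiv_def
    by (auto intro!: derivative_eq_intros)
  have "\<exists>y c. dist p y < \<epsilon> \<and> norm (c *\<^sub>R gradient F y - w) < \<epsilon>"
  proof (rule gradient_direction_at_maximiser[OF _ k Q w(1) _ _ \<open>0 < \<epsilon>\<close>])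
    show "F differentiable (at y)" for y using gF[of y] by (auto simp: gderiv_def differentiable_def)
    fix e :: real assume "0 < e"
    obtain \<delta> where \<delta>: "0 < \<delta>" "\<And>v. norm v < \<delta> \<Longrightarrow> \<bar>f (p + v) - f p - N (replicate k v) / fact k\<bar> \<le> e * norm v ^ k"
      using leading_term_expansion[OF D k van \<open>0 < e\<close>, folded N_def] by metis
    have \<delta>F: "\<bar>F (p + v) - F p - \<sigma> * N (replicate k v) / fact k\<bar> \<le> e * norm v ^ k" if "norm v < \<delta>" for v
    proof -
      have "F (p + v) - F p - \<sigma> * N (replicate k v) / fact k = \<sigma> * (f (p + v) - f p - N (replicate k v) / fact k)"
        by (simp add: F_def algebra_simps)
      then show ?thesis using \<delta>(2)[OF that] \<sigma>(1) by (simp add: abs_mult)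
    qed
    show "\<exists>\<delta>>0. \<forall>v. norm v < \<delta> \<longrightarrow> F (p + v) - F p \<le> (Q + e) * norm v ^ k"
    proof (intro exI[of _ \<delta>] conjI allI impI \<delta>(1))
      fix v :: 'a assume "norm v < \<delta>"
      moreover have "\<sigma> * N (replicate k v) / fact k \<le> Q * norm v ^ k"
        using abs_le_D1[OF NQ[of v]] abs_le_D2[OF NQ[of v]] by (auto simp: \<sigma>_def)
      ultimately show "F (p + v) - F p \<le> (Q + e) * norm v ^ k"
        using \<delta>F[of v] by (simp add: distrib_right)
    qed
    show "\<exists>\<delta>>0. \<forall>r. 0 < r \<longrightarrow> r < \<delta> \<longrightarrow> (Q - e) * r ^ k \<le> F (p + r *\<^sub>R w) - F p"
    proof (intro exI[of _ \<delta>] conjI allI impI \<delta>(1))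
      fix r assume r: "0 < r" "r < \<delta>"
      have "\<sigma> * N (replicate k (r *\<^sub>R w)) / fact k = r ^ k * Q"
        unfolding \<sigma>(2)[symmetric] multilinear_form_diagonal_scale[OF mult] by simp
      then show "(Q - e) * r ^ k \<le> F (p + r *\<^sub>R w) - F p"
        using \<delta>F[of "r *\<^sub>R w"] r w(1) by (simp add: left_diff_distrib mult.commute)
    qed
  qed
  then obtain y c where "dist p y < \<epsilon>" "norm (c *\<^sub>R gradient F y - w) < \<epsilon>" by blast
  then show "\<exists>y c. dist p y < \<epsilon> \<and> norm (c *\<^sub>R gradient f y - w) < \<epsilon>"
    by (intro exI[of _ y] exI[of _ "c * \<sigma>"]) (simp add: gradient_eqI[OF gF])
qed

text \<open>Go out from \<open>x b\<close> by \<open>r\<close> along a maximiser \<open>w\<close>.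
  The flow brings this point to within \<open>\<mu> * r\<close> of \<open>x a\<close> without
  changing \<open>f\<close>, so the leading term at \<open>x b\<close> is bounded by the one at
  \<open>x a\<close> at the shorter distance; this is the factor \<open>\<mu> ^ k\<close>.\<close>

lemma derivative_norm_contraction:
  assumes D: "\<And>y. D_at k f y" and k: "0 < k"
    and van: "lower_diagonals_vanish k f (x a)" "lower_diagonals_vanish k f (x b)"
    and ab: "a \<in> I" "b \<in> I" and con: "contracts a b"
  shows "nth_derivative_norm k f (x b) \<le> (1 - (b - a) * \<omega> / 2) ^ k * nth_derivative_norm k f (x a)"
proof -
  define \<nu> where "\<nu> t = nth_derivative_norm k f (x t)" for t
  define \<mu> where "\<mu> = 1 - (b - a) * \<omega> / 2"
  have \<mu>: "0 < \<mu>" using con by (simp add: contracts_def \<mu>_def)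
  obtain \<phi> \<eta> K where \<phi>: "germ_map f (x b) (x a) \<phi> \<eta> K" and
    shrink: "\<And>y z p. y \<in> ball (x b) \<eta> \<Longrightarrow> z \<in> ball (x b) \<eta> \<Longrightarrow> p \<in> ball (x b) \<eta> \<Longrightarrow>
       H p (y - z) \<bullet> (y - z) \<le> - \<omega> * (norm (y - z))\<^sup>2 \<Longrightarrow> norm (\<phi> y - \<phi> z) \<le> \<mu> * norm (y - z)"
    using con unfolding contracts_def \<mu>_def[symmetric] by blast
  have \<phi>: "0 < \<eta>" "\<phi> (x b) = x a" "\<And>y. y \<in> ball (x b) \<eta> \<Longrightarrow> f (\<phi> y) = f y"
    using \<phi> by (auto simp: germ_map_def)
  have \<nu>0: "0 \<le> \<nu> t" for t unfolding \<nu>_def by (rule nth_derivative_norm_nonneg[OF D])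
  have "\<nu> b \<le> \<mu> ^ k * \<nu> a"
  proof (cases "0 < \<nu> b")
    case False
    then show ?thesis using \<nu>0[of a] \<mu> by (simp add: order_trans[of _ 0])
  next
    case True
    define N where "N t = nth_derivative k f (x t)" for t
    obtain w where w: "norm w = 1" "\<bar>N b (replicate k w)\<bar> = \<nu> b"
      using nth_derivative_norm_bound(2)[OF D, of "x b"] unfolding N_def \<nu>_def by blast
    have mult: "multilinear_form k (N b)" unfolding N_def by (rule multilinear_nth_derivative[OF D order_refl])
    have curv_w: "H (x b) w \<bullet> w \<le> - \<omega> * (norm w)\<^sup>2"
      using curvature_at_leading_form_maximiser[OF D k van(2) xU[OF ab(2)] w(1)] w(2) True unfolding N_def \<nu>_def by blast
    have lin: "linear (H (x b))" using bounded_linear_H[OF xU[OF ab(2)]] bounded_linear.linear by blast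
    have est: "\<nu> b / fact k \<le> \<mu> ^ k * \<nu> a / fact k + e * (1 + \<mu> ^ k)" if "0 < e" for e :: real
    proof -
      obtain d1 where d1: "0 < d1" "\<And>v. norm v < d1 \<Longrightarrow> \<bar>f (x a + v) - f (x a) - N a (replicate k v) / fact k\<bar> \<le> e * norm v ^ k"
        using leading_term_expansion[OF D k van(1) \<open>0 < e\<close>, folded N_def] by metis
      obtain d2 where d2: "0 < d2" "\<And>v. norm v < d2 \<Longrightarrow> \<bar>f (x b + v) - f (x b) - N b (replicate k v) / fact k\<bar> \<le> e * norm v ^ k"
        using leading_term_expansion[OF D k van(2) \<open>0 < e\<close>, folded N_def] by metis
      define m where "m = min (min d1 d2) (min \<eta> (d1 / \<mu>))"
      have "0 < m" using d1(1) d2(1) \<phi>(1) \<mu> by (simp add: m_def)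
      define r where "r = m / 2"
      have "0 < r" "r < m" using \<open>0 < m\<close> by (auto simp: r_def)
      then have r: "0 < r" "r < d2" "r < \<eta>" "r < d1 / \<mu>" by (auto simp: m_def)
      have r\<mu>: "\<mu> * r < d1" using r(4) \<mu> by (simp add: pos_less_divide_eq mult.commute)
      define y where "y = x b + r *\<^sub>R w"
      have y: "y \<in> ball (x b) \<eta>" using r w by (simp add: y_def dist_norm)
      define v where "v = \<phi> y - x a"
      have "norm (\<phi> y - \<phi> (x b)) \<le> \<mu> * norm (y - x b)"
      proof (rule shrink[OF y])
        have "r\<^sup>2 * (H (x b) w \<bullet> w) \<le> r\<^sup>2 * (- \<omega> * (norm w)\<^sup>2)" using curv_w by (rule mult_left_mono) simp
        then show "H (x b) (y - x b) \<bullet> (y - x b) \<le> - \<omega> * (norm (y - x b))\<^sup>2"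
          by (simp add: y_def linear_scale[OF lin] power_mult_distrib power2_eq_square mult_ac)
      qed (use \<phi>(1) in auto)
      then have nv: "norm v \<le> \<mu> * r" using r w by (simp add: v_def y_def \<phi>(2))
      have nvk: "norm v ^ k \<le> \<mu> ^ k * r ^ k" using power_mono[OF nv norm_ge_zero, of k] by (simp add: power_mult_distrib)
      have "\<bar>f (x a + v) - f (x a) - N a (replicate k v) / fact k\<bar> \<le> e * norm v ^ k"
        by (rule d1(2)) (use nv r\<mu> in simp)
      moreover have "\<bar>N a (replicate k v) / fact k\<bar> \<le> \<nu> a / fact k * norm v ^ k"
        using nth_derivative_norm_bound(1)[OF D, of "x a" v] by (simp add: N_def \<nu>_def divide_right_mono)
      ultimately have "\<bar>f (x a + v) - f (x a)\<bar> \<le> (\<nu> a / fact k + e) * norm v ^ k"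
        unfolding distrib_right by linarith
      also have "\<dots> \<le> (\<nu> a / fact k + e) * (\<mu> ^ k * r ^ k)"
        using nvk \<nu>0[of a] \<open>0 < e\<close> by (intro mult_left_mono) auto
      finally have up: "\<bar>f (x a + v) - f (x a)\<bar> \<le> ((\<nu> a / fact k + e) * \<mu> ^ k) * r ^ k" by (simp add: mult_ac)
      have "f (x a + v) - f (x a) = f (x b + r *\<^sub>R w) - f (x b)"
        using \<phi>(3)[OF y] \<phi>(3)[of "x b"] \<phi>(1,2) by (simp add: v_def y_def)
      moreover have "\<bar>f (x b + r *\<^sub>R w) - f (x b) - N b (replicate k (r *\<^sub>R w)) / fact k\<bar> \<le> e * r ^ k"
        using d2(2)[of "r *\<^sub>R w"] r w by simp
      moreover have "\<bar>N b (replicate k (r *\<^sub>R w)) / fact k\<bar> = \<nu> b / fact k * r ^ k"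
        using multilinear_form_diagonal_scale[OF mult, of r w] w(2) r by (simp add: abs_mult mult.commute)
      moreover have "v' - e' \<le> u'" if "p' = q'" "\<bar>q' - n'\<bar> \<le> e'" "\<bar>n'\<bar> = v'" "\<bar>p'\<bar> \<le> u'" for p' q' n' e' v' u' :: real
        using that by linarith
      ultimately have "\<nu> b / fact k * r ^ k - e * r ^ k \<le> ((\<nu> a / fact k + e) * \<mu> ^ k) * r ^ k" using up by blast
      then have "(\<nu> b / fact k - e) * r ^ k \<le> ((\<nu> a / fact k + e) * \<mu> ^ k) * r ^ k" by (simp add: left_diff_distrib)
      then have "\<nu> b / fact k - e \<le> (\<nu> a / fact k + e) * \<mu> ^ k"
        using r(1) by (simp only: mult_le_cancel_right_pos zero_less_power)
      then show ?thesis by (simp add: algebra_simps)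
    qed
    have "\<nu> b / fact k \<le> \<mu> ^ k * \<nu> a / fact k"
    proof (rule field_le_epsilon)
      fix e :: real assume "0 < e"
      have "0 < 1 + \<mu> ^ k" using \<mu> by (simp add: add_pos_pos)
      then show "\<nu> b / fact k \<le> \<mu> ^ k * \<nu> a / fact k + e"
        using est[of "e / (1 + \<mu> ^ k)"] \<open>0 < e\<close> by simp
    qed
    then show ?thesis by (simp add: divide_le_cancel)
  qed
  then show ?thesis by (simp add: \<nu>_def \<mu>_def)
qed

text \<open>Vanishing and positivity are known at one time and are spread over \<open>I\<close> by
  the germ relations. With a positive norm at \<open>s\<close> the exponential factor makes the
  decay strict, and the norms over \<open>fact k\<close> are the coefficients compared by
  \<open>flatterI\<close>.\<close>

lemma smooth_case:
  assumes D: "\<And>y. D_at k f y" and k: "0 < k" and t0: "t0 \<in> I" and van: "lower_diagonals_vanish k f (x t0)"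
    and st: "s \<in> I" "t \<in> I" "s < t"
  shows "nth_derivative_norm k f (x t) \<le> exp (- real k * \<omega> * (t - s) / 2) * nth_derivative_norm k f (x s)"
    and "0 < nth_derivative_norm k f (x t0) \<Longrightarrow> flatter f (x t) (x s)"
proof -
  define \<nu> where "\<nu> t = nth_derivative_norm k f (x t)" for t
  have \<nu>0: "0 \<le> \<nu> t" for t unfolding \<nu>_def by (rule nth_derivative_norm_nonneg[OF D])
  have vanish: "lower_diagonals_vanish k f (x r)" if "r \<in> I" for r
    using lower_diagonals_vanish_germ_related[OF D k trajectory_germ_related[OF that t0] van] .
  have dec: "\<nu> t \<le> exp (- real k * \<omega> * (t - s) / 2) * \<nu> s" if "s \<in> I" "t \<in> I" "s \<le> t" for s t
  proof (rule decay[OF _ \<nu>0 that])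
    fix a b assume "a \<in> I" "b \<in> I" "contracts a b"
    then show "\<nu> b \<le> (1 - (b - a) * \<omega> / 2) ^ k * \<nu> a"
      unfolding \<nu>_def by (intro derivative_norm_contraction[OF D k] vanish)
  qed
  show "nth_derivative_norm k f (x t) \<le> exp (- real k * \<omega> * (t - s) / 2) * nth_derivative_norm k f (x s)"
    using dec[of s t] st by (simp add: \<nu>_def)
  assume "0 < nth_derivative_norm k f (x t0)"
  then have pos: "0 < \<nu> s"
    unfolding \<nu>_def
    by (rule nth_derivative_norm_pos_germ_related[OF D k trajectory_germ_related[OF t0 st(1)] vanish[OF st(1)]])
  have "exp (- real k * \<omega> * (t - s) / 2) < 1" using k \<omega> st(3) by simp
  then have "exp (- real k * \<omega> * (t - s) / 2) * \<nu> s < 1 * \<nu> s" using pos by (rule mult_strict_right_mono)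
  with dec[of s t] st have less: "\<nu> t < \<nu> s" by simp
  show "flatter f (x t) (x s)"
  proof (rule flatterI)
    have "f differentiable (at y)" for y using D_at_le[OF D, of 1 y] k by simp
    then show "continuous_on UNIV f"
      using differentiable_imp_continuous_within continuous_at_imp_continuous_on by blast
    show "\<nu> t / fact k < \<nu> s / fact k" using less by (simp add: divide_strict_right_mono)
    show "0 \<le> \<nu> t / fact k" using \<nu>0 by simp
    fix e :: real assume "0 < e"
    obtain \<delta> where \<delta>: "0 < \<delta>" "\<And>v. norm v < \<delta> \<Longrightarrow>
        \<bar>f (x t + v) - f (x t) - nth_derivative k f (x t) (replicate k v) / fact k\<bar> \<le> e * norm v ^ k"
      using leading_term_expansion[OF D k vanish[OF st(2)] \<open>0 < e\<close>] by metis
    have "\<bar>f (x t + v) - f (x t)\<bar> \<le> (\<nu> t / fact k + e) * norm v ^ k" if "norm v < \<delta>" for v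
    proof -
      have "\<bar>nth_derivative k f (x t) (replicate k v) / fact k\<bar> \<le> \<nu> t / fact k * norm v ^ k"
        using nth_derivative_norm_bound(1)[OF D, of "x t" v] by (simp add: \<nu>_def divide_right_mono)
      with \<delta>(2)[OF that] show ?thesis unfolding distrib_right by linarith
    qed
    with \<delta>(1) show "\<exists>\<delta>>0. \<forall>v. norm v < \<delta> \<longrightarrow> \<bar>f (x t + v) - f (x t)\<bar> \<le> (\<nu> t / fact k + e) * norm v ^ k" by blast
    obtain d where d: "0 < d" "\<And>v. norm v < d \<Longrightarrow>
        \<bar>f (x s + v) - f (x s) - nth_derivative k f (x s) (replicate k v) / fact k\<bar> \<le> e * norm v ^ k"
      using leading_term_expansion[OF D k vanish[OF st(1)] \<open>0 < e\<close>] by metis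
    obtain w where w: "norm w = 1" "\<bar>nth_derivative k f (x s) (replicate k w)\<bar> = \<nu> s"
      using nth_derivative_norm_bound(2)[OF D, of "x s"] unfolding \<nu>_def by blast
    have "norm (r *\<^sub>R w) \<le> r \<and> (\<nu> s / fact k - e) * r ^ k \<le> \<bar>f (x s + r *\<^sub>R w) - f (x s)\<bar>" if r: "0 < r" "r < d" for r
    proof -
      have "\<bar>nth_derivative k f (x s) (replicate k (r *\<^sub>R w)) / fact k\<bar> = \<nu> s / fact k * r ^ k"
        using multilinear_form_diagonal_scale[OF multilinear_nth_derivative[OF D order_refl], of "x s" r w] w(2) r
        by (simp add: abs_mult mult.commute)
      moreover have "\<bar>f (x s + r *\<^sub>R w) - f (x s) - nth_derivative k f (x s) (replicate k (r *\<^sub>R w)) / fact k\<bar> \<le> e * r ^ k"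
        using d(2)[of "r *\<^sub>R w"] r w by simp
      ultimately show ?thesis using r w(1) unfolding left_diff_distrib by (intro conjI) (simp, linarith)
    qed
    with d(1) show "\<exists>\<delta>>0. \<forall>r. 0 < r \<longrightarrow> r < \<delta> \<longrightarrow>
        (\<exists>v. norm v \<le> r \<and> (\<nu> s / fact k - e) * r ^ k \<le> \<bar>f (x s + v) - f (x s)\<bar>)" by blast
  qed
qed

end

section \<open>Decay of the Lipschitz modulus\<close>

lemma lip_le:
  assumes "0 < \<delta>" and "\<And>y z. y \<in> ball x \<delta> \<Longrightarrow> z \<in> ball x \<delta> \<Longrightarrow> \<bar>f y - f z\<bar> \<le> a * norm (y - z)"
  shows "lip f x \<le> ereal a"
  unfolding lip_def
proof (rule Limsup_bounded)
  show "\<forall>\<^sub>F p in at (x, x) within {p. fst p \<noteq> snd p}.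
      ereal (\<bar>f (fst p) - f (snd p)\<bar> / norm (fst p - snd p)) \<le> ereal a"
    unfolding eventually_at
  proof (intro exI[of _ \<delta>] conjI ballI impI \<open>0 < \<delta>\<close>)
    fix p assume p: "p \<in> {p. fst p \<noteq> snd p}" "p \<noteq> (x, x) \<and> dist p (x, x) < \<delta>"
    have "dist (fst p) x < \<delta>" "dist (snd p) x < \<delta>"
      using dist_fst_le[of p "(x, x)"] dist_snd_le[of p "(x, x)"] p(2) by auto
    then have "\<bar>f (fst p) - f (snd p)\<bar> \<le> a * norm (fst p - snd p)" by (intro assms(2)) (auto simp: dist_commute)
    then show "ereal (\<bar>f (fst p) - f (snd p)\<bar> / norm (fst p - snd p)) \<le> ereal a"
      using p(1) by (simp add: pos_divide_le_eq)
  qed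
qed

lemma lip_lessD:
  assumes "lip f x < ereal a"
  obtains \<delta> where "0 < \<delta>" "\<And>y z. y \<in> ball x \<delta> \<Longrightarrow> z \<in> ball x \<delta> \<Longrightarrow> \<bar>f y - f z\<bar> \<le> a * norm (y - z)"
proof -
  have "\<forall>\<^sub>F p in at (x, x) within {p. fst p \<noteq> snd p}.
      ereal (\<bar>f (fst p) - f (snd p)\<bar> / norm (fst p - snd p)) < ereal a"
    using assms unfolding lip_def by (rule Limsup_lessD)
  then obtain d where d: "0 < d" "\<And>p. fst p \<noteq> snd p \<Longrightarrow> p \<noteq> (x, x) \<Longrightarrow> dist p (x, x) < d \<Longrightarrow>
      \<bar>f (fst p) - f (snd p)\<bar> / norm (fst p - snd p) < a"
    unfolding eventually_at by auto
  have "\<bar>f y - f z\<bar> \<le> a * norm (y - z)" if yz: "y \<in> ball x (d / 2)" "z \<in> ball x (d / 2)" for y z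
  proof (cases "y = z")
    case False
    have "dist (y, z) (x, x) \<le> norm (y - x) + norm (z - x)"
      unfolding dist_norm using norm_Pair_le[of "y - x" "z - x"] by simp
    also have "\<dots> < d" using yz by (simp add: dist_norm norm_minus_commute)
    finally have "\<bar>f y - f z\<bar> / norm (y - z) < a" using d(2)[of "(y, z)"] False by auto
    then show ?thesis using False by (simp add: pos_divide_less_eq)
  qed simp
  with d(1) that[of "d / 2"] show ?thesis by simp
qed

text \<open>Off-diagonal pairs accumulate at \<open>(x, x)\<close>, so the filter is proper; over a
  trivial filter the upper limit would be minus infinity.\<close>

lemma lip_nonneg: "0 \<le> lip f (x :: 'a::euclidean_space)"
  unfolding lip_def
proof (rule le_Limsup)
  have "(x, x) islimpt {p. fst p \<noteq> snd p}"
    unfolding islimpt_approachable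
  proof (intro allI impI)
    fix e :: real assume "0 < e"
    obtain b :: 'a where b: "norm b = 1" using norm_Basis nonempty_Basis by blast
    have "dist (x + (e / 2) *\<^sub>R b, x) (x, x) < e" "b \<noteq> 0" using b \<open>0 < e\<close> by (auto simp: dist_norm)
    then show "\<exists>p\<in>{p. fst p \<noteq> snd p}. p \<noteq> (x, x) \<and> dist p (x, x) < e"
      using \<open>0 < e\<close> by (intro bexI[of _ "(x + (e / 2) *\<^sub>R b, x)"]) auto
  qed
  then show "at (x, x) within {p. fst p \<noteq> snd p} \<noteq> bot" by (simp add: trivial_limit_within)
qed simp

lemma lip_real:
  fixes f :: "'a::euclidean_space \<Rightarrow> real"
  assumes "locally_Lipschitz f"
  obtains l where "lip f x = ereal l" "0 \<le> l"
proof -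
  obtain r L where r: "0 < r" "L-lipschitz_on (ball x r) f"
    using assms unfolding locally_Lipschitz_def by blast
  have "lip f x \<le> ereal L"
    by (rule lip_le[OF r(1)]) (use lipschitz_onD[OF r(2)] in \<open>simp add: dist_norm\<close>)
  then show ?thesis using lip_nonneg[of f x] that by (cases "lip f x") auto
qed

text \<open>A modulus 0 at \<open>q\<close> means arbitrarily small Lipschitz constants near
  \<open>q\<close>, and composing with a map of fixed Lipschitz constant keeps them arbitrarily
  small near \<open>p\<close>. As with derivatives, this moves positivity from
  \<open>t\<^sub>0\<close> to \<open>s\<close>.\<close>

lemma lip_pos_germ_related:
  fixes f :: "'a::euclidean_space \<Rightarrow> real"
  assumes rel: "germ_related f p q" and pos: "0 < lip f p"
  shows "0 < lip f q"
proof (rule ccontr)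
  assume "\<not> ?thesis"
  then have q: "lip f q \<le> 0" by simp
  obtain \<phi> \<eta> K where \<phi>: "0 < \<eta>" "\<phi> p = q" "K-lipschitz_on (ball p \<eta>) \<phi>" "\<And>y. y\<in>ball p \<eta> \<Longrightarrow> f (\<phi> y) = f y"
    using rel by (auto simp: germ_related_def germ_map_def)
  have K: "0 \<le> K" using \<phi>(3) by (rule lipschitz_on_nonneg)
  have "lip f p \<le> ereal (c * K)" if "0 < c" for c
  proof -
    have "lip f q < ereal c" using q that by (simp add: order_le_less_trans)
    then obtain \<delta> where \<delta>: "0 < \<delta>" "\<And>y z. y \<in> ball q \<delta> \<Longrightarrow> z \<in> ball q \<delta> \<Longrightarrow> \<bar>f y - f z\<bar> \<le> c * norm (y - z)"
      using lip_lessD by metis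
    have "isCont \<phi> p" using lipschitz_on_continuous_on[OF \<phi>(3)] \<phi>(1)
      by (metis centre_in_ball continuous_on_eq_continuous_at open_ball)
    then obtain d where d: "0 < d" "\<And>y. dist y p < d \<Longrightarrow> dist (\<phi> y) q < \<delta>"
      unfolding continuous_at_eps_delta \<phi>(2) using \<delta>(1) by blast
    show ?thesis
    proof (rule lip_le)
      show "0 < min d \<eta>" using d \<phi> by simp
      fix y z assume yz: "y \<in> ball p (min d \<eta>)" "z \<in> ball p (min d \<eta>)"
      have "\<bar>f (\<phi> y) - f (\<phi> z)\<bar> \<le> c * norm (\<phi> y - \<phi> z)"
        using d(2)[of y] d(2)[of z] yz by (intro \<delta>(2)) (auto simp: dist_commute)
      also have "\<dots> \<le> c * (K * norm (y - z))"
        using lipschitz_onD[OF \<phi>(3), of y z] yz \<open>0 < c\<close> by (intro mult_left_mono) (auto simp: dist_norm)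
      finally show "\<bar>f y - f z\<bar> \<le> c * K * norm (y - z)" using \<phi>(4) yz by simp
    qed
  qed
  note le = this
  have "lip f p \<le> ereal (1 * K)" by (rule le) simp
  then obtain l where l: "lip f p = ereal l" "0 < l" using pos by (cases "lip f p") auto
  define c where "c = l / (K + 1)"
  have c: "0 < c" "c * (K + 1) = l" using K l(2) by (auto simp: c_def)
  have "l \<le> c * K" using le[OF c(1)] l(1) by simp
  moreover have "l = c * K + c" using c(2) by (simp add: distrib_left)
  ultimately show False using c(1) by simp
qed

context regular_Lipschitz begin

text \<open>The modulus compares two moving points, whereas \<open>local_variation\<close> keeps one
  of them at the centre. The directions of nearly optimal secants accumulate at some
  \<open>w\<close> by compactness, and regularity turns these secants into a slope along the ray
  from \<open>x\<close> in that direction.\<close>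

lemma lip_attained:
  assumes l: "lip f x = ereal l" and "0 < e"
  obtains w where "norm w = 1" "\<forall>\<^sub>F t in at_right 0. (l - e) * t \<le> f (x + t *\<^sub>R w) - f x"
proof -
  obtain r L where r: "0 < r" "L-lipschitz_on (ball x r) f"
    using lip unfolding locally_Lipschitz_def by blast
  have L: "0 \<le> L" using r(2) by (rule lipschitz_on_nonneg)
  have "\<exists>p q. p \<in> ball x \<delta> \<and> q \<in> ball x \<delta> \<and> (l - e / 4) * norm (p - q) < f p - f q" if "0 < \<delta>" for \<delta>
  proof (rule ccontr)
    assume "\<not> ?thesis"
    then have *: "f p - f q \<le> (l - e / 4) * norm (p - q)" if "p \<in> ball x \<delta>" "q \<in> ball x \<delta>" for p q
      using that by (meson not_less)
    have "lip f x \<le> ereal (l - e / 4)"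
    proof (rule lip_le[OF \<open>0 < \<delta>\<close>])
      fix y z assume yz: "y \<in> ball x \<delta>" "z \<in> ball x \<delta>"
      show "\<bar>f y - f z\<bar> \<le> (l - e / 4) * norm (y - z)"
        using *[OF yz] *[OF yz(2,1)] by (simp add: abs_le_iff norm_minus_commute)
    qed
    with l \<open>0 < e\<close> show False by simp
  qed
  then have "\<exists>p q. p \<in> ball x (r * inverse (real (Suc n))) \<and> q \<in> ball x (r * inverse (real (Suc n))) \<and>
      (l - e / 4) * norm (p - q) < f p - f q" for n
    using r(1) by simp
  then obtain p q where pq: "\<And>n. p n \<in> ball x (r * inverse (real (Suc n)))" "\<And>n. q n \<in> ball x (r * inverse (real (Suc n)))"
    "\<And>n. (l - e / 4) * norm (p n - q n) < f (p n) - f (q n)" by metis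
  define W where "W n = (p n - q n) /\<^sub>R norm (p n - q n)" for n
  have ne: "p n \<noteq> q n" for n using pq(3)[of n] by auto
  have W: "W n \<in> sphere 0 1" "q n + norm (p n - q n) *\<^sub>R W n = p n" for n using ne[of n] by (auto simp: W_def)
  have "compact (sphere (0::'a) 1)" by simp
  then obtain w \<phi> where w: "w \<in> sphere 0 1" "strict_mono (\<phi> :: nat \<Rightarrow> nat)" "(W \<circ> \<phi>) \<longlonglongrightarrow> w"
    using W(1) unfolding compact_def by meson
  have "\<forall>\<^sub>F t in at_right 0. (l - e / 2 - e / 2) * t \<le> f (x + t *\<^sub>R w) - f x"
  proof (rule subdiff_regular_strict_slope[OF lip])
    show "subdiff_regular_at f x" using reg by (simp add: subdiff_regular_def)
    show "0 < e / 2" using \<open>0 < e\<close> by simp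
    fix \<delta> :: real assume "0 < \<delta>"
    \<comment> \<open>Replacing the direction of a secant by its limit \<open>w\<close> changes
      \<open>f\<close> by at most \<open>L * c\<close> per unit of length, hence by at most
      \<open>e / 4\<close>.\<close>
    define c where "c = e / (4 * (L + 1))"
    have c: "0 < c" using \<open>0 < e\<close> L by (simp add: c_def)
    have cL: "L * c \<le> e / 4" using \<open>0 < e\<close> L by (simp add: c_def field_simps)
    have "\<forall>\<^sub>F n in sequentially. dist ((W \<circ> \<phi>) n) w < c" using w(3) c by (rule tendstoD)
    moreover have "(\<lambda>n. 4 * r * inverse (real (Suc n))) \<longlonglongrightarrow> 4 * r * 0"
      by (intro tendsto_intros LIMSEQ_inverse_real_of_nat)
    then have "\<forall>\<^sub>F n in sequentially. 4 * r * inverse (real (Suc n)) < min r \<delta>"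
      using \<open>0 < \<delta>\<close> r(1) by (intro order_tendstoD(2)) auto
    then have "\<forall>\<^sub>F n in sequentially. 4 * r * inverse (real (Suc (\<phi> n))) < min r \<delta>"
      by (rule eventually_subseq[OF w(2)])
    ultimately have "\<forall>\<^sub>F n in sequentially. dist ((W \<circ> \<phi>) n) w < c \<and> 4 * r * inverse (real (Suc (\<phi> n))) < min r \<delta>"
      by eventually_elim auto
    then obtain n where "dist ((W \<circ> \<phi>) n) w < c \<and> 4 * r * inverse (real (Suc (\<phi> n))) < min r \<delta>"
      using eventually_happens trivial_limit_sequentially by blast
    then obtain m where m: "norm (W m - w) < c" "4 * (r * inverse (real (Suc m))) < min r \<delta>"
      by (auto simp: dist_norm)
    define s where "s = r * inverse (real (Suc m))"
    have s0: "0 < s" using r(1) by (simp add: s_def)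
    have s: "4 * s < r" "4 * s < \<delta>" using m(2) by (auto simp: s_def)
    have near: "norm (p m - x) < s" "norm (q m - x) < s"
      using pq(1)[of m] pq(2)[of m] by (auto simp: s_def dist_norm norm_minus_commute)
    define t where "t = norm (p m - q m)"
    have t: "0 < t" "t < 2 * s"
      using ne[of m] near norm_triangle_ineq4[of "p m - x" "q m - x"] by (auto simp: t_def)
    have "norm (q m + t *\<^sub>R w - x) \<le> norm (q m - x) + t"
      using norm_triangle_ineq[of "q m - x" "t *\<^sub>R w"] w(1) t by (simp add: algebra_simps)
    then have mem: "q m + t *\<^sub>R w \<in> ball x r" "p m \<in> ball x r"
      using near t s s0 by (auto simp: dist_norm norm_minus_commute)
    have "\<bar>f (p m) - f (q m + t *\<^sub>R w)\<bar> \<le> L * norm (p m - (q m + t *\<^sub>R w))"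
      using lipschitz_onD[OF r(2) mem(2,1)] by (simp add: dist_norm)
    also have "p m - (q m + t *\<^sub>R w) = t *\<^sub>R (W m - w)"
      by (subst W(2)[of m, folded t_def, symmetric]) (simp add: scaleR_diff_right)
    also have "L * norm (t *\<^sub>R (W m - w)) \<le> L * (t * c)"
      using m(1) t L by (intro mult_left_mono) auto
    also have "\<dots> \<le> e / 4 * t" using mult_right_mono[OF cL, of t] t by (simp add: mult_ac)
    finally have "\<bar>f (p m) - f (q m + t *\<^sub>R w)\<bar> \<le> e / 4 * t" .
    moreover have "(l - e / 4) * t < f (p m) - f (q m)" using pq(3)[of m] by (simp add: t_def)
    moreover have "(l - e / 2) * t = (l - e / 4) * t - e / 4 * t" by (simp add: algebra_simps)
    ultimately have "(l - e / 2) * t < f (q m + t *\<^sub>R w) - f (q m)" by linarith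
    then show "\<exists>y\<in>ball x \<delta>. \<exists>t\<in>{0<..<\<delta>}. (l - e / 2) * t < f (y + t *\<^sub>R w) - f y"
      using near t s s0 by (intro bexI[of _ "q m"] bexI[of _ t]) (auto simp: dist_norm norm_minus_commute)
  qed
  with that[of w] w(1) show ?thesis by simp
qed

end

context curvature_flow begin

text \<open>At a differentiability point near \<open>x b\<close> with gradient \<open>v\<close>,
  small steps along \<open>v\<close> are shrunk by \<open>\<phi>\<close>, while \<open>f\<close> is
  unchanged and has Lipschitz constant \<open>c\<close> near \<open>x a\<close>; so
  \<open>norm v\<close> is at most \<open>\<mu> * c\<close>. Secants are no steeper than nearby
  gradients, so \<open>\<mu> * c\<close> is a Lipschitz constant near \<open>x b\<close>.\<close>

lemma lip_contraction:
  assumes reg: "regular_Lipschitz f" and con: "contracts a b"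
    and la: "lip f (x a) = ereal la" and lb: "lip f (x b) = ereal lb"
  shows "lb \<le> (1 - (b - a) * \<omega> / 2) * la"
proof -
  interpret regular_Lipschitz f by (rule reg)
  define \<mu> where "\<mu> = 1 - (b - a) * \<omega> / 2"
  have \<mu>: "0 < \<mu>" using con by (simp add: contracts_def \<mu>_def)
  have la0: "0 \<le> la" using lip_nonneg[of f "x a"] la by simp
  obtain \<phi> \<eta> K where \<phi>: "germ_map f (x b) (x a) \<phi> \<eta> K" and U': "ball (x b) \<eta> \<subseteq> U" and
    shrink: "\<And>y z p. y \<in> ball (x b) \<eta> \<Longrightarrow> z \<in> ball (x b) \<eta> \<Longrightarrow> p \<in> ball (x b) \<eta> \<Longrightarrow>
       H p (y - z) \<bullet> (y - z) \<le> - \<omega> * (norm (y - z))\<^sup>2 \<Longrightarrow> norm (\<phi> y - \<phi> z) \<le> \<mu> * norm (y - z)"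
    using con unfolding contracts_def \<mu>_def[symmetric] by blast
  have \<phi>: "0 < \<eta>" "\<phi> (x b) = x a" "K-lipschitz_on (ball (x b) \<eta>) \<phi>" "\<And>y. y \<in> ball (x b) \<eta> \<Longrightarrow> f (\<phi> y) = f y"
    using \<phi> by (auto simp: germ_map_def)
  have "lb \<le> \<mu> * c" if c: "la < c" for c
  proof -
    obtain \<delta> where \<delta>: "0 < \<delta>" "\<And>y z. y \<in> ball (x a) \<delta> \<Longrightarrow> z \<in> ball (x a) \<delta> \<Longrightarrow> \<bar>f y - f z\<bar> \<le> c * norm (y - z)"
      using lip_lessD[of f "x a" c] la c by auto
    have "isCont \<phi> (x b)" using lipschitz_on_continuous_on[OF \<phi>(3)] \<phi>(1)
      by (metis centre_in_ball continuous_on_eq_continuous_at open_ball)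
    then obtain d0 where d0: "0 < d0" "\<And>y. dist y (x b) < d0 \<Longrightarrow> dist (\<phi> y) (x a) < \<delta>"
      unfolding continuous_at_eps_delta \<phi>(2) using \<delta>(1) by blast
    define d where "d = min d0 \<eta>"
    have d: "0 < d" "ball (x b) d \<subseteq> ball (x b) \<eta>" using d0 \<phi>(1) by (auto simp: d_def)
    have im: "\<phi> y \<in> ball (x a) \<delta>" if "y \<in> ball (x b) d" for y
      using d0(2)[of y] that by (auto simp: d_def dist_commute)
    have grad: "norm v \<le> \<mu> * c"
      if z: "z \<in> ball (x b) d" and v: "GDERIV f z :> v" "v \<in> limiting_gradients f z" for z v
    proof -
      have zU: "z \<in> U" using z d(2) U' by blast
      have lin: "linear (H z)" using bounded_linear_H[OF zU] bounded_linear.linear by blast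
      have "v \<bullet> v \<le> \<mu> * c * norm v"
      proof (rule gderiv_inner_le[OF v(1)])
        obtain e where e: "0 < e" "ball z e \<subseteq> ball (x b) d" using z open_ball open_contains_ball by metis
        have pos: "0 < 1 + norm v" by (simp add: add_pos_nonneg)
        show "\<forall>\<^sub>F t in at_right 0. f (z + t *\<^sub>R v) - f z \<le> \<mu> * c * norm v * t"
          unfolding eventually_at_right_field
        proof (intro exI[of _ "e / (1 + norm v)"] conjI allI impI)
          fix t assume t: "0 < t" "t < e / (1 + norm v)"
          then have "t * norm v < e" using pos by (simp add: pos_less_divide_eq algebra_simps)
          then have "z + t *\<^sub>R v \<in> ball z e" using t by (simp add: dist_norm)
          then have y: "z + t *\<^sub>R v \<in> ball (x b) d" using e(2) by blast
          have "t\<^sup>2 * (H z v \<bullet> v) \<le> t\<^sup>2 * (- \<omega> * (norm v)\<^sup>2)"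
            using curv[OF zU v(2)] by (rule mult_left_mono) simp
          then have "H z (z + t *\<^sub>R v - z) \<bullet> (z + t *\<^sub>R v - z) \<le> - \<omega> * (norm (z + t *\<^sub>R v - z))\<^sup>2"
            by (simp add: linear_scale[OF lin] power_mult_distrib power2_eq_square mult_ac)
          then have "norm (\<phi> (z + t *\<^sub>R v) - \<phi> z) \<le> \<mu> * norm (z + t *\<^sub>R v - z)"
            using y z d(2) by (intro shrink) auto
          then have "norm (\<phi> (z + t *\<^sub>R v) - \<phi> z) \<le> \<mu> * (t * norm v)" using t by simp
          then have "c * norm (\<phi> (z + t *\<^sub>R v) - \<phi> z) \<le> c * (\<mu> * (t * norm v))"
            using c la0 by (intro mult_left_mono) auto
          moreover have "\<bar>f (\<phi> (z + t *\<^sub>R v)) - f (\<phi> z)\<bar> \<le> c * norm (\<phi> (z + t *\<^sub>R v) - \<phi> z)"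
            by (rule \<delta>(2)[OF im[OF y] im[OF z]])
          moreover have "f (\<phi> (z + t *\<^sub>R v)) = f (z + t *\<^sub>R v)" "f (\<phi> z) = f z"
            using \<phi>(4) y z d(2) by blast+
          ultimately show "f (z + t *\<^sub>R v) - f z \<le> \<mu> * c * norm v * t" by (simp add: mult_ac)
        qed (use e pos in simp)
      qed
      then have "norm v * norm v \<le> norm v * (\<mu> * c)"
        by (simp add: power2_norm_eq_inner[symmetric] power2_eq_square mult_ac)
      then show ?thesis using \<mu> c la0 by (cases "v = 0") auto
    qed
    have le: "f p - f q \<le> \<mu> * c * norm (p - q)" if pq: "p \<in> ball (x b) d" "q \<in> ball (x b) d" for p q
    proof (rule ccontr)
      assume "\<not> ?thesis"
      then have gt: "\<mu> * c * norm (p - q) < f p - f q" by simp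
      then have n: "0 < norm (p - q)" by auto
      define m where "m = (f p - f q) / norm (p - q)"
      have "\<mu> * c < m" using gt n by (simp add: m_def pos_less_divide_eq)
      then obtain a' where a': "\<mu> * c < a'" "a' < m" using dense by blast
      have steep: "a' * norm (p - q) < f p - f q" using a'(2) n by (simp add: m_def pos_less_divide_eq)
      have "closed_segment p q \<subseteq> ball (x b) d" using pq by (intro closed_segment_subset) auto
      from gradient_ge_lip[OF d(1) steep this] obtain z where
        z: "z \<in> ball (x b) d" "GDERIV f z :> gradient f z" "gradient f z \<in> limiting_gradients f z" "a' \<le> norm (gradient f z)"
        by metis
      from grad[OF z(1-3)] z(4) a'(1) show False by simp
    qed
    have "lip f (x b) \<le> ereal (\<mu> * c)"
    proof (rule lip_le[OF d(1)])
      fix y z assume yz: "y \<in> ball (x b) d" "z \<in> ball (x b) d"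
      show "\<bar>f y - f z\<bar> \<le> \<mu> * c * norm (y - z)"
        using le[OF yz] le[OF yz(2,1)] by (simp add: abs_le_iff norm_minus_commute)
    qed
    then show ?thesis using lb by simp
  qed
  note * = this
  have "lb \<le> \<mu> * la"
  proof (rule field_le_epsilon)
    fix e :: real assume "0 < e"
    have "lb \<le> \<mu> * (la + e / \<mu>)" using \<mu> \<open>0 < e\<close> by (intro *) simp
    then show "lb \<le> \<mu> * la + e" using \<mu> by (simp add: distrib_left)
  qed
  then show ?thesis by (simp add: \<mu>_def)
qed

lemma regular_case:
  assumes rl: "regular_Lipschitz f" and t0: "t0 \<in> I" and st: "s \<in> I" "t \<in> I" "s < t"
  shows "lip f (x t) \<le> ereal (exp (- \<omega> * (t - s) / 2)) * lip f (x s)"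
    and "0 < lip f (x t0) \<Longrightarrow> flatter f (x t) (x s)"
proof -
  interpret regular_Lipschitz f by (rule rl)
  define l where "l t = real_of_ereal (lip f (x t))" for t
  have l: "lip f (x t) = ereal (l t)" "0 \<le> l t" for t
    using lip_real[OF lip, of "x t"] by (metis l_def real_of_ereal.simps(1))+
  have "l t \<le> exp (- real 1 * \<omega> * (t - s) / 2) * l s"
  proof (rule decay[OF _ l(2) st(1,2)])
    fix a b assume "contracts a b"
    then show "l b \<le> (1 - (b - a) * \<omega> / 2) ^ 1 * l a" using lip_contraction[OF rl _ l(1) l(1)] by simp
  qed (use st in simp)
  then have dec: "l t \<le> exp (- \<omega> * (t - s) / 2) * l s" by simp
  then show "lip f (x t) \<le> ereal (exp (- \<omega> * (t - s) / 2)) * lip f (x s)" by (simp add: l(1))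
  assume "0 < lip f (x t0)"
  then have "0 < lip f (x s)" using lip_pos_germ_related trajectory_germ_related[OF t0 st(1)] by blast
  then have pos: "0 < l s" by (simp add: l(1))
  have "exp (- \<omega> * (t - s) / 2) < 1" using \<omega> st(3) by simp
  then have "exp (- \<omega> * (t - s) / 2) * l s < 1 * l s" using pos by (rule mult_strict_right_mono)
  with dec have less: "l t < l s" by simp
  show "flatter f (x t) (x s)"
  proof (rule flatterI[where k = 1, OF _ less _ _ l(2)])
    show "continuous_on UNIV f" using continuous continuous_at_imp_continuous_on by blast
    fix e :: real assume "0 < e"
    have "lip f (x t) < ereal (l t + e)" using \<open>0 < e\<close> by (simp add: l(1))
    then obtain \<delta> where \<delta>: "0 < \<delta>" "\<And>y z. y \<in> ball (x t) \<delta> \<Longrightarrow> z \<in> ball (x t) \<delta> \<Longrightarrow> \<bar>f y - f z\<bar> \<le> (l t + e) * norm (y - z)"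
      using lip_lessD by metis
    have "\<bar>f (x t + v) - f (x t)\<bar> \<le> (l t + e) * norm v ^ 1" if "norm v < \<delta>" for v
      using \<delta>(2)[of "x t + v" "x t"] \<delta>(1) that by (simp add: dist_norm)
    with \<delta>(1) show "\<exists>\<delta>>0. \<forall>v. norm v < \<delta> \<longrightarrow> \<bar>f (x t + v) - f (x t)\<bar> \<le> (l t + e) * norm v ^ 1" by blast
    obtain w where w: "norm w = 1" "\<forall>\<^sub>F r in at_right 0. (l s - e) * r \<le> f (x s + r *\<^sub>R w) - f (x s)"
      using lip_attained[OF l(1) \<open>0 < e\<close>] by metis
    then obtain d where d: "0 < d" "\<And>r. 0 < r \<Longrightarrow> r < d \<Longrightarrow> (l s - e) * r \<le> f (x s + r *\<^sub>R w) - f (x s)"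
      unfolding eventually_at_right_field by blast
    have "norm (r *\<^sub>R w) \<le> r \<and> (l s - e) * r ^ 1 \<le> \<bar>f (x s + r *\<^sub>R w) - f (x s)\<bar>" if "0 < r" "r < d" for r
      using d(2)[OF that] w(1) that by simp
    with d(1) show "\<exists>\<delta>>0. \<forall>r. 0 < r \<longrightarrow> r < \<delta> \<longrightarrow>
        (\<exists>v. norm v \<le> r \<and> (l s - e) * r ^ 1 \<le> \<bar>f (x s + v) - f (x s)\<bar>)" by blast
  qed
qed

end

section \<open>The gradient flow\<close>

text \<open>Components of the gradient and entries of the Hessian are values of the first two
  iterated derivatives; in a list \<open>[v, b]\<close> the head \<open>v\<close> is the direction
  of the later differentiation. As the order exceeds 2, second derivatives are themselves
  differentiable, hence continuous.\<close>

lemma C_on_hessian: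
  fixes g :: "'a::euclidean_space \<Rightarrow> real"
  assumes C: "C_on k U g" and "2 < k" and U: "open U"
  shows "\<And>y. y \<in> U \<Longrightarrow> (gradient g has_derivative hessian g y) (at y)"
    and "continuous_on U (\<lambda>y. hessian g y a \<bullet> b)"
proof -
  have D: "D_at k g y" if "y \<in> U" for y using C that by (simp add: C_on_def)
  have grad: "gradient g y \<bullet> b = nth_derivative 1 g y [b]" if "y \<in> U" for y b
  proof -
    have "g differentiable (at y)" using D_at_le[OF D[OF that], of 1] \<open>2 < k\<close> by simp
    then have "(g has_derivative (\<lambda>h. h \<bullet> gradient g y)) (at y)"
      using differentiable_imp_gderiv by (auto simp: gderiv_def)
    then have "(\<lambda>h. h \<bullet> gradient g y) = frechet_derivative g (at y)" by (rule frechet_derivative_at)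
    then have "b \<bullet> gradient g y = frechet_derivative g (at y) b" by metis
    then show ?thesis by (simp add: inner_commute)
  qed
  have der: "(gradient g has_derivative (\<lambda>v. \<Sum>b\<in>Basis. nth_derivative 2 g y [v, b] *\<^sub>R b)) (at y)" if y: "y \<in> U" for y
    unfolding has_derivative_componentwise_within[of "gradient g"]
  proof
    fix b :: 'a assume b: "b \<in> Basis"
    have "((\<lambda>y. nth_derivative 1 g y [b]) has_derivative (\<lambda>v. nth_derivative (Suc 1) g y (v # [b]))) (at y)"
      using \<open>2 < k\<close> by (intro nth_derivative_has_derivative[OF D[OF y]]) auto
    then have "((\<lambda>y. gradient g y \<bullet> b) has_derivative (\<lambda>v. nth_derivative (Suc 1) g y (v # [b]))) (at y)"
      by (rule has_derivative_transform_within_open[OF _ U y]) (simp only: grad)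
    then show "((\<lambda>y. gradient g y \<bullet> b) has_derivative (\<lambda>v. (\<Sum>b\<in>Basis. nth_derivative 2 g y [v, b] *\<^sub>R b) \<bullet> b)) (at y)"
      using b by (simp add: inner_sum_left_Basis numeral_2_eq_2 del: nth_derivative.simps)
  qed
  have hess: "hessian g y = (\<lambda>v. \<Sum>b\<in>Basis. nth_derivative 2 g y [v, b] *\<^sub>R b)" if "y \<in> U" for y
    unfolding hessian_def using frechet_derivative_at[OF der[OF that]] by simp
  show "\<And>y. y \<in> U \<Longrightarrow> (gradient g has_derivative hessian g y) (at y)" using der hess by simp
  have "continuous_on U (\<lambda>y. nth_derivative 2 g y [a, c])" for c
  proof (rule continuous_at_imp_continuous_on, rule ballI)
    fix y assume "y \<in> U"
    show "isCont (\<lambda>y. nth_derivative 2 g y [a, c]) y"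
      by (rule has_derivative_continuous[OF nth_derivative_has_derivative[OF D[OF \<open>y \<in> U\<close>] \<open>2 < k\<close>]]) simp
  qed
  then have "continuous_on U (\<lambda>y. (\<Sum>c\<in>Basis. nth_derivative 2 g y [a, c] *\<^sub>R c) \<bullet> b)"
    by (intro continuous_intros)
  then show "continuous_on U (\<lambda>y. hessian g y a \<bullet> b)"
    by (rule continuous_on_eq) (simp add: hess)
qed

lemma constant_along_orthogonal_solution:
  fixes f :: "'a::euclidean_space \<Rightarrow> real"
  assumes diff: "\<And>y. y \<in> U \<Longrightarrow> f differentiable (at y)" and orth: "\<And>y. y \<in> U \<Longrightarrow> G y \<bullet> gradient f y = 0"
    and "0 \<le> h" and u: "solves_ode G U h u"
  shows "f (u h) = f (u 0)"
proof -
  have "\<exists>c. \<forall>t\<in>{0..h}. f (u t) = c"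
  proof (rule has_derivative_zero_constant)
    fix t assume t: "t \<in> {0..h}"
    have "(f has_derivative (\<lambda>v. v \<bullet> gradient f (u t))) (at (u t))"
      using differentiable_imp_gderiv[OF diff[OF solves_odeD(1)[OF u t]]] by (simp add: gderiv_def)
    from has_derivative_compose[OF solves_odeD(2)[OF u t, unfolded has_vector_derivative_def] this]
    show "((\<lambda>t. f (u t)) has_derivative (\<lambda>_. 0)) (at t within {0..h})"
      using orth[OF solves_odeD(1)[OF u t]] by simp
  qed simp
  then obtain c where "\<And>t. t \<in> {0..h} \<Longrightarrow> f (u t) = c" by blast
  then show ?thesis using \<open>0 \<le> h\<close> by simp
qed

text \<open>Monotonicity is applied to the solution and to its reversal, which solves the equation
  for \<open>- G\<close>; orthogonality is insensitive to the sign.\<close>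

lemma (in regular_Lipschitz) constant_along_solution:
  assumes "open U" and G: "\<And>y. y \<in> U \<Longrightarrow> isCont G y"
    and orth: "\<And>z v. z \<in> U \<Longrightarrow> v \<in> limiting_gradients f z \<Longrightarrow> G z \<bullet> v = 0"
    and "0 \<le> h" and u: "solves_ode G U h u"
  shows "f (u h) = f (u 0)"
proof (rule antisym)
  show "f (u 0) \<le> f (u h)"
    using solves_odeD[OF u] by (intro le_along_solution[OF assms(1) G orth assms(4)]) auto
  have "f ((\<lambda>t. u (h - t)) 0) \<le> f ((\<lambda>t. u (h - t)) h)"
    using solves_odeD[OF solves_ode_reverse[OF u]] G orth
    by (intro le_along_solution[OF assms(1) _ _ assms(4), of "\<lambda>y. - G y"]) (auto intro: continuous_minus)
  then show "f (u h) \<le> f (u 0)" by simp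
qed

theorem corollary4p8:
  fixes f :: "real ^ 'n \<Rightarrow> real"
    and c :: "real ^ 'n \<Rightarrow> ereal"
    and U :: "(real ^ 'n) set"
    and S :: "nat \<Rightarrow> real list set set"
    and \<omega> :: real
    and I :: "real set"
    and x :: "real \<Rightarrow> real ^ 'n"
    and s t t\<^sub>0 :: real
  assumes "o_minimal_structure S"
    and "definable_in S f"
    and "locally_Lipschitz f"
    and "bounded U" "convex U" "open U"
    and "\<forall>y. c y \<noteq> -\<infinity>"
    and "\<forall>y\<in>U. c y \<noteq> \<infinity>"
    and "C_on 4 U (\<lambda>y. real_of_ereal (c y))"
    and "\<omega> > 0"
    and "\<forall>y\<in>U. \<forall>v\<in>limiting_gradients f y.
           gradient (\<lambda>z. real_of_ereal (c z)) y \<bullet> v = 0 \<and>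
           hessian (\<lambda>z. real_of_ereal (c z)) y v \<bullet> v \<le> - \<omega> * (norm v)\<^sup>2"
    and "is_interval I" "compact I" "t\<^sub>0 \<in> I"
    and "x \<in> I \<rightarrow> U"
    and "\<forall>\<tau>\<in>I. (x has_vector_derivative
                   - gradient (\<lambda>z. real_of_ereal (c z)) (x \<tau>)) (at \<tau> within I)"
    and "s \<in> I" "t \<in> I" "s < t"
  shows "(subdiff_regular f \<longrightarrow>
            lip f (x t) \<le> ereal (exp (- \<omega> * (t - s) / 2)) * lip f (x s) \<and>
            (lip f (x t\<^sub>0) > 0 \<longrightarrow> flatter f (x t) (x s))) \<and>
         (\<forall>k\<ge>1. C_on (k + 1) U (\<lambda>y. real_of_ereal (c y)) \<longrightarrow>
            (\<forall>y. D_at k f y) \<longrightarrow>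
            (\<forall>i\<in>{1..k - 1}. \<forall>vs. length vs = i \<longrightarrow> nth_derivative i f (x t\<^sub>0) vs = 0) \<longrightarrow>
            nth_derivative_norm k f (x t)
              \<le> exp (- real k * \<omega> * (t - s) / 2) * nth_derivative_norm k f (x s) \<and>
            (nth_derivative_norm k f (x t\<^sub>0) > 0 \<longrightarrow> flatter f (x t) (x s)))"
proof -
  \<comment> \<open>At infinity \<open>real_of_ereal\<close> returns a default value, but
    \<open>U\<close> is open and \<open>c\<close> is finite on it, so derivatives at points of
    \<open>U\<close> see only true values.\<close>
  define g where "g = (\<lambda>z. real_of_ereal (c z))"
  have hess: "\<And>y. y \<in> U \<Longrightarrow> (gradient g has_derivative hessian g y) (at y)"
    and cont: "\<And>a b. continuous_on U (\<lambda>y. hessian g y a \<bullet> b)"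
    using C_on_hessian[OF assms(9) _ assms(6)] unfolding g_def by simp_all
  have orth: "gradient g y \<bullet> v = 0" and curv: "hessian g y v \<bullet> v \<le> - \<omega> * (norm v)\<^sup>2"
    if "y \<in> U" "v \<in> limiting_gradients f y" for y v
    using assms(11) that unfolding g_def by blast+
  \<comment> \<open>Everything except invariance of \<open>f\<close> is shared by the two
    cases.\<close>
  have flow: "curvature_flow f (gradient g) (hessian g) U \<omega> I x"
    if "\<And>h u. 0 \<le> h \<Longrightarrow> solves_ode (gradient g) U h u \<Longrightarrow> f (u h) = f (u 0)"
    using assms(6,10,12,15,16) hess cont curv that unfolding g_def
    by unfold_locales auto
  have reg: "lip f (x t) \<le> ereal (exp (- \<omega> * (t - s) / 2)) * lip f (x s) \<and>
      (lip f (x t\<^sub>0) > 0 \<longrightarrow> flatter f (x t) (x s))" if "subdiff_regular f"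
  proof -
    interpret regular_Lipschitz f using assms(3) that by unfold_locales
    interpret curvature_flow f "gradient g" "hessian g" U \<omega> I x
    proof (rule flow)
      fix h u assume "0 \<le> h" "solves_ode (gradient g) U h u"
      then show "f (u h) = f (u 0)"
        using orth has_derivative_continuous[OF hess] by (intro constant_along_solution[OF assms(6)])
    qed
    show ?thesis using regular_case[OF regular_Lipschitz_axioms assms(14,17,18,19)] by blast
  qed
  have smooth: "nth_derivative_norm k f (x t) \<le> exp (- real k * \<omega> * (t - s) / 2) * nth_derivative_norm k f (x s) \<and>
      (nth_derivative_norm k f (x t\<^sub>0) > 0 \<longrightarrow> flatter f (x t) (x s))"
    if k: "1 \<le> k" and D: "\<forall>y. D_at k f y"
      and van: "\<forall>i\<in>{1..k - 1}. \<forall>vs. length vs = i \<longrightarrow> nth_derivative i f (x t\<^sub>0) vs = 0" for k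
  proof -
    have D: "D_at k f y" for y using D by blast
    have diff: "f differentiable (at y)" for y using D_at_le[OF D k, of y] by simp
    interpret curvature_flow f "gradient g" "hessian g" U \<omega> I x
    proof (rule flow)
      fix h u assume h: "0 \<le> h" and u: "solves_ode (gradient g) U h u"
      show "f (u h) = f (u 0)"
      proof (rule constant_along_orthogonal_solution[OF diff _ h u])
        fix y assume "y \<in> U"
        then show "gradient g y \<bullet> gradient f y = 0"
          by (rule orth[OF _ gradient_in_limiting_gradients[OF diff]])
      qed
    qed
    \<comment> \<open>The hypothesis at \<open>t\<^sub>0\<close> is specialised to constant argument
      lists; for \<open>k = 1\<close> the range of orders is empty.\<close>
    have "lower_diagonals_vanish k f (x t\<^sub>0)"
      unfolding lower_diagonals_vanish_def
    proof (intro allI impI)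
      fix j e assume "0 < j" "j < k"
      then have "j \<in> {1..k - 1}" by auto
      with van show "nth_derivative j f (x t\<^sub>0) (replicate j e) = 0" by (metis length_replicate)
    qed
    then show ?thesis using smooth_case[OF D _ assms(14) _ assms(17,18,19)] k by simp
  qed
  show ?thesis using reg smooth by blast
qed

end
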